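(* Let $M$ be a 4-dimensional spacetime manifold, $\Lambda\in\mathbb{R}$, and let $g_{ab}(\lambda)$, $\lambda\ge 0$, be a one-parameter family of smooth Lorentzian metrics on $M$ satisfying assumptions (i)--(iv) listed in the context, with background metric $g^{(0)}_{ab}=g_{ab}(0)$. Let $t^{(0)}_{ab}$ be the effective gravitational stress-energy tensor (defined in the context) appearing in the background equation $$G_{ab}(g^{(0)})+\Lambda g^{(0)}_{ab}=8\pi T^{(0)}_{ab}+8\pi t^{(0)}_{ab}.$$ Then $t^{(0)}_{ab}$ is traceless with respect to the background metric: $$g^{(0)ab}\,t^{(0)}_{ab}=0 .$$
   Context: Signature is $(-,+,+,+)$; $G_{ab}(g)$ is the Einstein tensor of $g$ (conventions of Wald, General Relativity). Write $h_{ab}(\lambda)=g_{ab}(\lambda)-g^{(0)}_{ab}$. $\nabla_a$ is the derivative operator of $g^{(0)}_{ab}$; indices are raised and lowered with $g^{(0)}_{ab}$. Fix an arbitrary Riemannian metric $e_{ab}$ on $M$ and let $|t_{a_1\dots a_n}|^2=e^{a_1b_1}\cdots e^{a_nb_n}t_{a_1\dots a_n}t_{b_1\dots b_n}$ (the assumptions do not depend on the choice of $e_{ab}$, nor on the choice of $\lambda$-independent derivative operator). Weak limit: for tensor fields $A_{a_1\dots a_n}(\lambda)$, $\lambda>0$, $\operatorname{w-lim}_{\lambda\to0}A_{a_1\dots a_n}(\lambda)=B_{a_1\dots a_n}$ means $\lim_{\lambda\to0}\int f^{a_1\dots a_n}A_{a_1\dots a_n}(\lambda)=\int f^{a_1\dots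 a_n}B_{a_1\dots a_n}$ for all smooth compactly supported tensor fields $f^{a_1\dots a_n}$, with the volume element of $g^{(0)}_{ab}$. Assumptions: (i) For all $\lambda>0$, $G_{ab}(g(\lambda))+\Lambda g_{ab}(\lambda)=8\pi T_{ab}(\lambda)$, where $T_{ab}(\lambda)$ satisfies the weak energy condition: $T_{ab}(\lambda)t^at^b\ge0$ for all vectors $t^a$ timelike with respect to $g_{ab}(\lambda)$. (ii) There is a smooth positive function $C_1$ on $M$ with $|h_{ab}(\lambda,x)|\le\lambda C_1(x)$. (iii) There is a smooth positive function $C_2$ on $M$ with $|\nabla_ch_{ab}(\lambda,x)|\le C_2(x)$. (iv) There is a smooth tensor field $\mu_{abcdef}$ on $M$ with $\operatorname{w-lim}_{\lambda\to0}[\nabla_ah_{cd}(\lambda)\nabla_bh_{ef}(\lambda)]=\mu_{abcdef}$. Under (i)--(iv) the weak limit $T^{(0)}_{ab}=\operatorname{w-lim}_{\lambda\to0}T_{ab}(\lambda)$ exists. The effective gravitational stress-energy tensor $t^{(0)}_{ab}$ is the tensor determined by $8\pi t^{(0)}_{ab}=G_{ab}(g^{(0)})+\Lambda g^{(0)}_{ab}-8\pi T^{(0)}_{ab}$. *)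

theory Defs
  imports "HOL-Analysis.Analysis"
begin

text \<open>Iterated directional derivatives; meaningful for open \<open>S\<close>.\<close>

primrec Ck_on :: "nat \<Rightarrow> ('a::real_normed_vector) set \<Rightarrow> ('a \<Rightarrow> 'b::real_normed_vector) \<Rightarrow> bool" where
  "Ck_on 0 S f \<longleftrightarrow> continuous_on S f"
| "Ck_on (Suc k) S f \<longleftrightarrow>
     (\<forall>x\<in>S. f differentiable (at x)) \<and> (\<forall>v. Ck_on k S (\<lambda>x. frechet_derivative f (at x) v))"

definition smooth_on :: "('a::real_normed_vector) set \<Rightarrow> ('a \<Rightarrow> 'b::real_normed_vector) \<Rightarrow> bool" where
  "smooth_on S f \<longleftrightarrow> (\<forall>k. Ck_on k S f)"

text \<open>A chart is a pair of its domain and its coordinate map; the values of the coordinate map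
  outside the domain are irrelevant. A manifold is a topology together with a smooth atlas,
  which need not be maximal.\<close>

type_synonym 'a chart = "'a set \<times> ('a \<Rightarrow> real^4)"

abbreviation cdom :: "'a chart \<Rightarrow> 'a set" where "cdom c \<equiv> fst c"
abbreviation crd :: "'a chart \<Rightarrow> 'a \<Rightarrow> real^4" where "crd c \<equiv> snd c"
abbreviation cran :: "'a chart \<Rightarrow> (real^4) set" where "cran c \<equiv> crd c ` cdom c"
abbreviation cinv :: "'a chart \<Rightarrow> real^4 \<Rightarrow> 'a" where "cinv c \<equiv> inv_into (cdom c) (crd c)"

definition smooth_atlas :: "'a topology \<Rightarrow> 'a chart set \<Rightarrow> bool" where
  "smooth_atlas X A \<longleftrightarrow>
     (\<forall>c\<in>A. openin X (cdom c) \<and> open (cran c) \<and>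
        homeomorphic_map (subtopology X (cdom c)) (top_of_set (cran c)) (crd c)) \<and>
     (\<Union>c\<in>A. cdom c) = topspace X \<and>
     (\<forall>c\<in>A. \<forall>d\<in>A. smooth_on (crd c ` (cdom c \<inter> cdom d)) (crd d \<circ> cinv c))"

definition manifold4 :: "'a topology \<Rightarrow> 'a chart set \<Rightarrow> bool" where
  "manifold4 X A \<longleftrightarrow> Hausdorff_space X \<and> second_countable X \<and> smooth_atlas X A"

definition smooth_scalar :: "'a chart set \<Rightarrow> ('a \<Rightarrow> real) \<Rightarrow> bool" where
  "smooth_scalar A f \<longleftrightarrow> (\<forall>c\<in>A. smooth_on (cran c) (f \<circ> cinv c))"

text \<open>\<open>pd c i f p\<close> is the partial derivative of \<open>f\<close> at \<open>p\<close> with respect to the \<open>i\<close>-th coordinate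
  of the chart \<open>c\<close>; \<open>jac c d p i j\<close> is the derivative of the \<open>i\<close>-th coordinate of \<open>d\<close> with
  respect to the \<open>j\<close>-th coordinate of \<open>c\<close>.\<close>

definition pd :: "'a chart \<Rightarrow> 4 \<Rightarrow> ('a \<Rightarrow> real) \<Rightarrow> 'a \<Rightarrow> real" where
  "pd c i f p = frechet_derivative (f \<circ> cinv c) (at (crd c p)) (axis i 1)"

definition jac :: "'a chart \<Rightarrow> 'a chart \<Rightarrow> 'a \<Rightarrow> 4 \<Rightarrow> 4 \<Rightarrow> real" where
  "jac c d p i j = pd c j (\<lambda>q. crd d q $ i) p"

text \<open>A tensor field of rank \<open>k\<close> is the family of its components: \<open>T c p [i\<^sub>1, \<dots>, i\<^sub>k]\<close> is a
  component at \<open>p\<close> with respect to the coordinate basis of \<open>c\<close>. Components in different charts are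
  related by the tensor transformation law. Only charts of the atlas, points in their domains and
  index lists of length \<open>k\<close> matter.\<close>

type_synonym 'a tfield = "'a chart \<Rightarrow> 'a \<Rightarrow> 4 list \<Rightarrow> real"

definition idx :: "nat \<Rightarrow> 4 list set" where
  "idx k = {I. length I = k}"

definition cov_tensor :: "'a chart set \<Rightarrow> nat \<Rightarrow> 'a tfield \<Rightarrow> bool" where
  "cov_tensor A k T \<longleftrightarrow>
     (\<forall>c\<in>A. \<forall>d\<in>A. \<forall>p\<in>cdom c \<inter> cdom d. \<forall>I\<in>idx k.
        T d p I = (\<Sum>J\<in>idx k. (\<Prod>m<k. jac d c p (J!m) (I!m)) * T c p J))"

definition contra_tensor :: "'a chart set \<Rightarrow> nat \<Rightarrow> 'a tfield \<Rightarrow> bool" where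
  "contra_tensor A k F \<longleftrightarrow>
     (\<forall>c\<in>A. \<forall>d\<in>A. \<forall>p\<in>cdom c \<inter> cdom d. \<forall>I\<in>idx k.
        F d p I = (\<Sum>J\<in>idx k. (\<Prod>m<k. jac c d p (I!m) (J!m)) * F c p J))"

definition smooth_comps :: "'a chart set \<Rightarrow> nat \<Rightarrow> 'a tfield \<Rightarrow> bool" where
  "smooth_comps A k T \<longleftrightarrow> (\<forall>c\<in>A. \<forall>I\<in>idx k. smooth_on (cran c) (\<lambda>x. T c (cinv c x) I))"

definition smooth_cov_tensor :: "'a chart set \<Rightarrow> nat \<Rightarrow> 'a tfield \<Rightarrow> bool" where
  "smooth_cov_tensor A k T \<longleftrightarrow> cov_tensor A k T \<and> smooth_comps A k T"

definition test_tensor :: "'a topology \<Rightarrow> 'a chart set \<Rightarrow> nat \<Rightarrow> 'a tfield \<Rightarrow> bool" where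
  "test_tensor X A k F \<longleftrightarrow> contra_tensor A k F \<and> smooth_comps A k F \<and>
     (\<exists>K. compactin X K \<and> (\<forall>c\<in>A. \<forall>p\<in>cdom c - K. \<forall>I\<in>idx k. F c p I = 0))"

text \<open>The full contraction of a contravariant and a covariant tensor field, a scalar; its value
  does not depend on which chart around the point is used.\<close>

definition contract :: "'a chart set \<Rightarrow> nat \<Rightarrow> 'a tfield \<Rightarrow> 'a tfield \<Rightarrow> 'a \<Rightarrow> real" where
  "contract A k F T p =
     (let c = (SOME c. c \<in> A \<and> p \<in> cdom c) in \<Sum>I\<in>idx k. F c p I * T c p I)"

definition mat_of :: "'a tfield \<Rightarrow> 'a chart \<Rightarrow> 'a \<Rightarrow> real^4^4" where
  "mat_of g c p = (\<chi> i j. g c p [i, j])"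

definition inv_metric :: "'a tfield \<Rightarrow> 'a chart \<Rightarrow> 'a \<Rightarrow> 4 \<Rightarrow> 4 \<Rightarrow> real" where
  "inv_metric g c p i j = matrix_inv (mat_of g c p) $ i $ j"

definition minkowski :: "real^4^4" where
  "minkowski = (\<chi> i j. if i = j then (if i = 0 then - 1 else 1) else 0)"

text \<open>The columns of \<open>E\<close> below form an orthonormal basis of the tangent space. The type \<open>4\<close> is
  the integers modulo 4, so \<open>0\<close> is one of its four elements.\<close>

definition lorentzian_metric :: "'a chart set \<Rightarrow> 'a tfield \<Rightarrow> bool" where
  "lorentzian_metric A g \<longleftrightarrow> smooth_cov_tensor A 2 g \<and>
     (\<forall>c\<in>A. \<forall>p\<in>cdom c.
        (\<forall>i j. g c p [i, j] = g c p [j, i]) \<and>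
        (\<exists>E. transpose E ** mat_of g c p ** E = minkowski))"

definition riemannian_metric :: "'a chart set \<Rightarrow> 'a tfield \<Rightarrow> bool" where
  "riemannian_metric A e \<longleftrightarrow> smooth_cov_tensor A 2 e \<and>
     (\<forall>c\<in>A. \<forall>p\<in>cdom c.
        (\<forall>i j. e c p [i, j] = e c p [j, i]) \<and>
        (\<forall>v. v \<noteq> 0 \<longrightarrow> v \<bullet> (mat_of e c p *v v) > 0))"

definition tnorm :: "'a tfield \<Rightarrow> nat \<Rightarrow> 'a tfield \<Rightarrow> 'a chart \<Rightarrow> 'a \<Rightarrow> real" where
  "tnorm e k T c p =
     sqrt (\<Sum>I\<in>idx k. \<Sum>J\<in>idx k. (\<Prod>m<k. inv_metric e c p (I!m) (J!m)) * T c p I * T c p J)"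

text \<open>\<open>christoffel g c i j k p\<close> is \<open>\<Gamma>\<close> with upper index \<open>i\<close> and lower indices \<open>j k\<close>.\<close>

definition christoffel :: "'a tfield \<Rightarrow> 'a chart \<Rightarrow> 4 \<Rightarrow> 4 \<Rightarrow> 4 \<Rightarrow> 'a \<Rightarrow> real" where
  "christoffel g c i j k p = (1/2) * (\<Sum>l\<in>UNIV. inv_metric g c p i l *
     (pd c j (\<lambda>q. g c q [l, k]) p + pd c k (\<lambda>q. g c q [l, j]) p - pd c l (\<lambda>q. g c q [j, k]) p))"

text \<open>The derivative index comes first.\<close>

definition cov_deriv :: "'a tfield \<Rightarrow> 'a tfield \<Rightarrow> 'a tfield" where
  "cov_deriv g T c p J = (let m = hd J; I = tl J in
     pd c m (\<lambda>q. T c q I) p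
     - (\<Sum>r<length I. \<Sum>l\<in>UNIV. christoffel g c l m (I!r) p * T c p (I[r := l])))"

text \<open>\<open>riemann g c a b d e p\<close> has lower indices \<open>a b d\<close> and upper index \<open>e\<close>, with the sign
  convention \<open>\<nabla>\<^sub>a \<nabla>\<^sub>b \<omega>\<^sub>d - \<nabla>\<^sub>b \<nabla>\<^sub>a \<omega>\<^sub>d = R\<^sub>a\<^sub>b\<^sub>d\<^sup>e \<omega>\<^sub>e\<close>; the Ricci tensor contracts the second
  lower index with the upper one.\<close>

definition riemann :: "'a tfield \<Rightarrow> 'a chart \<Rightarrow> 4 \<Rightarrow> 4 \<Rightarrow> 4 \<Rightarrow> 4 \<Rightarrow> 'a \<Rightarrow> real" where
  "riemann g c a b d e p =
     pd c b (christoffel g c e a d) p - pd c a (christoffel g c e b d) p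
     + (\<Sum>f\<in>UNIV. christoffel g c f a d p * christoffel g c e f b p
                 - christoffel g c f b d p * christoffel g c e f a p)"

definition ricci :: "'a tfield \<Rightarrow> 'a chart \<Rightarrow> 'a \<Rightarrow> 4 \<Rightarrow> 4 \<Rightarrow> real" where
  "ricci g c p a d = (\<Sum>b\<in>UNIV. riemann g c a b d b p)"

definition scalar_curv :: "'a tfield \<Rightarrow> 'a chart \<Rightarrow> 'a \<Rightarrow> real" where
  "scalar_curv g c p = (\<Sum>a\<in>UNIV. \<Sum>b\<in>UNIV. inv_metric g c p a b * ricci g c p a b)"

definition einstein :: "'a tfield \<Rightarrow> 'a chart \<Rightarrow> 'a \<Rightarrow> 4 \<Rightarrow> 4 \<Rightarrow> real" where
  "einstein g c p a b = ricci g c p a b - (1/2) * scalar_curv g c p * g c p [a, b]"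

definition metric_trace :: "'a tfield \<Rightarrow> 'a tfield \<Rightarrow> 'a chart \<Rightarrow> 'a \<Rightarrow> real" where
  "metric_trace g T c p = (\<Sum>a\<in>UNIV. \<Sum>b\<in>UNIV. inv_metric g c p a b * T c p [a, b])"

text \<open>The volume element of \<open>g\<close> as a Borel measure: \<open>sqrt \<bar>det g\<bar> d\<^sup>4x\<close> in every chart. The
  expressions in different charts agree by the change of variables formula, and countably many
  charts cover the manifold, so there is exactly one such measure.\<close>

definition is_volume :: "'a topology \<Rightarrow> 'a chart set \<Rightarrow> 'a tfield \<Rightarrow> 'a measure \<Rightarrow> bool" where
  "is_volume X A g \<nu> \<longleftrightarrow> space \<nu> = topspace X \<and> sets \<nu> = sigma_sets (topspace X) {U. openin X U} \<and>
     (\<forall>c\<in>A. \<forall>S\<in>sets \<nu>. S \<subseteq> cdom c \<longrightarrow>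
        emeasure \<nu> S =
          (\<integral>\<^sup>+x\<in>crd c ` S. ennreal (sqrt \<bar>det (mat_of g c (cinv c x))\<bar>) \<partial>lborel))"

definition volume :: "'a topology \<Rightarrow> 'a chart set \<Rightarrow> 'a tfield \<Rightarrow> 'a measure" where
  "volume X A g = (THE \<nu>. is_volume X A g \<nu>)"

text \<open>\<open>S\<close> is the family whose limit is taken, \<open>B\<close> the limit field, and \<open>g0\<close> supplies the volume
  element. For tensor fields with smooth components the integrands are continuous with compact
  support, hence integrable.\<close>

definition weak_limit ::
  "'a topology \<Rightarrow> 'a chart set \<Rightarrow> 'a tfield \<Rightarrow> nat \<Rightarrow> (real \<Rightarrow> 'a tfield) \<Rightarrow> 'a tfield \<Rightarrow> bool" where
  "weak_limit X A g0 k S B \<longleftrightarrow>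
     (\<forall>F. test_tensor X A k F \<longrightarrow>
        ((\<lambda>l. \<integral>p. contract A k F (S l) p \<partial>volume X A g0)
           \<longlongrightarrow> (\<integral>p. contract A k F B p \<partial>volume X A g0)) (at_right 0))"

definition perturbation :: "(real \<Rightarrow> 'a tfield) \<Rightarrow> real \<Rightarrow> 'a tfield" where
  "perturbation g l = (\<lambda>c p I. g l c p I - g 0 c p I)"

text \<open>The field with components \<open>\<nabla>\<^sub>a h\<^sub>c\<^sub>d \<nabla>\<^sub>b h\<^sub>e\<^sub>f\<close>, the indices being in the order \<open>a b c d e f\<close>.\<close>

definition grad_h_squared :: "(real \<Rightarrow> 'a tfield) \<Rightarrow> real \<Rightarrow> 'a tfield" where
  "grad_h_squared g l = (\<lambda>c p I.
     cov_deriv (g 0) (perturbation g l) c p [I!0, I!2, I!3] *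
     cov_deriv (g 0) (perturbation g l) c p [I!1, I!4, I!5])"

definition weak_energy_condition :: "'a chart set \<Rightarrow> 'a tfield \<Rightarrow> 'a tfield \<Rightarrow> bool" where
  "weak_energy_condition A g T \<longleftrightarrow>
     (\<forall>c\<in>A. \<forall>p\<in>cdom c. \<forall>v. v \<bullet> (mat_of g c p *v v) < 0 \<longrightarrow> v \<bullet> (mat_of T c p *v v) \<ge> 0)"

text \<open>The limit stress-energy tensor \<open>T\<^sup>0\<close> is the smooth tensor field representing the weak limit
  of the matter stress-energy tensors.\<close>

definition effective_stress_energy ::
  "'a topology \<Rightarrow> 'a chart set \<Rightarrow> real \<Rightarrow> (real \<Rightarrow> 'a tfield) \<Rightarrow> (real \<Rightarrow> 'a tfield) \<Rightarrow> 'a tfield \<Rightarrow> bool" where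
  "effective_stress_energy X A \<Lambda> g T t0 \<longleftrightarrow>
     (\<exists>T0. smooth_cov_tensor A 2 T0 \<and> weak_limit X A (g 0) 2 T T0 \<and>
        (\<forall>c\<in>A. \<forall>p\<in>cdom c. \<forall>a b.
           8 * pi * t0 c p [a, b] =
             einstein (g 0) c p a b + \<Lambda> * g 0 c p [a, b] - 8 * pi * T0 c p [a, b]))"

end

theory Submission
  imports Defs
begin

text \<open>
  Work in a chart. Let \<open>h = g\<^sub>\<lambda> - g\<^sub>0\<close>. The tensor \<open>S = g\<^sub>0\<^sup>a\<^sup>b - (h\<^sup>a\<^sup>b - h g\<^sub>0\<^sup>a\<^sup>b / 2) / 2\<close> is close to
  the inverse background metric, and its first-order part is chosen such that in
  \<open>S\<^sup>a\<^sup>b (R\<^sub>a\<^sub>b(g\<^sub>\<lambda>) - R\<^sub>a\<^sub>b(g\<^sub>0))\<close>, after one integration by parts, all terms quadratic in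
  \<open>\<nabla>h\<close> cancel identically up to uniformly small ones, so that this expression tends weakly to zero.
  By Einstein's equation, \<open>S\<^sup>a\<^sup>b R\<^sub>a\<^sub>b(g\<^sub>\<lambda>)\<close> is a combination of \<open>8\<pi> T(\<lambda>)\<close>, with
  coefficients converging uniformly to \<open>- g\<^sub>0\<^sup>a\<^sup>b\<close>, and of \<open>\<Lambda>\<close>. The weak energy condition bounds
  every component of \<open>T(\<lambda>)\<close> by finitely many nonnegative functions with convergent integrals, so
  \<open>T(\<lambda>)\<close> is locally bounded in \<open>L\<^sup>1\<close> and uniformly small coefficients may be discarded.
  In the limit \<open>R(g\<^sub>0) + 8\<pi> T\<^sup>(\<^sup>0\<^sup>) - 4\<Lambda> = 0\<close> (\<open>T\<^sup>(\<^sup>0\<^sup>)\<close> traced with \<open>g\<^sub>0\<close>), which says that the trace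
  of the effective stress-energy vanishes. The weak limit \<open>\<mu>\<close> of the quadratic terms is never computed.
\<close>

text \<open>The obstacle: \<open>h\<close> tends to zero uniformly, but its first derivatives are
  only bounded, hence only weakly null, and its second derivatives are not controlled at all. Second
  derivatives are therefore always moved to a test function, while products of two first derivatives
  keep a weak limit that nothing forces to vanish. Contracting with the inverse background metric
  alone would leave such products behind. The coefficients of \<open>S\<close> have a classical
  origin: relative to the background density, its first-order part is half of the first variation of
  the densitized inverse metric sqrt |det g| g^ab. In the Einstein-Hilbert Lagrangian the terms with
  derivatives of Christoffel symbols become, after integration by parts, minus twice the terms
  quadratic in Christoffel symbols. Half of the variation leaves minus once those terms, and this is
  what cancels them. The price is that the first-order part of \<open>S\<close> also multiplies
  T(\<lambda>), and a uniformly small factor times a merely weakly convergent one need not be weakly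
  small; hence the need for an L1 bound.\<close>

subsection \<open>Smooth functions\<close>

lemma Ck_on_Suc_differentiable: "Ck_on (Suc k) S f \<Longrightarrow> x \<in> S \<Longrightarrow> f differentiable (at x)"
  by simp

lemma Ck_on_Suc_derivative: "Ck_on (Suc k) S f \<Longrightarrow> Ck_on k S (\<lambda>x. frechet_derivative f (at x) v)"
  by simp

lemma Ck_on_has_derivative:
  "Ck_on (Suc k) S f \<Longrightarrow> x \<in> S \<Longrightarrow> (f has_derivative frechet_derivative f (at x)) (at x)"
  by (rule iffD1[OF frechet_derivative_works Ck_on_Suc_differentiable])

lemma Ck_on_SucI0:
  "(\<And>x. x \<in> S \<Longrightarrow> f differentiable (at x)) \<Longrightarrow> (\<And>v. Ck_on k S (\<lambda>x. frechet_derivative f (at x) v))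
    \<Longrightarrow> Ck_on (Suc k) S f"
  by simp

declare Ck_on.simps(2) [simp del]

lemma Ck_on_subset: "Ck_on k S f \<Longrightarrow> T \<subseteq> S \<Longrightarrow> Ck_on k T f"
proof (induction k arbitrary: f)
  case 0
  then show ?case unfolding Ck_on.simps(1) by (rule continuous_on_subset)
next
  case (Suc k)
  show ?case
    by (rule Ck_on_SucI0) (use Suc.prems Ck_on_Suc_differentiable in blast,
        rule Suc.IH[OF Ck_on_Suc_derivative[OF Suc.prems(1)] Suc.prems(2)])
qed

text \<open>Openness makes the agreement persist near each point, so both functions have the same
  derivative throughout \<open>S\<close>, and the induction continues with the directional
  derivatives.\<close>

lemma Ck_on_cong:
  assumes "open S" "\<And>x. x \<in> S \<Longrightarrow> f x = g x" "Ck_on k S f"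
  shows "Ck_on k S g"
  using assms(2,3)
proof (induction k arbitrary: f g)
  case 0
  then show ?case using continuous_on_cong by force
next
  case (Suc k)
  have dg: "(g has_derivative frechet_derivative f (at x)) (at x)" if "x \<in> S" for x
    by (rule has_derivative_transform_within_open[OF Ck_on_has_derivative[OF Suc.prems(2) that] assms(1) that Suc.prems(1)])
  have eq: "frechet_derivative f (at x) = frechet_derivative g (at x)" if "x \<in> S" for x
    using dg[OF that] by (rule frechet_derivative_at)
  show ?case
  proof (rule Ck_on_SucI0)
    show "g differentiable (at x)" if "x \<in> S" for x using dg[OF that] by (rule differentiableI)
    show "Ck_on k S (\<lambda>x. frechet_derivative g (at x) v)" for v
      by (rule Suc.IH[OF _ Ck_on_Suc_derivative[OF Suc.prems(2)]]) (simp add: eq)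
  qed
qed

lemma Ck_on_SucD: "Ck_on (Suc k) S f \<Longrightarrow> Ck_on k S f"
proof (induction k arbitrary: f)
  case 0
  then have "isCont f x" if "x \<in> S" for x
    by (intro differentiable_imp_continuous_within Ck_on_Suc_differentiable[OF _ that])
  then show ?case by (simp add: continuous_at_imp_continuous_on)
next
  case (Suc k)
  show ?case
    by (rule Ck_on_SucI0, rule Ck_on_Suc_differentiable[OF Suc.prems], assumption,
        rule Suc.IH[OF Ck_on_Suc_derivative[OF Suc.prems]])
qed

text \<open>Lets a closure proof name its own derivative formula: uniqueness of derivatives
  identifies it with \<open>frechet_derivative\<close> on \<open>S\<close>, and openness transports
  the class.\<close>

lemma Ck_on_SucI:
  assumes "open S" and "\<And>x. x \<in> S \<Longrightarrow> (f has_derivative f' x) (at x)"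
    and "\<And>v. Ck_on k S (\<lambda>x. f' x v)"
  shows "Ck_on (Suc k) S f"
proof -
  have "frechet_derivative f (at x) = f' x" if "x \<in> S" for x
    using frechet_derivative_at[OF assms(2)[OF that]] by simp
  then have "Ck_on k S (\<lambda>x. frechet_derivative f (at x) v)" for v
    by (intro Ck_on_cong[OF assms(1) _ assms(3)[of v]]) simp
  then show ?thesis by (intro Ck_on_SucI0 differentiableI[OF assms(2)])
qed

lemma Ck_on_local:
  assumes "\<And>x. x \<in> S \<Longrightarrow> \<exists>T. open T \<and> x \<in> T \<and> Ck_on k T f"
  shows "Ck_on k S f"
  using assms
proof (induction k arbitrary: f)
  case 0
  have "isCont f x" if x: "x \<in> S" for x
  proof -
    obtain T where "open T" "x \<in> T" "continuous_on T f" using 0[OF x] Ck_on.simps(1) by metis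
    then show ?thesis using continuous_on_eq_continuous_at by blast
  qed
  then show ?case by (simp add: continuous_at_imp_continuous_on)
next
  case (Suc k)
  show ?case
  proof (rule Ck_on_SucI0)
    show "f differentiable (at x)" if "x \<in> S" for x using Suc.prems[OF that] Ck_on_Suc_differentiable by blast
    show "Ck_on k S (\<lambda>x. frechet_derivative f (at x) v)" for v
    proof (rule Suc.IH)
      fix x assume "x \<in> S"
      then obtain T where T: "open T" "x \<in> T" "Ck_on (Suc k) T f" using Suc.prems by blast
      show "\<exists>T. open T \<and> x \<in> T \<and> Ck_on k T (\<lambda>x. frechet_derivative f (at x) v)"
        by (intro exI[of _ T] conjI T Ck_on_Suc_derivative)
    qed
  qed
qed

lemma Ck_on_const: "Ck_on k S (\<lambda>x. c)"
proof (induction k arbitrary: c)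
  case (Suc k)
  show ?case
  proof (rule Ck_on_SucI0)
    show "Ck_on k S (\<lambda>x. frechet_derivative (\<lambda>x. c) (at x) v)" for v
      unfolding frechet_derivative_const by (rule Suc.IH)
  qed (rule differentiable_const)
qed (simp only: Ck_on.simps(1) continuous_on_const)

lemma Ck_on_bounded_linear:
  assumes "open S" "bounded_linear L" "Ck_on k S f"
  shows "Ck_on k S (\<lambda>x. L (f x))"
  using assms(3)
proof (induction k arbitrary: f)
  case 0
  then show ?case using bounded_linear.continuous_on[OF assms(2)] by auto
next
  case (Suc k)
  show ?case
  proof (rule Ck_on_SucI[OF assms(1)])
    show "((\<lambda>x. L (f x)) has_derivative (\<lambda>v. L (frechet_derivative f (at x) v))) (at x)" if "x \<in> S" for x
      using Ck_on_has_derivative[OF Suc.prems that] by (rule bounded_linear.has_derivative[OF assms(2)])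
    show "Ck_on k S (\<lambda>x. L (frechet_derivative f (at x) v))" for v
      by (intro Suc.IH Ck_on_Suc_derivative[OF Suc.prems])
  qed
qed

lemma Ck_on_id:
  assumes "open S"
  shows "Ck_on k S (\<lambda>x. x)"
proof (cases k)
  case (Suc j)
  show ?thesis unfolding Suc
    by (rule Ck_on_SucI[OF assms, where f' = "\<lambda>x v. v"]) (rule has_derivative_ident, rule Ck_on_const)
qed simp

lemma Ck_on_linear:
  assumes "open S" "bounded_linear L"
  shows "Ck_on k S L"
  by (rule Ck_on_bounded_linear[OF assms Ck_on_id[OF assms(1)]])

lemma Ck_on_add:
  assumes "open S" "Ck_on k S f" "Ck_on k S g"
  shows "Ck_on k S (\<lambda>x. f x + g x)"
  using assms(2,3)
proof (induction k arbitrary: f g)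
  case 0
  then show ?case by (auto intro: continuous_intros)
next
  case (Suc k)
  show ?case
  proof (rule Ck_on_SucI[OF assms(1)])
    show "((\<lambda>x. f x + g x) has_derivative (\<lambda>v. frechet_derivative f (at x) v + frechet_derivative g (at x) v)) (at x)"
      if "x \<in> S" for x
      using Suc.prems that by (intro has_derivative_add Ck_on_has_derivative)
    show "Ck_on k S (\<lambda>x. frechet_derivative f (at x) v + frechet_derivative g (at x) v)" for v
      by (intro Suc.IH Ck_on_Suc_derivative Suc.prems)
  qed
qed

lemma Ck_on_mult:
  fixes f g :: "'a::real_normed_vector \<Rightarrow> 'b::real_normed_algebra"
  assumes "open S" "Ck_on k S f" "Ck_on k S g"
  shows "Ck_on k S (\<lambda>x. f x * g x)"
  using assms(2,3)
proof (induction k arbitrary: f g)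
  case 0
  then show ?case by (auto intro: continuous_intros)
next
  case (Suc k)
  show ?case
  proof (rule Ck_on_SucI[OF assms(1)])
    show "((\<lambda>x. f x * g x) has_derivative (\<lambda>v. f x * frechet_derivative g (at x) v + frechet_derivative f (at x) v * g x)) (at x)"
      if "x \<in> S" for x
      using Suc.prems that by (intro has_derivative_mult Ck_on_has_derivative)
    show "Ck_on k S (\<lambda>x. f x * frechet_derivative g (at x) v + frechet_derivative f (at x) v * g x)" for v
      using Suc.prems by (intro Ck_on_add assms(1) Suc.IH) (auto intro: Ck_on_SucD Ck_on_Suc_derivative)
  qed
qed

lemma Ck_on_uminus: "open S \<Longrightarrow> Ck_on k S f \<Longrightarrow> Ck_on k S (\<lambda>x. - f x)"
  by (rule Ck_on_bounded_linear[OF _ bounded_linear_minus[OF bounded_linear_ident]])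

text \<open>The derivative is a product of the inverse itself and a derivative of \<open>f\<close>,
  so the induction hypothesis for the same function, one order lower, covers every factor. The
  square root below is treated by the same bootstrap.\<close>

lemma Ck_on_inverse:
  fixes f :: "'a::real_normed_vector \<Rightarrow> real"
  assumes "open S" "Ck_on k S f" and nz: "\<And>x. x \<in> S \<Longrightarrow> f x \<noteq> 0"
  shows "Ck_on k S (\<lambda>x. inverse (f x))"
  using assms(2)
proof (induction k)
  case 0
  then have "continuous_on S f" unfolding Ck_on.simps(1) .
  then show ?case unfolding Ck_on.simps(1) by (rule continuous_on_inverse) (simp add: nz)
next
  case (Suc k)
  have i: "Ck_on k S (\<lambda>x. inverse (f x))" by (rule Suc.IH[OF Ck_on_SucD[OF Suc.prems]])
  show ?case
  proof (rule Ck_on_SucI[OF assms(1)])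
    show "((\<lambda>x. inverse (f x)) has_derivative (\<lambda>v. - (inverse (f x) * frechet_derivative f (at x) v * inverse (f x)))) (at x)"
      if "x \<in> S" for x
      by (rule Deriv.has_derivative_inverse[OF nz[OF that] Ck_on_has_derivative[OF Suc.prems that]])
    show "Ck_on k S (\<lambda>x. - (inverse (f x) * frechet_derivative f (at x) v * inverse (f x)))" for v
      by (rule Ck_on_uminus[OF assms(1) Ck_on_mult[OF assms(1) Ck_on_mult[OF assms(1) i Ck_on_Suc_derivative[OF Suc.prems]] i]])
  qed
qed

lemma Ck_on_sqrt:
  fixes f :: "'a::real_normed_vector \<Rightarrow> real"
  assumes "open S" "Ck_on k S f" "\<And>x. x \<in> S \<Longrightarrow> f x > 0"
  shows "Ck_on k S (\<lambda>x. sqrt (f x))"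
  using assms(2)
proof (induction k)
  case 0
  then show ?case using continuous_on_real_sqrt[of S f] by simp
next
  case (Suc k)
  have s: "Ck_on k S (\<lambda>x. sqrt (f x))" by (rule Suc.IH[OF Ck_on_SucD[OF Suc.prems]])
  show ?case
  proof (rule Ck_on_SucI[OF assms(1)])
    show "((\<lambda>x. sqrt (f x)) has_derivative (\<lambda>v. frechet_derivative f (at x) v * (inverse (sqrt (f x)) * (1/2)))) (at x)"
      if "x \<in> S" for x
      using has_derivative_real_sqrt[OF assms(3)[OF that] Ck_on_has_derivative[OF Suc.prems that]]
      by (simp add: field_simps)
    have nz: "sqrt (f x) \<noteq> 0" if "x \<in> S" for x using assms(3)[OF that] by simp
    show "Ck_on k S (\<lambda>x. frechet_derivative f (at x) v * (inverse (sqrt (f x)) * (1/2)))" for v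
      by (rule Ck_on_mult[OF assms(1) Ck_on_Suc_derivative[OF Suc.prems]
            Ck_on_mult[OF assms(1) Ck_on_inverse[OF assms(1) s nz] Ck_on_const]])
  qed
qed

lemma Ck_on_sum:
  assumes "open S" "\<And>i. i \<in> I \<Longrightarrow> Ck_on k S (f i)"
  shows "Ck_on k S (\<lambda>x. \<Sum>i\<in>I. f i x)"
  using assms(2)
proof (induction I rule: infinite_finite_induct)
  case (insert i I)
  have "Ck_on k S (\<lambda>x. f i x + (\<Sum>i\<in>I. f i x))"
    by (rule Ck_on_add[OF assms(1) insert.prems insert.IH]) (simp_all add: insert.prems)
  then show ?case by (simp only: sum.insert[OF insert.hyps])
qed (simp_all add: Ck_on_const)

lemma Ck_on_prod:
  fixes f :: "'i \<Rightarrow> 'a::real_normed_vector \<Rightarrow> 'b::real_normed_field"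
  assumes "open S" "\<And>i. i \<in> I \<Longrightarrow> Ck_on k S (f i)"
  shows "Ck_on k S (\<lambda>x. \<Prod>i\<in>I. f i x)"
  using assms(2)
proof (induction I rule: infinite_finite_induct)
  case (insert i I)
  have "Ck_on k S (\<lambda>x. f i x * (\<Prod>i\<in>I. f i x))"
    by (rule Ck_on_mult[OF assms(1) insert.prems insert.IH]) (simp_all add: insert.prems)
  then show ?case by (simp only: prod.insert[OF insert.hyps])
qed (simp_all add: Ck_on_const)

text \<open>\<open>Ck_on\<close> controls derivatives in fixed directions, whereas the chain rule
  differentiates \<open>f\<close> in a direction that moves with \<open>x\<close>. Expanding this
  direction over \<open>Basis\<close> leaves derivatives of \<open>f\<close> in fixed directions
  with scalar coefficients; hence the Euclidean intermediate space.\<close>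

lemma Ck_on_compose:
  fixes g :: "'a::real_normed_vector \<Rightarrow> 'b::euclidean_space" and f :: "'b \<Rightarrow> 'c::real_normed_vector"
  assumes "open S" "open T" "g ` S \<subseteq> T" "Ck_on k S g" "Ck_on k T f"
  shows "Ck_on k S (\<lambda>x. f (g x))"
  using assms(4,5)
proof (induction k arbitrary: f)
  case 0
  then have "continuous_on T f" "continuous_on S g" by (simp_all only: Ck_on.simps(1))
  then show ?case unfolding Ck_on.simps(1) using assms(3) by (rule continuous_on_compose2)
next
  case (Suc k)
  have gT: "g x \<in> T" if "x \<in> S" for x using assms(3) that by auto
  show ?case
  proof (rule Ck_on_SucI[OF assms(1)])
    fix x assume x: "x \<in> S"
    have df: "(f has_derivative frechet_derivative f (at (g x))) (at (g x))"
      by (rule Ck_on_has_derivative[OF Suc.prems(2) gT[OF x]])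
    interpret Df: bounded_linear "frechet_derivative f (at (g x))" using df by (rule has_derivative_bounded_linear)
    have hd: "((\<lambda>x. f (g x)) has_derivative (\<lambda>v. frechet_derivative f (at (g x)) (frechet_derivative g (at x) v))) (at x)"
      using has_derivative_compose[OF Ck_on_has_derivative[OF Suc.prems(1) x] df] .
    have hr: "frechet_derivative f (at (g x)) w = (\<Sum>b\<in>Basis. (w \<bullet> b) *\<^sub>R frechet_derivative f (at (g x)) b)" for w
    proof -
      have "frechet_derivative f (at (g x)) (\<Sum>b\<in>Basis. (w \<bullet> b) *\<^sub>R b)
          = (\<Sum>b\<in>Basis. (w \<bullet> b) *\<^sub>R frechet_derivative f (at (g x)) b)"
        by (simp add: Df.sum Df.scaleR)
      then show ?thesis by (simp add: euclidean_representation)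
    qed
    show "((\<lambda>x. f (g x)) has_derivative (\<lambda>v. \<Sum>b\<in>Basis. (frechet_derivative g (at x) v \<bullet> b) *\<^sub>R frechet_derivative f (at (g x)) b)) (at x)"
      by (rule has_derivative_eq_rhs[OF hd]) (rule ext, rule hr)
  next
    fix v
    \<comment> \<open>The values of \<open>f\<close> lie in a normed space without multiplication,
      so the product rule is needed for scalar multiples.\<close>
    have *: "Ck_on k S (\<lambda>x. a x *\<^sub>R b x)" if "Ck_on k S a" "Ck_on k S b" for a :: "'a \<Rightarrow> real" and b :: "'a \<Rightarrow> 'c"
      using that
    proof (induction k arbitrary: a b)
      case 0
      then show ?case unfolding Ck_on.simps(1) by (rule continuous_on_scaleR)
    next
      case (Suc k)
      show ?case
      proof (rule Ck_on_SucI[OF assms(1)])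
        show "((\<lambda>x. a x *\<^sub>R b x) has_derivative (\<lambda>v. a x *\<^sub>R frechet_derivative b (at x) v + frechet_derivative a (at x) v *\<^sub>R b x)) (at x)"
          if "x \<in> S" for x
          using Suc.prems that by (intro has_derivative_scaleR Ck_on_has_derivative)
        show "Ck_on k S (\<lambda>x. a x *\<^sub>R frechet_derivative b (at x) v + frechet_derivative a (at x) v *\<^sub>R b x)" for v
          by (rule Ck_on_add[OF assms(1) Suc.IH[OF Ck_on_SucD[OF Suc.prems(1)] Ck_on_Suc_derivative[OF Suc.prems(2)]]
                Suc.IH[OF Ck_on_Suc_derivative[OF Suc.prems(1)] Ck_on_SucD[OF Suc.prems(2)]]])
      qed
    qed
    show "Ck_on k S (\<lambda>x. \<Sum>b\<in>Basis. (frechet_derivative g (at x) v \<bullet> b) *\<^sub>R frechet_derivative f (at (g x)) b)"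
    proof (intro Ck_on_sum assms(1) *)
      fix b :: 'b
      show "Ck_on k S (\<lambda>x. frechet_derivative g (at x) v \<bullet> b)"
        by (rule Ck_on_bounded_linear[OF assms(1) bounded_linear_inner_left Ck_on_Suc_derivative[OF Suc.prems(1)]])
      show "Ck_on k S (\<lambda>x. frechet_derivative f (at (g x)) b)"
        by (rule Suc.IH[OF Ck_on_SucD[OF Suc.prems(1)] Ck_on_Suc_derivative[OF Suc.prems(2)]])
    qed
  qed
qed

lemma smooth_on_subset: "smooth_on S f \<Longrightarrow> T \<subseteq> S \<Longrightarrow> smooth_on T f"
  by (auto simp: smooth_on_def intro: Ck_on_subset)

lemma smooth_on_cong: "open S \<Longrightarrow> (\<And>x. x \<in> S \<Longrightarrow> f x = g x) \<Longrightarrow> smooth_on S f \<Longrightarrow> smooth_on S g"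
  unfolding smooth_on_def by (intro allI, rule Ck_on_cong[of S f]) auto

lemma smooth_on_local:
  assumes "\<And>x. x \<in> S \<Longrightarrow> \<exists>T. open T \<and> x \<in> T \<and> smooth_on T f"
  shows "smooth_on S f"
  unfolding smooth_on_def
proof
  fix k
  show "Ck_on k S f"
  proof (rule Ck_on_local)
    fix x assume "x \<in> S"
    then obtain T where T: "open T" "x \<in> T" "smooth_on T f" using assms by blast
    show "\<exists>T. open T \<and> x \<in> T \<and> Ck_on k T f"
      by (rule exI[of _ T]) (use T in \<open>simp add: smooth_on_def\<close>)
  qed
qed

lemma smooth_on_const: "smooth_on S (\<lambda>x. c)"
  by (simp add: smooth_on_def Ck_on_const)

lemma smooth_on_linear: "open S \<Longrightarrow> bounded_linear L \<Longrightarrow> smooth_on S L"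
  by (simp add: smooth_on_def Ck_on_linear)

lemma smooth_on_bounded_linear: "open S \<Longrightarrow> bounded_linear L \<Longrightarrow> smooth_on S f \<Longrightarrow> smooth_on S (\<lambda>x. L (f x))"
  by (simp add: smooth_on_def Ck_on_bounded_linear)

lemma smooth_on_add: "open S \<Longrightarrow> smooth_on S f \<Longrightarrow> smooth_on S g \<Longrightarrow> smooth_on S (\<lambda>x. f x + g x)"
  by (simp add: smooth_on_def Ck_on_add)

lemma smooth_on_mult:
  fixes f g :: "'a::real_normed_vector \<Rightarrow> real"
  shows "open S \<Longrightarrow> smooth_on S f \<Longrightarrow> smooth_on S g \<Longrightarrow> smooth_on S (\<lambda>x. f x * g x)"
  by (simp add: smooth_on_def Ck_on_mult)

lemma smooth_on_uminus:
  fixes f :: "'a::real_normed_vector \<Rightarrow> real"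
  shows "open S \<Longrightarrow> smooth_on S f \<Longrightarrow> smooth_on S (\<lambda>x. - f x)"
  using smooth_on_mult[OF _ smooth_on_const[of S "- 1"]] by simp

lemma smooth_on_diff:
  fixes f g :: "'a::real_normed_vector \<Rightarrow> real"
  shows "open S \<Longrightarrow> smooth_on S f \<Longrightarrow> smooth_on S g \<Longrightarrow> smooth_on S (\<lambda>x. f x - g x)"
  using smooth_on_add[OF _ _ smooth_on_uminus, of S f g] by simp

lemma smooth_on_sum: "open S \<Longrightarrow> (\<And>i. i \<in> I \<Longrightarrow> smooth_on S (f i)) \<Longrightarrow> smooth_on S (\<lambda>x. \<Sum>i\<in>I. f i x)"
  by (simp add: smooth_on_def Ck_on_sum)

lemma smooth_on_prod:
  fixes f :: "'i \<Rightarrow> 'a::real_normed_vector \<Rightarrow> real"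
  shows "open S \<Longrightarrow> (\<And>i. i \<in> I \<Longrightarrow> smooth_on S (f i)) \<Longrightarrow> smooth_on S (\<lambda>x. \<Prod>i\<in>I. f i x)"
  by (simp add: smooth_on_def Ck_on_prod)

lemma smooth_on_inverse:
  fixes f :: "'a::real_normed_vector \<Rightarrow> real"
  shows "open S \<Longrightarrow> smooth_on S f \<Longrightarrow> (\<And>x. x \<in> S \<Longrightarrow> f x \<noteq> 0) \<Longrightarrow> smooth_on S (\<lambda>x. inverse (f x))"
  by (simp add: smooth_on_def Ck_on_inverse)

lemma smooth_on_sqrt:
  fixes f :: "'a::real_normed_vector \<Rightarrow> real"
  shows "open S \<Longrightarrow> smooth_on S f \<Longrightarrow> (\<And>x. x \<in> S \<Longrightarrow> f x > 0) \<Longrightarrow> smooth_on S (\<lambda>x. sqrt (f x))"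
  by (simp add: smooth_on_def Ck_on_sqrt)

lemma smooth_on_compose:
  fixes g :: "'a::real_normed_vector \<Rightarrow> 'b::euclidean_space"
  shows "open S \<Longrightarrow> open T \<Longrightarrow> g ` S \<subseteq> T \<Longrightarrow> smooth_on S g \<Longrightarrow> smooth_on T f \<Longrightarrow> smooth_on S (\<lambda>x. f (g x))"
  by (simp add: smooth_on_def Ck_on_compose)

lemma smooth_on_imp_differentiable: "smooth_on S f \<Longrightarrow> x \<in> S \<Longrightarrow> f differentiable (at x)"
  unfolding smooth_on_def by (rule Ck_on_Suc_differentiable) blast

lemma smooth_on_imp_continuous_on: "smooth_on S f \<Longrightarrow> continuous_on S f"
  unfolding smooth_on_def using Ck_on.simps(1)[of S f] by blast

lemma smooth_on_frechet_derivative: "smooth_on S f \<Longrightarrow> smooth_on S (\<lambda>x. frechet_derivative f (at x) v)"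
  unfolding smooth_on_def by (intro allI, rule Ck_on_Suc_derivative) blast

section \<open>Coordinate partial derivatives\<close>

definition partial :: "4 \<Rightarrow> (real^4 \<Rightarrow> real) \<Rightarrow> real^4 \<Rightarrow> real" where
  "partial i f x = frechet_derivative f (at x) (axis i 1)"

lemma smooth_on_partial: "smooth_on S f \<Longrightarrow> smooth_on S (partial i f)"
  unfolding partial_def by (rule smooth_on_frechet_derivative)

text \<open>The two functions have exactly the same derivatives at \<open>x\<close>, so the choice
  behind \<open>frechet_derivative\<close> picks the same map even where neither is
  differentiable.\<close>

lemma partial_cong:
  assumes "open S" "x \<in> S" "\<And>y. y \<in> S \<Longrightarrow> f y = g y"
  shows "partial i f x = partial i g x"
proof -
  have "(f has_derivative D) (at x) \<longleftrightarrow> (g has_derivative D) (at x)" for D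
    using assms has_derivative_transform_within_open[of f D x UNIV S g]
      has_derivative_transform_within_open[of g D x UNIV S f] by auto
  then show ?thesis by (simp add: partial_def frechet_derivative_def)
qed

lemma partial_eqI: "(f has_derivative D) (at x) \<Longrightarrow> partial i f x = D (axis i 1)"
  unfolding partial_def by (drule frechet_derivative_at) simp

lemma partial_add:
  assumes "f differentiable (at x)" "g differentiable (at x)"
  shows "partial i (\<lambda>y. f y + g y) x = partial i f x + partial i g x"
  using partial_eqI[OF has_derivative_add[OF iffD1[OF frechet_derivative_works assms(1)] iffD1[OF frechet_derivative_works assms(2)]]]
  by (simp add: partial_def)

lemma partial_diff:
  assumes "f differentiable (at x)" "g differentiable (at x)"
  shows "partial i (\<lambda>y. f y - g y) x = partial i f x - partial i g x"
  using partial_eqI[OF has_derivative_diff[OF iffD1[OF frechet_derivative_works assms(1)] iffD1[OF frechet_derivative_works assms(2)]]]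
  by (simp add: partial_def)

lemma partial_mult:
  assumes "f differentiable (at x)" "g differentiable (at x)"
  shows "partial i (\<lambda>y. f y * g y) x = f x * partial i g x + partial i f x * g x"
  using partial_eqI[OF has_derivative_mult[OF iffD1[OF frechet_derivative_works assms(1)] iffD1[OF frechet_derivative_works assms(2)]]]
  by (simp add: partial_def)

lemma partial_sum:
  assumes "finite I" "\<And>j. j \<in> I \<Longrightarrow> f j differentiable (at x)"
  shows "partial i (\<lambda>y. \<Sum>j\<in>I. f j y) x = (\<Sum>j\<in>I. partial i (f j) x)"
  using assms
proof (induction I rule: finite_induct)
  case empty
  then show ?case by (simp add: partial_def frechet_derivative_const)
next
  case (insert j I)
  have "partial i (\<lambda>y. f j y + (\<Sum>j\<in>I. f j y)) x = partial i (f j) x + partial i (\<lambda>y. \<Sum>j\<in>I. f j y) x"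
    by (rule partial_add) (use insert in \<open>auto intro!: differentiable_sum\<close>)
  then show ?case using insert by simp
qed

lemma partial_const: "partial i (\<lambda>y. c) x = 0"
  by (simp add: partial_def frechet_derivative_const)

text \<open>The open sets \<open>U\<close> and \<open>- K\<close> cover the space; on the first both
  factors are smooth, on the second the product is zero. Arbitrary values of \<open>f\<close>
  outside \<open>U\<close> do no harm, which matters for fields read off in a chart.\<close>

lemma smooth_on_times_support:
  fixes \<phi> f :: "'a::{real_normed_vector,t2_space} \<Rightarrow> real"
  assumes "open U" "compact K" "K \<subseteq> U" "smooth_on UNIV \<phi>" "\<And>x. x \<notin> K \<Longrightarrow> \<phi> x = 0" "smooth_on U f"
  shows "smooth_on UNIV (\<lambda>x. \<phi> x * f x)"
proof (rule smooth_on_local)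
  fix x
  show "\<exists>T. open T \<and> x \<in> T \<and> smooth_on T (\<lambda>x. \<phi> x * f x)"
  proof (cases "x \<in> U")
    case True
    then show ?thesis
      using assms by (intro exI[of _ U] conjI smooth_on_mult) (auto intro: smooth_on_subset)
  next
    case False
    have "open (- K)" using assms(2) by (simp add: compact_imp_closed open_Compl)
    moreover have "smooth_on (- K) (\<lambda>x. \<phi> x * f x)"
      by (rule smooth_on_cong[of _ "\<lambda>x. 0"]) (use assms \<open>open (- K)\<close> in \<open>auto intro: smooth_on_const\<close>)
    ultimately show ?thesis using False assms(3) by (intro exI[of _ "- K"]) auto
  qed
qed

subsection \<open>Bump functions\<close>

text \<open>An arbitrary polynomial in 1/t is carried along because this makes the family closed
  under differentiation, so smoothness is one induction over all \<open>p\<close> at once.\<close>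

definition flat_exp :: "real poly \<Rightarrow> real \<Rightarrow> real" where
  "flat_exp p t = (if t > 0 then poly p (inverse t) * exp (- inverse t) else 0)"

lemma poly_times_exp_tendsto_0: "((\<lambda>x::real. poly p x * exp (- x)) \<longlongrightarrow> 0) at_top"
proof -
  have "((\<lambda>x. \<Sum>i\<le>degree p. coeff p i * (x ^ i / exp x)) \<longlongrightarrow> (\<Sum>i\<le>degree p. coeff p i * 0)) at_top"
    by (intro tendsto_sum tendsto_mult tendsto_const tendsto_power_div_exp_0)
  moreover have "(\<lambda>x. \<Sum>i\<le>degree p. coeff p i * (x ^ i / exp x)) = (\<lambda>x. poly p x * exp (- x))"
    by (rule ext) (simp add: poly_altdef exp_minus divide_inverse sum_distrib_right mult.assoc)
  ultimately show ?thesis by simp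
qed

text \<open>For t > 0 the chain rule produces the polynomial x^2 (p - p') in x = 1/t. At 0 the
  difference quotient from the right is the polynomial x p times exp (- x) with x tending to
  infinity, and from the left it is zero.\<close>

lemma flat_exp_has_derivative:
  "(flat_exp p has_field_derivative flat_exp ([:0, 0, 1:] * (p - pderiv p)) t) (at t)"
proof (cases t "0::real" rule: linorder_cases)
  case less
  have "((\<lambda>_. 0) has_field_derivative 0) (at t)" by (rule DERIV_const)
  then have "(flat_exp p has_field_derivative 0) (at t)"
    by (rule has_field_derivative_transform_within_open[where S = "{..<0}"]) (use less in \<open>auto simp: flat_exp_def\<close>)
  then show ?thesis using less by (simp add: flat_exp_def)
next
  case greater
  have "((\<lambda>t. poly p (inverse t) * exp (- inverse t)) has_field_derivative
      poly (pderiv p) (inverse t) * (- (inverse t * inverse t)) * exp (- inverse t)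
        + poly p (inverse t) * (exp (- inverse t) * (inverse t * inverse t))) (at t)"
    using greater
    by (auto intro!: derivative_eq_intros DERIV_chain2[OF poly_DERIV] simp: power2_eq_square algebra_simps)
  then have "(flat_exp p has_field_derivative
      poly (pderiv p) (inverse t) * (- (inverse t * inverse t)) * exp (- inverse t)
        + poly p (inverse t) * (exp (- inverse t) * (inverse t * inverse t))) (at t)"
    by (rule has_field_derivative_transform_within_open[where S = "{0<..}"]) (use greater in \<open>auto simp: flat_exp_def\<close>)
  moreover have "poly (pderiv p) (inverse t) * (- (inverse t * inverse t)) * exp (- inverse t)
        + poly p (inverse t) * (exp (- inverse t) * (inverse t * inverse t))
      = flat_exp ([:0, 0, 1:] * (p - pderiv p)) t"
    using greater by (simp add: flat_exp_def algebra_simps)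
  ultimately show ?thesis by simp
next
  case equal
  have "((\<lambda>h. flat_exp p h / h) \<longlongrightarrow> 0) (at_right 0)"
  proof -
    have "((\<lambda>x. poly ([:0, 1:] * p) x * exp (- x)) \<longlongrightarrow> 0) at_top" by (rule poly_times_exp_tendsto_0)
    then have "\<forall>\<^sub>F x in at_top. True \<Longrightarrow> ((\<lambda>x. flat_exp p (inverse x) / inverse x) \<longlongrightarrow> 0) at_top"
      by (rule Lim_transform_eventually)
        (use eventually_gt_at_top[of 0] in \<open>eventually_elim, simp add: flat_exp_def divide_inverse mult_ac\<close>)
    then show ?thesis by (simp add: filterlim_at_right_to_top)
  qed
  moreover have "((\<lambda>h. flat_exp p h / h) \<longlongrightarrow> 0) (at_left 0)"
    by (rule Lim_transform_eventually[where f = "\<lambda>_. 0"]) (auto simp: flat_exp_def eventually_at_filter)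
  ultimately have "((\<lambda>h. flat_exp p h / h) \<longlongrightarrow> 0) (at 0)"
    by (simp add: filterlim_at_split)
  then have "((\<lambda>h. (flat_exp p (0 + h) - flat_exp p 0) / h) \<longlongrightarrow> 0) (at 0)"
    by (simp add: flat_exp_def)
  then have "(flat_exp p has_field_derivative 0) (at 0)" by (simp only: DERIV_def)
  then show ?thesis using equal by (simp add: flat_exp_def)
qed

lemma Ck_on_cmult_right:
  fixes f :: "'a::real_normed_vector \<Rightarrow> real"
  assumes "open S" "Ck_on k S f"
  shows "Ck_on k S (\<lambda>x. f x * c)"
  by (rule Ck_on_mult[OF assms Ck_on_const])

lemma smooth_on_flat_exp: "smooth_on UNIV (flat_exp p)"
proof -
  have "Ck_on k UNIV (flat_exp p)" for k
  proof (induction k arbitrary: p)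
    case 0
    have "isCont (flat_exp p) t" for t by (rule DERIV_isCont[OF flat_exp_has_derivative])
    then show ?case unfolding Ck_on.simps(1) by (intro continuous_at_imp_continuous_on) auto
  next
    case (Suc k)
    show ?case
    proof (rule Ck_on_SucI[OF open_UNIV])
      show "(flat_exp p has_derivative (\<lambda>v. flat_exp ([:0, 0, 1:] * (p - pderiv p)) t * v)) (at t)" for t
        using flat_exp_has_derivative[of p t] unfolding has_field_derivative_def .
      show "Ck_on k UNIV (\<lambda>t. flat_exp ([:0, 0, 1:] * (p - pderiv p)) t * v)" for v
        by (rule Ck_on_cmult_right[OF open_UNIV Suc.IH])
    qed
  qed
  then show ?thesis unfolding smooth_on_def by blast
qed

text \<open>Here \<open>1\<close> is the constant polynomial, so this is exp (- 1/s) at s = r^2 - |x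
  - a|^2. The squared distance is a polynomial in the coordinates and hence smooth at the centre
  too.\<close>

definition bump :: "real^4 \<Rightarrow> real \<Rightarrow> real^4 \<Rightarrow> real" where
  "bump a r x = flat_exp 1 (r\<^sup>2 - (x - a) \<bullet> (x - a))"

lemma smooth_on_bump: "smooth_on UNIV (bump a r)"
proof -
  have c: "smooth_on UNIV (\<lambda>x::real^4. (x - a) $ i)" for i
    unfolding vector_minus_component
    by (rule smooth_on_diff[OF open_UNIV smooth_on_linear[OF open_UNIV bounded_linear_vec_nth] smooth_on_const])
  have "smooth_on UNIV (\<lambda>x::real^4. r\<^sup>2 - (\<Sum>i\<in>UNIV. (x - a) $ i * (x - a) $ i))"
    by (rule smooth_on_diff[OF open_UNIV smooth_on_const smooth_on_sum[OF open_UNIV smooth_on_mult[OF open_UNIV c c]]])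
  then have "smooth_on UNIV (\<lambda>x::real^4. flat_exp 1 (r\<^sup>2 - (\<Sum>i\<in>UNIV. (x - a) $ i * (x - a) $ i)))"
    by (rule smooth_on_compose[OF open_UNIV open_UNIV subset_UNIV _ smooth_on_flat_exp])
  then show ?thesis by (simp add: bump_def[abs_def] inner_vec_def)
qed

lemma bump_nonneg: "bump a r x \<ge> 0"
  by (simp add: bump_def flat_exp_def)

lemma bump_pos: "norm (x - a) < r \<Longrightarrow> bump a r x > 0"
  using power_strict_mono[of "norm (x - a)" r 2]
  by (simp add: bump_def flat_exp_def flip: power2_norm_eq_inner)

lemma bump_zero: "0 \<le> r \<Longrightarrow> norm (x - a) \<ge> r \<Longrightarrow> bump a r x = 0"
  using power_mono[of r "norm (x - a)" 2]
  by (simp add: bump_def flat_exp_def not_less flip: power2_norm_eq_inner)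

subsection \<open>Integration by parts\<close>

lemma integrable_compact_support:
  fixes f :: "real^4 \<Rightarrow> real"
  assumes "continuous_on UNIV f" "compact K" "\<And>x. x \<notin> K \<Longrightarrow> f x = 0"
  shows "integrable lborel f"
proof -
  have "integrable lborel (\<lambda>x. indicator K x *\<^sub>R f x)"
    using borel_integrable_compact[OF assms(2) continuous_on_subset[OF assms(1) subset_UNIV]] .
  moreover have "(\<lambda>x. indicator K x *\<^sub>R f x) = f" using assms(3) by (auto simp: indicator_def fun_eq_iff)
  ultimately show ?thesis by simp
qed

text \<open>Lebesgue measure is translation invariant, so every difference quotient of
  \<open>f\<close> has integral zero; dominated convergence passes this to the derivative.\<close>

lemma integral_partial_zero:
  assumes "smooth_on UNIV f" "compact K" "\<And>x. x \<notin> K \<Longrightarrow> f x = 0"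
  shows "(\<integral>x. partial i f x \<partial>lborel) = 0"
proof -
  define e :: "real^4" where "e = axis i 1"
  have ne: "norm e = 1" by (simp add: e_def)
  obtain R where R: "\<And>x. x \<in> K \<Longrightarrow> norm x \<le> R" using compact_imp_bounded[OF assms(2)] by (auto simp: bounded_iff)
  \<comment> \<open>The shifts used have length at most 1. Outside \<open>B\<close> neither
    \<open>x\<close> nor its shift meets \<open>K\<close>; inside \<open>B\<close> the mean value
    point has norm at most R + 2, where \<open>M\<close> bounds the derivative.\<close>
  define B where "B = cball (0::real^4) (R + 1)"
  have df: "(f has_derivative frechet_derivative f (at x)) (at x)" for x
    using smooth_on_imp_differentiable[OF assms(1)] frechet_derivative_works by blast
  have sp: "smooth_on UNIV (partial i f)" by (rule smooth_on_partial[OF assms(1)])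
  have "compact (cball (0::real^4) (R + 2))" by simp
  then have "bounded (partial i f ` cball 0 (R + 2))"
    by (intro compact_imp_bounded compact_continuous_image continuous_on_subset[OF smooth_on_imp_continuous_on[OF sp]]) auto
  then obtain M where M: "\<And>x. norm x \<le> R + 2 \<Longrightarrow> \<bar>partial i f x\<bar> \<le> M" by (fastforce simp: bounded_iff)
  have line: "((\<lambda>t. f (x + t *\<^sub>R e)) has_real_derivative partial i f (x + t *\<^sub>R e)) (at t)" for x t
  proof -
    have "((\<lambda>t. x + t *\<^sub>R e) has_derivative (\<lambda>h. h *\<^sub>R e)) (at t)" by (auto intro!: derivative_eq_intros)
    from has_derivative_compose[OF this df]
    have "((\<lambda>t. f (x + t *\<^sub>R e)) has_derivative (\<lambda>h. frechet_derivative f (at (x + t *\<^sub>R e)) (h *\<^sub>R e))) (at t)" .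
    moreover have "frechet_derivative f (at y) (h *\<^sub>R e) = partial i f y * h" for y h
      using linear_scale[OF bounded_linear.linear[OF has_derivative_bounded_linear[OF df[of y]]]]
      by (simp add: partial_def e_def)
    ultimately show ?thesis by (simp add: has_field_derivative_def)
  qed
  define q where "q n x = (f (x + inverse (real (Suc n)) *\<^sub>R e) - f x) * real (Suc n)" for n x
  have cf: "continuous_on UNIV f" by (rule smooth_on_imp_continuous_on[OF assms(1)])
  have if1: "integrable lborel f" by (rule integrable_compact_support[OF cf assms(2,3)])
  have bm: "f \<in> borel_measurable borel" by (rule borel_measurable_continuous_onI[OF cf])
  have tr: "integrable lborel (\<lambda>x. f (x + a))" "(\<integral>x. f (x + a) \<partial>lborel) = (\<integral>x. f x \<partial>lborel)" for a
  proof -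
    have d: "distr lborel borel ((+) a) = (lborel :: (real^4) measure)" by (rule lborel_distr_plus)
    have "integrable (distr lborel borel ((+) a)) f" unfolding d by (rule if1)
    then show "integrable lborel (\<lambda>x. f (x + a))"
      by (subst (asm) integrable_distr_eq) (auto simp: bm add.commute)
    have "(\<integral>x. f x \<partial>distr lborel borel ((+) a)) = (\<integral>x. f (a + x) \<partial>lborel)"
      by (rule integral_distr) (auto simp: bm)
    then show "(\<integral>x. f (x + a) \<partial>lborel) = (\<integral>x. f x \<partial>lborel)" unfolding d by (simp add: add.commute)
  qed
  have q0: "(\<integral>x. q n x \<partial>lborel) = 0" for n
    unfolding q_def using tr if1 by (simp add: Bochner_Integration.integral_diff)
  have lim: "(\<lambda>n. \<integral>x. q n x \<partial>lborel) \<longlonglongrightarrow> (\<integral>x. partial i f x \<partial>lborel)"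
  proof (rule integral_dominated_convergence[where w = "\<lambda>x. indicator B x * M"])
    show "partial i f \<in> borel_measurable lborel"
      using borel_measurable_continuous_onI[OF smooth_on_imp_continuous_on[OF sp]] by simp
    show "q n \<in> borel_measurable lborel" for n
      unfolding q_def using tr(1) if1 by (intro borel_measurable_times borel_measurable_diff borel_measurable_integrable) auto
    have "integrable lborel (indicator B :: real^4 \<Rightarrow> real)"
      using emeasure_lborel_cball_finite[of "0::real^4" "R + 1"]
      by (intro integrable_real_indicator) (simp_all add: B_def)
    then show "integrable lborel (\<lambda>x. indicator B x * M)" by (rule integrable_mult_left)
    show "AE x in lborel. (\<lambda>n. q n x) \<longlonglongrightarrow> partial i f x"
    proof (rule AE_I2)
      fix x
      have "((\<lambda>h. (f (x + (0 + h) *\<^sub>R e) - f (x + 0 *\<^sub>R e)) / h) \<longlongrightarrow> partial i f (x + 0 *\<^sub>R e)) (at 0)"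
        using line[of x 0] by (simp only: DERIV_def)
      then have *: "((\<lambda>h. (f (x + h *\<^sub>R e) - f x) / h) \<longlongrightarrow> partial i f x) (at 0)" by simp
      have "filterlim (\<lambda>n. inverse (real (Suc n))) (at 0) sequentially"
        by (rule filterlim_atI[OF LIMSEQ_inverse_real_of_nat]) auto
      from filterlim_compose[OF * this]
      have "(\<lambda>n. (f (x + inverse (real (Suc n)) *\<^sub>R e) - f x) / inverse (real (Suc n))) \<longlonglongrightarrow> partial i f x" .
      then show "(\<lambda>n. q n x) \<longlonglongrightarrow> partial i f x" by (simp add: q_def divide_inverse)
    qed
    show "AE x in lborel. norm (q n x) \<le> indicator B x * M" for n
    proof (rule AE_I2)
      fix x
      let ?t = "inverse (real (Suc n))"
      have t: "0 < ?t" "?t \<le> 1" by (auto simp: inverse_le_1_iff)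
      show "norm (q n x) \<le> indicator B x * M"
      proof (cases "x \<in> B")
        case True
        obtain z where z: "0 < z" "z < ?t" "f (x + ?t *\<^sub>R e) - f (x + 0 *\<^sub>R e) = (?t - 0) * partial i f (x + z *\<^sub>R e)"
          using MVT2[OF t(1), of "\<lambda>t. f (x + t *\<^sub>R e)" "\<lambda>t. partial i f (x + t *\<^sub>R e)"] line by blast
        have "norm (x + z *\<^sub>R e) \<le> norm x + z" using norm_triangle_ineq[of x "z *\<^sub>R e"] z(1) ne by simp
        then have "\<bar>partial i f (x + z *\<^sub>R e)\<bar> \<le> M" using True z t by (intro M) (auto simp: B_def)
        moreover have "q n x = partial i f (x + z *\<^sub>R e)" using z(3) by (simp add: q_def)
        ultimately show ?thesis using True by simp
      next
        case False
        then have nx: "norm x > R + 1" by (simp add: B_def)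
        have "norm (x + ?t *\<^sub>R e) \<ge> norm x - ?t" using norm_triangle_ineq2[of x "- (?t *\<^sub>R e)"] ne t by simp
        then have "x + ?t *\<^sub>R e \<notin> K" "x \<notin> K" using R[of x] R[of "x + ?t *\<^sub>R e"] nx t by (smt (verit))+
        then show ?thesis using False assms(3) by (simp add: q_def)
      qed
    qed
  qed
  have "(\<lambda>n::nat. 0::real) \<longlonglongrightarrow> (\<integral>x. partial i f x \<partial>lborel)" using lim by (simp only: q0)
  from LIMSEQ_unique[OF this tendsto_const] show ?thesis .
qed

text \<open>The product rule for \<open>\<psi> * f\<close> holds on all of the space: on
  \<open>U\<close> by differentiability, outside \<open>U\<close> because every term vanishes off
  \<open>K\<close>. The product then has an integrable derivative with integral zero.\<close>

lemma integral_by_parts: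
  assumes U: "open U" "compact K" "K \<subseteq> U" and \<psi>: "smooth_on UNIV \<psi>" "\<And>x. x \<notin> K \<Longrightarrow> \<psi> x = 0"
    and f: "smooth_on U f"
  shows "(\<integral>x. \<psi> x * partial i f x \<partial>lborel) = - (\<integral>x. partial i \<psi> x * f x \<partial>lborel)"
    and "\<And>x. x \<notin> K \<Longrightarrow> partial i \<psi> x = 0"
proof -
  show d0: "partial i \<psi> x = 0" if "x \<notin> K" for x
  proof -
    have "partial i \<psi> x = partial i (\<lambda>x. 0) x"
      by (rule partial_cong[of "- K"]) (use U that \<psi> in \<open>auto simp: compact_imp_closed open_Compl\<close>)
    then show ?thesis by (simp add: partial_const)
  qed
  have s1: "smooth_on UNIV (\<lambda>x. \<psi> x * partial i f x)"
    by (rule smooth_on_times_support[OF U \<psi> smooth_on_partial[OF f]])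
  have s2: "smooth_on UNIV (\<lambda>x. partial i \<psi> x * f x)"
    by (rule smooth_on_times_support[OF U smooth_on_partial[OF \<psi>(1)] d0 f])
  have s3: "smooth_on UNIV (\<lambda>x. \<psi> x * f x)"
    by (rule smooth_on_times_support[OF U \<psi> f])
  have eq: "partial i (\<lambda>x. \<psi> x * f x) x = \<psi> x * partial i f x + partial i \<psi> x * f x" for x
  proof (cases "x \<in> U")
    case True
    then show ?thesis
      using smooth_on_imp_differentiable[OF \<psi>(1)] smooth_on_imp_differentiable[OF f]
      by (intro partial_mult) auto
  next
    case False
    then have "x \<notin> K" using U(3) by blast
    then have "partial i (\<lambda>x. \<psi> x * f x) x = partial i (\<lambda>x. 0) x"
      by (intro partial_cong[of "- K"]) (use U \<psi> in \<open>auto simp: compact_imp_closed open_Compl\<close>)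
    then show ?thesis using \<open>x \<notin> K\<close> d0 \<psi>(2) by (simp add: partial_const)
  qed
  have i1: "integrable lborel (\<lambda>x. \<psi> x * partial i f x)"
    by (rule integrable_compact_support[OF smooth_on_imp_continuous_on[OF s1] U(2)]) (simp add: \<psi>(2))
  have i2: "integrable lborel (\<lambda>x. partial i \<psi> x * f x)"
    by (rule integrable_compact_support[OF smooth_on_imp_continuous_on[OF s2] U(2)]) (simp add: d0)
  have "(\<integral>x. partial i (\<lambda>x. \<psi> x * f x) x \<partial>lborel) = 0"
    by (rule integral_partial_zero[OF s3 U(2)]) (simp add: \<psi>(2))
  then show "(\<integral>x. \<psi> x * partial i f x \<partial>lborel) = - (\<integral>x. partial i \<psi> x * f x \<partial>lborel)"
    unfolding eq using Bochner_Integration.integral_add[OF i1 i2] by simp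
qed

subsection \<open>Families of functions that converge weakly to zero\<close>

text \<open>Smoothness is asked on an open set, so that derivatives make sense; estimates and test
  functions refer to a compact subset, on which fixed smooth coefficients are bounded.\<close>

locale weak_setting =
  fixes U K :: "(real^4) set"
  assumes open_U: "open U" and compact_K: "compact K" and K_subset: "K \<subseteq> U"
begin

definition test_fun :: "(real^4 \<Rightarrow> real) \<Rightarrow> bool" where
  "test_fun \<psi> \<longleftrightarrow> smooth_on UNIV \<psi> \<and> (\<forall>x. x \<notin> K \<longrightarrow> \<psi> x = 0)"

definition family :: "(real \<Rightarrow> real^4 \<Rightarrow> real) \<Rightarrow> bool" where
  "family f \<longleftrightarrow> (\<forall>l>0. smooth_on U (f l))"

definition weak_null :: "(real \<Rightarrow> real^4 \<Rightarrow> real) \<Rightarrow> bool" where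
  "weak_null f \<longleftrightarrow> family f \<and> (\<forall>\<psi>. test_fun \<psi> \<longrightarrow> ((\<lambda>l. \<integral>x. \<psi> x * f l x \<partial>lborel) \<longlongrightarrow> 0) (at_right 0))"

definition unif_null :: "(real \<Rightarrow> real^4 \<Rightarrow> real) \<Rightarrow> bool" where
  "unif_null f \<longleftrightarrow> family f \<and> (\<forall>\<epsilon>>0. \<forall>\<^sub>F l in at_right 0. \<forall>x\<in>K. \<bar>f l x\<bar> \<le> \<epsilon>)"

text \<open>The bound is only asked eventually, since the inverse metrics and the derivatives of the
  perturbation are controlled only for small \<open>l\<close>.\<close>

definition unif_bounded :: "(real \<Rightarrow> real^4 \<Rightarrow> real) \<Rightarrow> bool" where
  "unif_bounded f \<longleftrightarrow> family f \<and> (\<exists>C. \<forall>\<^sub>F l in at_right 0. \<forall>x\<in>K. \<bar>f l x\<bar> \<le> C)"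

lemma pos_at_right: "\<forall>\<^sub>F l in at_right 0. (0::real) < l"
  by (rule eventually_at_right_less)

lemma family_const: "smooth_on U a \<Longrightarrow> family (\<lambda>l. a)"
  by (simp add: family_def)

lemma family_add: "family f \<Longrightarrow> family g \<Longrightarrow> family (\<lambda>l x. f l x + g l x)"
  by (simp add: family_def smooth_on_add open_U)

lemma family_mult: "family f \<Longrightarrow> family g \<Longrightarrow> family (\<lambda>l x. f l x * g l x)"
  by (simp add: family_def smooth_on_mult open_U)

lemma family_partial: "family f \<Longrightarrow> family (\<lambda>l. partial i (f l))"
  by (simp add: family_def smooth_on_partial)

lemma family_cong:
  assumes "family f" "\<And>l x. l > 0 \<Longrightarrow> x \<in> U \<Longrightarrow> f l x = g l x"
  shows "family g"
  unfolding family_def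
proof (intro allI impI)
  fix l :: real assume l: "l > 0"
  show "smooth_on U (g l)"
    by (rule smooth_on_cong[OF open_U assms(2)[OF l]]) (use assms(1) l in \<open>auto simp: family_def\<close>)
qed

lemma integrable_test:
  assumes "test_fun \<psi>" "smooth_on U f"
  shows "integrable lborel (\<lambda>x. \<psi> x * f x)"
proof (rule integrable_compact_support[OF _ compact_K])
  show "continuous_on UNIV (\<lambda>x. \<psi> x * f x)"
    by (rule smooth_on_imp_continuous_on, rule smooth_on_times_support[OF open_U compact_K K_subset])
      (use assms in \<open>auto simp: test_fun_def\<close>)
  show "\<psi> x * f x = 0" if "x \<notin> K" for x using that assms by (simp add: test_fun_def)
qed

lemma test_fun_mult: "test_fun \<psi> \<Longrightarrow> smooth_on U a \<Longrightarrow> test_fun (\<lambda>x. \<psi> x * a x)"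
  using smooth_on_times_support[OF open_U compact_K K_subset, of \<psi> a] by (simp add: test_fun_def)

lemma unif_null_family: "unif_null f \<Longrightarrow> family f" by (simp add: unif_null_def)
lemma unif_bounded_family: "unif_bounded f \<Longrightarrow> family f" by (simp add: unif_bounded_def)
lemma weak_null_family: "weak_null f \<Longrightarrow> family f" by (simp add: weak_null_def)

lemma unif_null_bounded: "unif_null f \<Longrightarrow> unif_bounded f"
  unfolding unif_null_def unif_bounded_def by (meson zero_less_one)

lemma unif_bounded_const:
  assumes "smooth_on U a"
  shows "unif_bounded (\<lambda>l. a)"
proof -
  have "compact (a ` K)"
    by (rule compact_continuous_image[OF continuous_on_subset[OF smooth_on_imp_continuous_on[OF assms] K_subset] compact_K])
  then obtain C where "\<forall>y\<in>a ` K. norm y \<le> C" using compact_imp_bounded bounded_iff by metis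
  then have "\<forall>x\<in>K. \<bar>a x\<bar> \<le> C" by simp
  then show ?thesis unfolding unif_bounded_def using family_const[OF assms] by (auto intro: always_eventually)
qed

lemma unif_bounded_add:
  assumes "unif_bounded f" "unif_bounded g"
  shows "unif_bounded (\<lambda>l x. f l x + g l x)"
proof -
  obtain C D where "\<forall>\<^sub>F l in at_right 0. \<forall>x\<in>K. \<bar>f l x\<bar> \<le> C" "\<forall>\<^sub>F l in at_right 0. \<forall>x\<in>K. \<bar>g l x\<bar> \<le> D"
    using assms by (auto simp: unif_bounded_def)
  then have "\<forall>\<^sub>F l in at_right 0. \<forall>x\<in>K. \<bar>f l x + g l x\<bar> \<le> C + D"
    by eventually_elim (meson abs_triangle_ineq add_mono order_trans)
  then show ?thesis unfolding unif_bounded_def using assms family_add unif_bounded_family by blast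
qed

lemma unif_bounded_mult:
  assumes "unif_bounded f" "unif_bounded g"
  shows "unif_bounded (\<lambda>l x. f l x * g l x)"
proof -
  obtain C D where "\<forall>\<^sub>F l in at_right 0. \<forall>x\<in>K. \<bar>f l x\<bar> \<le> C" "\<forall>\<^sub>F l in at_right 0. \<forall>x\<in>K. \<bar>g l x\<bar> \<le> D"
    using assms by (auto simp: unif_bounded_def)
  then have "\<forall>\<^sub>F l in at_right 0. \<forall>x\<in>K. \<bar>f l x * g l x\<bar> \<le> C * D"
  proof eventually_elim
    case (elim l)
    show ?case
    proof
      fix x assume x: "x \<in> K"
      show "\<bar>f l x * g l x\<bar> \<le> C * D"
        unfolding abs_mult using elim x order_trans[OF abs_ge_zero] by (intro mult_mono) blast+
    qed
  qed
  then show ?thesis unfolding unif_bounded_def using assms family_mult unif_bounded_family by blast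
qed

lemma unif_bounded_sum:
  assumes "finite I" "\<And>i. i \<in> I \<Longrightarrow> unif_bounded (f i)"
  shows "unif_bounded (\<lambda>l x. \<Sum>i\<in>I. f i l x)"
  using assms
proof (induction I rule: finite_induct)
  case empty
  then show ?case using unif_bounded_const[OF smooth_on_const[of U 0]] by simp
next
  case (insert i I)
  have "unif_bounded (\<lambda>l x. f i l x + (\<Sum>i\<in>I. f i l x))"
    by (rule unif_bounded_add) (use insert in auto)
  then show ?case using insert by simp
qed

lemma unif_null_add:
  assumes "unif_null f" "unif_null g"
  shows "unif_null (\<lambda>l x. f l x + g l x)"
  unfolding unif_null_def
proof (intro conjI allI impI family_add unif_null_family assms)
  fix \<epsilon> :: real assume "\<epsilon> > 0"
  then have "\<epsilon> / 2 > 0" by simp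
  then have "\<forall>\<^sub>F l in at_right 0. \<forall>x\<in>K. \<bar>f l x\<bar> \<le> \<epsilon> / 2" "\<forall>\<^sub>F l in at_right 0. \<forall>x\<in>K. \<bar>g l x\<bar> \<le> \<epsilon> / 2"
    using assms unfolding unif_null_def by blast+
  then show "\<forall>\<^sub>F l in at_right 0. \<forall>x\<in>K. \<bar>f l x + g l x\<bar> \<le> \<epsilon>"
    by eventually_elim (smt (verit) field_sum_of_halves)
qed

lemma unif_null_mult:
  assumes "unif_null f" "unif_bounded g"
  shows "unif_null (\<lambda>l x. f l x * g l x)"
  unfolding unif_null_def
proof (intro conjI allI impI family_mult[OF unif_null_family[OF assms(1)] unif_bounded_family[OF assms(2)]])
  fix \<epsilon> :: real assume e: "\<epsilon> > 0"
  obtain C where C: "\<forall>\<^sub>F l in at_right 0. \<forall>x\<in>K. \<bar>g l x\<bar> \<le> C"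
    using assms by (auto simp: unif_bounded_def)
  define D where "D = \<bar>C\<bar> + 1"
  have D: "D > 0" "C \<le> D" by (auto simp: D_def)
  have "\<forall>\<^sub>F l in at_right 0. \<forall>x\<in>K. \<bar>f l x\<bar> \<le> \<epsilon> / D"
    using assms(1) e D by (auto simp: unif_null_def)
  then show "\<forall>\<^sub>F l in at_right 0. \<forall>x\<in>K. \<bar>f l x * g l x\<bar> \<le> \<epsilon>"
    using C
  proof eventually_elim
    case (elim l)
    show ?case
    proof
      fix x assume x: "x \<in> K"
      have "\<bar>f l x\<bar> * \<bar>g l x\<bar> \<le> (\<epsilon> / D) * D"
        using elim x D e by (intro mult_mono) (auto intro: order_trans)
      then show "\<bar>f l x * g l x\<bar> \<le> \<epsilon>" using D by (simp add: abs_mult)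
    qed
  qed
qed

lemma unif_null_mult': "unif_bounded g \<Longrightarrow> unif_null f \<Longrightarrow> unif_null (\<lambda>l x. g l x * f l x)"
  using unif_null_mult[of f g] by (simp add: mult.commute)

lemma unif_null_cmult: "unif_null f \<Longrightarrow> unif_null (\<lambda>l x. c * f l x)"
  by (rule unif_null_mult'[OF unif_bounded_const[OF smooth_on_const]])

lemma unif_bounded_cmult: "unif_bounded f \<Longrightarrow> unif_bounded (\<lambda>l x. c * f l x)"
  by (rule unif_bounded_mult[OF unif_bounded_const[OF smooth_on_const]])

lemma unif_null_zero: "unif_null (\<lambda>l x. 0)"
  by (simp add: unif_null_def family_const smooth_on_const)

lemma unif_null_sum:
  assumes "finite I" "\<And>i. i \<in> I \<Longrightarrow> unif_null (f i)"
  shows "unif_null (\<lambda>l x. \<Sum>i\<in>I. f i l x)"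
  using assms
proof (induction I rule: finite_induct)
  case empty
  then show ?case using unif_null_zero by simp
next
  case (insert i I)
  have "unif_null (\<lambda>l x. f i l x + (\<Sum>i\<in>I. f i l x))"
    by (rule unif_null_add) (use insert in auto)
  then show ?case using insert by simp
qed

lemma unif_null_diff: "unif_null f \<Longrightarrow> unif_null g \<Longrightarrow> unif_null (\<lambda>l x. f l x - g l x)"
  using unif_null_add[OF _ unif_null_cmult[of g "-1"], of f] by simp

lemma unif_bounded_diff: "unif_bounded f \<Longrightarrow> unif_bounded g \<Longrightarrow> unif_bounded (\<lambda>l x. f l x - g l x)"
  using unif_bounded_add[OF _ unif_bounded_cmult[of g "-1"], of f] by simp

lemma unif_null_cong:
  assumes "unif_null f" "\<And>l x. l > 0 \<Longrightarrow> x \<in> U \<Longrightarrow> f l x = g l x"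
  shows "unif_null g"
  unfolding unif_null_def
proof (intro conjI allI impI)
  show "family g" using unif_null_family[OF assms(1)] assms(2) by (rule family_cong)
  fix \<epsilon> :: real assume "\<epsilon> > 0"
  then have "\<forall>\<^sub>F l in at_right 0. \<forall>x\<in>K. \<bar>f l x\<bar> \<le> \<epsilon>" using assms(1) by (simp add: unif_null_def)
  then show "\<forall>\<^sub>F l in at_right 0. \<forall>x\<in>K. \<bar>g l x\<bar> \<le> \<epsilon>"
    using pos_at_right by eventually_elim (use assms(2) K_subset in \<open>simp add: subset_iff\<close>)
qed

lemma unif_bounded_cong:
  assumes "unif_bounded f" "\<And>l x. l > 0 \<Longrightarrow> x \<in> U \<Longrightarrow> f l x = g l x"
  shows "unif_bounded g"
proof -
  obtain C where "\<forall>\<^sub>F l in at_right 0. \<forall>x\<in>K. \<bar>f l x\<bar> \<le> C" using assms(1) by (auto simp: unif_bounded_def)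
  then have "\<forall>\<^sub>F l in at_right 0. \<forall>x\<in>K. \<bar>g l x\<bar> \<le> C"
    using pos_at_right by eventually_elim (use assms(2) K_subset in \<open>simp add: subset_iff\<close>)
  then show ?thesis
    unfolding unif_bounded_def using family_cong[OF unif_bounded_family[OF assms(1)] assms(2)] by blast
qed

lemma weak_null_cong:
  assumes "weak_null f" "\<And>l x. l > 0 \<Longrightarrow> x \<in> U \<Longrightarrow> f l x = g l x"
  shows "weak_null g"
  unfolding weak_null_def
proof (intro conjI allI impI)
  show "family g" using weak_null_family[OF assms(1)] assms(2) by (rule family_cong)
  fix \<psi> assume \<psi>: "test_fun \<psi>"
  have eq: "(\<integral>x. \<psi> x * f l x \<partial>lborel) = (\<integral>x. \<psi> x * g l x \<partial>lborel)" if "l > 0" for l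
  proof (rule Bochner_Integration.integral_cong)
    show "\<psi> x * f l x = \<psi> x * g l x" for x
      using assms(2)[OF that, of x] \<psi> K_subset by (cases "x \<in> U") (auto simp: test_fun_def)
  qed simp
  have "((\<lambda>l. \<integral>x. \<psi> x * f l x \<partial>lborel) \<longlongrightarrow> 0) (at_right 0)"
    using assms(1) \<psi> by (simp add: weak_null_def)
  then show "((\<lambda>l. \<integral>x. \<psi> x * g l x \<partial>lborel) \<longlongrightarrow> 0) (at_right 0)"
    by (rule Lim_transform_eventually) (use pos_at_right in \<open>eventually_elim, simp add: eq\<close>)
qed

lemma weak_null_add:
  assumes "weak_null f" "weak_null g"
  shows "weak_null (\<lambda>l x. f l x + g l x)"
  unfolding weak_null_def
proof (intro conjI allI impI family_add weak_null_family assms)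
  fix \<psi> assume \<psi>: "test_fun \<psi>"
  have eq: "(\<integral>x. \<psi> x * f l x \<partial>lborel) + (\<integral>x. \<psi> x * g l x \<partial>lborel) = (\<integral>x. \<psi> x * (f l x + g l x) \<partial>lborel)"
    if "l > 0" for l
  proof -
    have "integrable lborel (\<lambda>x. \<psi> x * f l x)" "integrable lborel (\<lambda>x. \<psi> x * g l x)"
      using assms[THEN weak_null_family] that \<psi> by (auto simp: family_def intro: integrable_test)
    from Bochner_Integration.integral_add[OF this] show ?thesis by (simp add: distrib_left)
  qed
  have "((\<lambda>l. (\<integral>x. \<psi> x * f l x \<partial>lborel) + (\<integral>x. \<psi> x * g l x \<partial>lborel)) \<longlongrightarrow> 0 + 0) (at_right 0)"
    using assms \<psi> by (intro tendsto_add) (auto simp: weak_null_def)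
  then have "((\<lambda>l. (\<integral>x. \<psi> x * f l x \<partial>lborel) + (\<integral>x. \<psi> x * g l x \<partial>lborel)) \<longlongrightarrow> 0) (at_right 0)" by simp
  then show "((\<lambda>l. \<integral>x. \<psi> x * (f l x + g l x) \<partial>lborel) \<longlongrightarrow> 0) (at_right 0)"
    by (rule Lim_transform_eventually) (use pos_at_right in \<open>eventually_elim, simp add: eq\<close>)
qed

text \<open>A smooth coefficient that does not depend on \<open>l\<close> is absorbed into the test
  function.\<close>

lemma weak_null_smooth_mult:
  assumes "smooth_on U a" "weak_null f"
  shows "weak_null (\<lambda>l x. a x * f l x)"
  unfolding weak_null_def
proof (intro conjI allI impI family_mult family_const weak_null_family assms)
  fix \<psi> assume "test_fun \<psi>"
  then have "test_fun (\<lambda>x. \<psi> x * a x)" using assms(1) by (rule test_fun_mult)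
  then have "((\<lambda>l. \<integral>x. \<psi> x * a x * f l x \<partial>lborel) \<longlongrightarrow> 0) (at_right 0)"
    using assms(2) unfolding weak_null_def by blast
  then show "((\<lambda>l. \<integral>x. \<psi> x * (a x * f l x) \<partial>lborel) \<longlongrightarrow> 0) (at_right 0)" by (simp add: mult.assoc)
qed

lemma weak_null_cmult: "weak_null f \<Longrightarrow> weak_null (\<lambda>l x. c * f l x)"
  by (rule weak_null_smooth_mult[OF smooth_on_const])

lemma weak_null_diff: "weak_null f \<Longrightarrow> weak_null g \<Longrightarrow> weak_null (\<lambda>l x. f l x - g l x)"
  using weak_null_add[OF _ weak_null_cmult[of g "-1"], of f] by simp

lemma unif_null_weak_null:
  assumes "unif_null f"
  shows "weak_null f"
  unfolding weak_null_def
proof (intro conjI allI impI unif_null_family assms)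
  fix \<psi> assume \<psi>: "test_fun \<psi>"
  have a: "integrable lborel (\<lambda>x. \<bar>\<psi> x\<bar>)"
    using integrable_test[OF \<psi> smooth_on_const[of U 1]] by simp
  \<comment> \<open>The added 1 allows division by \<open>N\<close> even for the zero test function
    and makes the final estimate strict.\<close>
  define N where "N = (\<integral>x. \<bar>\<psi> x\<bar> \<partial>lborel) + 1"
  have N0: "(\<integral>x. \<bar>\<psi> x\<bar> \<partial>lborel) \<ge> 0" by simp
  then have N: "N > 0" unfolding N_def by linarith
  show "((\<lambda>l. \<integral>x. \<psi> x * f l x \<partial>lborel) \<longlongrightarrow> 0) (at_right 0)"
  proof (rule tendstoI)
    fix \<epsilon> :: real assume e: "\<epsilon> > 0"
    have "\<forall>\<^sub>F l in at_right 0. \<forall>x\<in>K. \<bar>f l x\<bar> \<le> \<epsilon> / N"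
      using assms e N by (auto simp: unif_null_def)
    then show "\<forall>\<^sub>F l in at_right 0. dist (\<integral>x. \<psi> x * f l x \<partial>lborel) 0 < \<epsilon>"
      using pos_at_right
    proof eventually_elim
      case (elim l)
      have "norm (\<integral>x. \<psi> x * f l x \<partial>lborel) \<le> (\<integral>x. \<bar>\<psi> x\<bar> * (\<epsilon> / N) \<partial>lborel)"
      proof (rule order_trans[OF integral_norm_bound integral_mono])
        show "integrable lborel (\<lambda>x. norm (\<psi> x * f l x))"
          using unif_null_family[OF assms] elim(2) by (intro integrable_norm integrable_test \<psi>) (simp add: family_def)
        show "integrable lborel (\<lambda>x. \<bar>\<psi> x\<bar> * (\<epsilon> / N))" using a by simp
        fix x
        show "norm (\<psi> x * f l x) \<le> \<bar>\<psi> x\<bar> * (\<epsilon> / N)"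
        proof (cases "x \<in> K")
          case True
          then have "\<bar>\<psi> x\<bar> * \<bar>f l x\<bar> \<le> \<bar>\<psi> x\<bar> * (\<epsilon> / N)" using elim(1) by (intro mult_left_mono) auto
          then show ?thesis by (simp only: real_norm_def abs_mult)
        qed (use \<psi> in \<open>simp add: test_fun_def\<close>)
      qed
      also have "\<dots> = (\<integral>x. \<bar>\<psi> x\<bar> \<partial>lborel) * (\<epsilon> / N)" by simp
      also have "\<dots> < N * (\<epsilon> / N)" using e N by (intro mult_strict_right_mono) (auto simp: N_def)
      also have "\<dots> = \<epsilon>" using N by simp
      finally show ?case by simp
    qed
  qed
qed

lemma weak_null_sum:
  assumes "finite I" "\<And>i. i \<in> I \<Longrightarrow> weak_null (f i)"
  shows "weak_null (\<lambda>l x. \<Sum>i\<in>I. f i l x)"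
  using assms
proof (induction I rule: finite_induct)
  case empty
  then show ?case using unif_null_weak_null[OF unif_null_zero] by simp
next
  case (insert i I)
  have "weak_null (\<lambda>l x. f i l x + (\<Sum>i\<in>I. f i l x))"
    by (rule weak_null_add) (use insert in auto)
  then show ?case using insert by simp
qed

text \<open>The derivative moves to the test function, so no bound on the derivative of
  \<open>f\<close> enters. This is how the uncontrolled second derivatives of the perturbation are
  disposed of.\<close>

lemma weak_null_partial:
  assumes "weak_null f"
  shows "weak_null (\<lambda>l. partial i (f l))"
  unfolding weak_null_def
proof (intro conjI allI impI family_partial weak_null_family assms)
  fix \<psi> assume \<psi>: "test_fun \<psi>"
  then have s: "smooth_on UNIV \<psi>" and z: "\<And>x. x \<notin> K \<Longrightarrow> \<psi> x = 0" by (auto simp: test_fun_def)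
  have d0: "\<And>x. x \<notin> K \<Longrightarrow> partial i \<psi> x = 0"
    by (rule integral_by_parts(2)[OF open_U compact_K K_subset s z smooth_on_const[of U 0]])
  have "test_fun (partial i \<psi>)" using smooth_on_partial[OF s] d0 by (simp add: test_fun_def)
  then have "((\<lambda>l. - (\<integral>x. partial i \<psi> x * f l x \<partial>lborel)) \<longlongrightarrow> - 0) (at_right 0)"
    using assms by (intro tendsto_minus) (auto simp: weak_null_def)
  then have *: "((\<lambda>l. - (\<integral>x. partial i \<psi> x * f l x \<partial>lborel)) \<longlongrightarrow> 0) (at_right 0)" by simp
  have eq: "(\<integral>x. \<psi> x * partial i (f l) x \<partial>lborel) = - (\<integral>x. partial i \<psi> x * f l x \<partial>lborel)" if "l > 0" for l
    by (rule integral_by_parts(1)[OF open_U compact_K K_subset s z])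
      (use weak_null_family[OF assms] that in \<open>auto simp: family_def\<close>)
  show "((\<lambda>l. \<integral>x. \<psi> x * partial i (f l) x \<partial>lborel) \<longlongrightarrow> 0) (at_right 0)"
    by (rule Lim_transform_eventually[OF *]) (use pos_at_right in \<open>eventually_elim, simp add: eq\<close>)
qed

text \<open>The fundamental lemma of the calculus of variations at one point: were
  \<open>q a\<close> nonzero, a bump inside the ball, supported where \<open>q\<close> keeps its
  sign, would have a nonzero integral against \<open>q\<close>. The ball guarantees that this bump
  is an admissible test function.\<close>

lemma weak_null_const:
  assumes "weak_null (\<lambda>l. q)" "ball a r \<subseteq> K" "r > 0"
  shows "q a = 0"
proof (rule ccontr)
  assume ne: "q a \<noteq> 0"
  have sq: "smooth_on U q" using weak_null_family[OF assms(1)] zero_less_one unfolding family_def by blast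
  have "a \<in> ball a r" using assms(3) by simp
  then have aU: "a \<in> U" using assms(2) K_subset by blast
  have "isCont q a"
    using smooth_on_imp_continuous_on[OF sq] open_U aU continuous_on_eq_continuous_at by blast
  then obtain d where d: "d > 0" "\<And>x. dist x a < d \<Longrightarrow> \<bar>q x - q a\<bar> < \<bar>q a\<bar>"
    using ne unfolding continuous_at_eps_delta by (metis dist_real_def zero_less_abs_iff)
  define s where "s = min (d / 2) (r / 2)"
  have s: "s > 0" "s < d" "s < r" using d assms by (auto simp: s_def)
  define \<psi> where "\<psi> = bump a s"
  have nz: "\<psi> x = 0" if "s \<le> norm (x - a)" for x using bump_zero[of s x a] s that by (simp add: \<psi>_def)
  have \<psi>: "test_fun \<psi>"
  proof -
    have "\<psi> x = 0" if "x \<notin> K" for x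
    proof (rule nz)
      have "x \<notin> ball a r" using that assms by auto
      then show "s \<le> norm (x - a)" using s by (simp add: dist_norm norm_minus_commute)
    qed
    then show ?thesis by (simp add: test_fun_def \<psi>_def smooth_on_bump)
  qed
  have lim: "((\<lambda>l::real. \<integral>x. \<psi> x * q x \<partial>lborel) \<longlongrightarrow> 0) (at_right 0)"
    using assms(1) \<psi> by (simp add: weak_null_def)
  have int: "(\<integral>x. \<psi> x * q x \<partial>lborel) = 0"
    \<comment> \<open>The integral does not depend on \<open>l\<close>, so its limit zero is its
      value.\<close>
    using tendsto_unique[OF trivial_limit_at_right_real tendsto_const lim] .
  define f where "f x = \<psi> x * (q x * sgn (q a))" for x
  have "f x \<ge> 0" for x
  proof (cases "norm (x - a) < s")
    case True
    then have "\<bar>q x - q a\<bar> < \<bar>q a\<bar>" using d s by (simp add: dist_norm)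
    then have "q x * sgn (q a) \<ge> 0" by (auto simp: sgn_if abs_if split: if_splits)
    then show ?thesis by (simp add: f_def \<psi>_def bump_nonneg)
  qed (use nz in \<open>simp add: f_def\<close>)
  moreover have cf: "continuous_on UNIV f"
  proof -
    have "smooth_on UNIV (\<lambda>x. \<psi> x * q x)"
      by (rule smooth_on_times_support[OF open_U compact_K K_subset _ _ sq]) (use \<psi> in \<open>auto simp: test_fun_def\<close>)
    then have "continuous_on UNIV (\<lambda>x. \<psi> x * q x * sgn (q a))"
      by (intro continuous_intros smooth_on_imp_continuous_on)
    then show ?thesis by (simp add: f_def[abs_def] mult.assoc)
  qed
  moreover have "integrable lborel f"
    by (rule integrable_compact_support[OF cf compact_K]) (use \<psi> in \<open>simp add: f_def test_fun_def\<close>)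
  moreover have "(\<integral>x. f x \<partial>lborel) = 0"
  proof -
    have "(\<integral>x. f x \<partial>lborel) = (\<integral>x. \<psi> x * q x * sgn (q a) \<partial>lborel)" by (simp add: f_def mult.assoc)
    also have "\<dots> = (\<integral>x. \<psi> x * q x \<partial>lborel) * sgn (q a)" by simp
    finally show ?thesis using int by simp
  qed
  ultimately have ae: "AE x in lborel. f x = 0"
    by (subst (asm) integral_nonneg_eq_0_iff_AE) auto
  have fa: "f a > 0" using bump_pos[of a a s] s ne by (simp add: f_def \<psi>_def flip: abs_sgn)
  have "isCont f a" using cf continuous_on_eq_continuous_at by blast
  then obtain e where e: "e > 0" "\<And>x. dist x a < e \<Longrightarrow> \<bar>f x - f a\<bar> < f a"
    using fa unfolding continuous_at_eps_delta dist_real_def by blast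
  have "ball a e \<subseteq> {x. f x \<noteq> 0}" using e by (force simp: dist_commute)
  moreover obtain N where "{x \<in> space lborel. \<not> f x = 0} \<subseteq> N" "emeasure lborel N = 0" "N \<in> sets lborel"
    using ae by (rule AE_E)
  ultimately have "ball a e \<subseteq> N" "N \<in> null_sets lborel" by auto
  then have "ball a e \<in> null_sets lborel" by (metis null_sets_subset sets_lborel borel_open open_ball)
  then have "measure lborel (ball a e) = 0" by (simp add: null_sets_def measure_def)
  then show False using content_ball_pos[OF e(1), of a] by simp
qed

end

subsection \<open>The quadratic terms cancel\<close>

text \<open>Here \<open>G\<close> is an inverse metric at a point and \<open>H c i j\<close> stands for the derivative of \<open>h\<^sub>i\<^sub>j\<close> in
  direction \<open>c\<close>. Every complete contraction of \<open>H \<otimes> H\<close> is one of the five invariants \<open>quad_inv0\<close>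
  to \<open>quad_inv4\<close>; the cancellation is checked on their coefficients.\<close>

definition contr :: "(4 \<Rightarrow> 4 \<Rightarrow> real) \<Rightarrow> (4 \<times> 4 \<times> 4 \<times> 4 \<times> 4 \<times> 4 \<Rightarrow> real) \<Rightarrow> real" where
  "contr G F = (\<Sum>(a, a1, b, b1, c, c1)\<in>UNIV. G a a1 * G b b1 * G c c1 * F (a, a1, b, b1, c, c1))"

context
  fixes G :: "4 \<Rightarrow> 4 \<Rightarrow> real" and H :: "4 \<Rightarrow> 4 \<Rightarrow> 4 \<Rightarrow> real"
  assumes G_sym: "G i j = G j i" and H_sym: "H c i j = H c j i"
begin

text \<open>In order: the divergence of \<open>h\<close> times the gradient of its trace, the square
  of the divergence, the square of the gradient of the trace, the full square of the gradient, and
  the gradient paired with itself after exchanging the derivative index with a tensor index.\<close>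

definition "quad_inv0 = contr G (\<lambda>(a, a1, b, b1, c, c1). H a a1 b * H b1 c c1)"
definition "quad_inv1 = contr G (\<lambda>(a, a1, b, b1, c, c1). H a a1 b * H c b1 c1)"
definition "quad_inv2 = contr G (\<lambda>(a, a1, b, b1, c, c1). H a b b1 * H a1 c c1)"
definition "quad_inv3 = contr G (\<lambda>(a, a1, b, b1, c, c1). H a b c * H a1 b1 c1)"
definition "quad_inv4 = contr G (\<lambda>(a, a1, b, b1, c, c1). H a b c * H b1 a1 c1)"

text \<open>Each \<open>contr_monomial\<close> lemma renames the summation indices: the two maps are
  mutually inverse, permute the pairs joined by \<open>G\<close> and swap partners within a pair.
  Symmetry of \<open>G\<close> keeps the weight, symmetry of \<open>H\<close> in its last two
  arguments matches the rest.\<close>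

lemma contr_monomial0: "contr G (\<lambda>(a, a1, b, b1, c, c1). H c a1 b1 * H a b c1) = quad_inv4"
  unfolding contr_def quad_inv4_def
  by (rule sum.reindex_bij_witness[where j = "\<lambda>(a, a1, b, b1, c, c1). (a, a1, c1, c, b, b1)" and i = "\<lambda>(a, a1, b, b1, c, c1). (a, a1, c, c1, b1, b)"])
    (auto simp: G_sym H_sym mult_ac)

lemma contr_monomial1: "contr G (\<lambda>(a, a1, b, b1, c, c1). H c a1 b1 * H b a c1) = quad_inv4"
  unfolding contr_def quad_inv4_def
  by (rule sum.reindex_bij_witness[where j = "\<lambda>(a, a1, b, b1, c, c1). (b, b1, c1, c, a, a1)" and i = "\<lambda>(a, a1, b, b1, c, c1). (c, c1, a, a1, b1, b)"])
    (auto simp: G_sym H_sym mult_ac)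

lemma contr_monomial2: "contr G (\<lambda>(a, a1, b, b1, c, c1). H c a1 b1 * H c1 a b) = quad_inv3"
  unfolding contr_def quad_inv3_def
  by (rule sum.reindex_bij_witness[where j = "\<lambda>(a, a1, b, b1, c, c1). (c1, c, a, a1, b, b1)" and i = "\<lambda>(a, a1, b, b1, c, c1). (b, b1, c, c1, a1, a)"])
    (auto simp: G_sym H_sym mult_ac)

lemma contr_monomial3: "contr G (\<lambda>(a, a1, b, b1, c, c1). H c b b1 * H a a1 c1) = quad_inv0"
  unfolding contr_def quad_inv0_def
  by (rule sum.reindex_bij_witness[where j = "\<lambda>(a, a1, b, b1, c, c1). (a, a1, c1, c, b, b1)" and i = "\<lambda>(a, a1, b, b1, c, c1). (a, a1, c, c1, b1, b)"])
    (auto simp: G_sym H_sym mult_ac)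

lemma contr_monomial4: "contr G (\<lambda>(a, a1, b, b1, c, c1). H c b b1 * H a1 a c1) = quad_inv0"
  unfolding contr_def quad_inv0_def
  by (rule sum.reindex_bij_witness[where j = "\<lambda>(a, a1, b, b1, c, c1). (a1, a, c1, c, b, b1)" and i = "\<lambda>(a, a1, b, b1, c, c1). (a1, a, c, c1, b1, b)"])
    (auto simp: G_sym H_sym mult_ac)

lemma contr_monomial5: "contr G (\<lambda>(a, a1, b, b1, c, c1). H c b b1 * H c1 a a1) = quad_inv2"
  unfolding contr_def quad_inv2_def
  by (rule sum.reindex_bij_witness[where j = "\<lambda>(a, a1, b, b1, c, c1). (c1, c, a, a1, b, b1)" and i = "\<lambda>(a, a1, b, b1, c, c1). (b, b1, c, c1, a1, a)"])
    (auto simp: G_sym H_sym mult_ac)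

lemma contr_monomial6: "contr G (\<lambda>(a, a1, b, b1, c, c1). H a a1 b1 * H c b c1) = quad_inv1"
  unfolding contr_def quad_inv1_def
  by (rule sum.reindex_bij_witness[where j = "\<lambda>(a, a1, b, b1, c, c1). (a, a1, b1, b, c, c1)" and i = "\<lambda>(a, a1, b, b1, c, c1). (a, a1, b1, b, c, c1)"])
    (auto simp: G_sym H_sym mult_ac)

lemma contr_monomial7: "contr G (\<lambda>(a, a1, b, b1, c, c1). H a a1 b1 * H b c c1) = quad_inv0"
  unfolding contr_def quad_inv0_def
  by (rule sum.reindex_bij_witness[where j = "\<lambda>(a, a1, b, b1, c, c1). (a, a1, b1, b, c, c1)" and i = "\<lambda>(a, a1, b, b1, c, c1). (a, a1, b1, b, c, c1)"])
    (auto simp: G_sym H_sym mult_ac)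

lemma contr_monomial8: "contr G (\<lambda>(a, a1, b, b1, c, c1). H a a1 b1 * H c1 b c) = quad_inv1"
  unfolding contr_def quad_inv1_def
  by (rule sum.reindex_bij_witness[where j = "\<lambda>(a, a1, b, b1, c, c1). (a, a1, b1, b, c1, c)" and i = "\<lambda>(a, a1, b, b1, c, c1). (a, a1, b1, b, c1, c)"])
    (auto simp: G_sym H_sym mult_ac)

lemma contr_monomial9: "contr G (\<lambda>(a, a1, b, b1, c, c1). H a b b1 * H c a1 c1) = quad_inv0"
  unfolding contr_def quad_inv0_def
  by (rule sum.reindex_bij_witness[where j = "\<lambda>(a, a1, b, b1, c, c1). (c, c1, a1, a, b, b1)" and i = "\<lambda>(a, a1, b, b1, c, c1). (b1, b, c, c1, a, a1)"])
    (auto simp: G_sym H_sym mult_ac)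

lemma contr_monomial10: "contr G (\<lambda>(a, a1, b, b1, c, c1). H a b b1 * H a1 c c1) = quad_inv2"
  unfolding contr_def quad_inv2_def
  by (rule sum.reindex_bij_witness[where j = "\<lambda>(a, a1, b, b1, c, c1). (a, a1, b, b1, c, c1)" and i = "\<lambda>(a, a1, b, b1, c, c1). (a, a1, b, b1, c, c1)"])
    (auto simp: G_sym H_sym mult_ac)

lemma contr_monomial11: "contr G (\<lambda>(a, a1, b, b1, c, c1). H a b b1 * H c1 a1 c) = quad_inv0"
  unfolding contr_def quad_inv0_def
  by (rule sum.reindex_bij_witness[where j = "\<lambda>(a, a1, b, b1, c, c1). (c1, c, a1, a, b, b1)" and i = "\<lambda>(a, a1, b, b1, c, c1). (b1, b, c, c1, a1, a)"])
    (auto simp: G_sym H_sym mult_ac)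

lemma contr_monomial12: "contr G (\<lambda>(a, a1, b, b1, c, c1). H a1 a b1 * H b c c1) = quad_inv0"
  unfolding contr_def quad_inv0_def
  by (rule sum.reindex_bij_witness[where j = "\<lambda>(a, a1, b, b1, c, c1). (a1, a, b1, b, c, c1)" and i = "\<lambda>(a, a1, b, b1, c, c1). (a1, a, b1, b, c, c1)"])
    (auto simp: G_sym H_sym mult_ac)

lemma contr_monomial13: "contr G (\<lambda>(a, a1, b, b1, c, c1). H a1 a b1 * H c b c1) = quad_inv1"
  unfolding contr_def quad_inv1_def
  by (rule sum.reindex_bij_witness[where j = "\<lambda>(a, a1, b, b1, c, c1). (a1, a, b1, b, c, c1)" and i = "\<lambda>(a, a1, b, b1, c, c1). (a1, a, b1, b, c, c1)"])
    (auto simp: G_sym H_sym mult_ac)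

lemma contr_monomial14: "contr G (\<lambda>(a, a1, b, b1, c, c1). H a1 a b1 * H c1 b c) = quad_inv1"
  unfolding contr_def quad_inv1_def
  by (rule sum.reindex_bij_witness[where j = "\<lambda>(a, a1, b, b1, c, c1). (a1, a, b1, b, c1, c)" and i = "\<lambda>(a, a1, b, b1, c, c1). (a1, a, b1, b, c1, c)"])
    (auto simp: G_sym H_sym mult_ac)

lemma contr_monomial15: "contr G (\<lambda>(a, a1, b, b1, c, c1). H b1 a a1 * H b c c1) = quad_inv2"
  unfolding contr_def quad_inv2_def
  by (rule sum.reindex_bij_witness[where j = "\<lambda>(a, a1, b, b1, c, c1). (b1, b, a, a1, c, c1)" and i = "\<lambda>(a, a1, b, b1, c, c1). (b, b1, a1, a, c, c1)"])
    (auto simp: G_sym H_sym mult_ac)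

lemma contr_monomial16: "contr G (\<lambda>(a, a1, b, b1, c, c1). H b1 a a1 * H c b c1) = quad_inv0"
  unfolding contr_def quad_inv0_def
  by (rule sum.reindex_bij_witness[where j = "\<lambda>(a, a1, b, b1, c, c1). (c, c1, b, b1, a, a1)" and i = "\<lambda>(a, a1, b, b1, c, c1). (c, c1, b, b1, a, a1)"])
    (auto simp: G_sym H_sym mult_ac)

lemma contr_monomial17: "contr G (\<lambda>(a, a1, b, b1, c, c1). H b1 a a1 * H c1 b c) = quad_inv0"
  unfolding contr_def quad_inv0_def
  by (rule sum.reindex_bij_witness[where j = "\<lambda>(a, a1, b, b1, c, c1). (c1, c, b, b1, a, a1)" and i = "\<lambda>(a, a1, b, b1, c, c1). (c, c1, b, b1, a1, a)"])
    (auto simp: G_sym H_sym mult_ac)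

lemma contr_monomial18: "contr G (\<lambda>(a, a1, b, b1, c, c1). H a1 b1 c * H b a c1) = quad_inv4"
  unfolding contr_def quad_inv4_def
  by (rule sum.reindex_bij_witness[where j = "\<lambda>(a, a1, b, b1, c, c1). (a1, a, b1, b, c, c1)" and i = "\<lambda>(a, a1, b, b1, c, c1). (a1, a, b1, b, c, c1)"])
    (auto simp: G_sym H_sym mult_ac)

lemma contr_monomial19: "contr G (\<lambda>(a, a1, b, b1, c, c1). H a1 b1 c * H a b c1) = quad_inv3"
  unfolding contr_def quad_inv3_def
  by (rule sum.reindex_bij_witness[where j = "\<lambda>(a, a1, b, b1, c, c1). (a, a1, b, b1, c1, c)" and i = "\<lambda>(a, a1, b, b1, c, c1). (a, a1, b, b1, c1, c)"])
    (auto simp: G_sym H_sym mult_ac)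

lemma contr_monomial20: "contr G (\<lambda>(a, a1, b, b1, c, c1). H a1 b1 c * H c1 a b) = quad_inv4"
  unfolding contr_def quad_inv4_def
  by (rule sum.reindex_bij_witness[where j = "\<lambda>(a, a1, b, b1, c, c1). (a1, a, c, c1, b1, b)" and i = "\<lambda>(a, a1, b, b1, c, c1). (a1, a, c1, c, b, b1)"])
    (auto simp: G_sym H_sym mult_ac)

lemma contr_monomial21: "contr G (\<lambda>(a, a1, b, b1, c, c1). H b1 a1 c * H b a c1) = quad_inv3"
  unfolding contr_def quad_inv3_def
  by (rule sum.reindex_bij_witness[where j = "\<lambda>(a, a1, b, b1, c, c1). (b, b1, a, a1, c1, c)" and i = "\<lambda>(a, a1, b, b1, c, c1). (b, b1, a, a1, c1, c)"])
    (auto simp: G_sym H_sym mult_ac)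

lemma contr_monomial22: "contr G (\<lambda>(a, a1, b, b1, c, c1). H b1 a1 c * H a b c1) = quad_inv4"
  unfolding contr_def quad_inv4_def
  by (rule sum.reindex_bij_witness[where j = "\<lambda>(a, a1, b, b1, c, c1). (a, a1, b, b1, c1, c)" and i = "\<lambda>(a, a1, b, b1, c, c1). (a, a1, b, b1, c1, c)"])
    (auto simp: G_sym H_sym mult_ac)

lemma contr_monomial23: "contr G (\<lambda>(a, a1, b, b1, c, c1). H b1 a1 c * H c1 a b) = quad_inv4"
  unfolding contr_def quad_inv4_def
  by (rule sum.reindex_bij_witness[where j = "\<lambda>(a, a1, b, b1, c, c1). (b1, b, c, c1, a1, a)" and i = "\<lambda>(a, a1, b, b1, c, c1). (c1, c, a1, a, b, b1)"])
    (auto simp: G_sym H_sym mult_ac)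

text \<open>Twice the Christoffel symbol of the first kind formed from \<open>H\<close>; the factor
  1/2 enters with \<open>lin_chr\<close>.\<close>

definition "low_chr m j k = H j m k + H k m j - H m j k"

lemma contr_add: "contr G (\<lambda>t. F t + F' t) = contr G F + contr G F'"
  by (simp add: contr_def case_prod_beta' sum.distrib distrib_left)

lemma contr_diff: "contr G (\<lambda>t. F t - F' t) = contr G F - contr G F'"
  by (simp add: contr_def case_prod_beta' sum_subtractf right_diff_distrib)

text \<open>The six \<open>contr_term\<close> lemmas multiply out \<open>low_chr\<close> into three
  or nine monomials and collect invariants. The square of the divergence, \<open>quad_inv1\<close>,
  drops out of all six.\<close>

lemma contr_term1: "contr G (\<lambda>(a, a1, b, b1, c, c1). H c a1 b1 * low_chr c1 a b) = 0 - 1 * quad_inv3 + 2 * quad_inv4"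
proof -
  have "(\<lambda>(a, a1, b, b1, c, c1). H c a1 b1 * low_chr c1 a b) = (\<lambda>t. (\<lambda>(a, a1, b, b1, c, c1). H c a1 b1 * H a b c1) t
      + (\<lambda>(a, a1, b, b1, c, c1). H c a1 b1 * H b a c1) t
      - (\<lambda>(a, a1, b, b1, c, c1). H c a1 b1 * H c1 a b) t)"
    by (rule ext) (auto simp: low_chr_def algebra_simps H_sym)
  then show ?thesis by (simp only: contr_add contr_diff contr_monomial0 contr_monomial1 contr_monomial2)
qed

lemma contr_term2: "contr G (\<lambda>(a, a1, b, b1, c, c1). H c b b1 * low_chr c1 a a1) = 0 + 2 * quad_inv0 - 1 * quad_inv2"
proof -
  have "(\<lambda>(a, a1, b, b1, c, c1). H c b b1 * low_chr c1 a a1) = (\<lambda>t. (\<lambda>(a, a1, b, b1, c, c1). H c b b1 * H a a1 c1) t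
      + (\<lambda>(a, a1, b, b1, c, c1). H c b b1 * H a1 a c1) t
      - (\<lambda>(a, a1, b, b1, c, c1). H c b b1 * H c1 a a1) t)"
    by (rule ext) (auto simp: low_chr_def algebra_simps H_sym)
  then show ?thesis by (simp only: contr_add contr_diff contr_monomial3 contr_monomial4 contr_monomial5)
qed

lemma contr_term3: "contr G (\<lambda>(a, a1, b, b1, c, c1). H a a1 b1 * low_chr c1 c b) = 0 + 1 * quad_inv0"
proof -
  have "(\<lambda>(a, a1, b, b1, c, c1). H a a1 b1 * low_chr c1 c b) = (\<lambda>t. (\<lambda>(a, a1, b, b1, c, c1). H a a1 b1 * H c b c1) t
      + (\<lambda>(a, a1, b, b1, c, c1). H a a1 b1 * H b c c1) t
      - (\<lambda>(a, a1, b, b1, c, c1). H a a1 b1 * H c1 b c) t)"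
    by (rule ext) (auto simp: low_chr_def algebra_simps H_sym)
  then show ?thesis by (simp only: contr_add contr_diff contr_monomial6 contr_monomial7 contr_monomial8)
qed

lemma contr_term4: "contr G (\<lambda>(a, a1, b, b1, c, c1). H a b b1 * low_chr c1 c a1) = 0 + 1 * quad_inv2"
proof -
  have "(\<lambda>(a, a1, b, b1, c, c1). H a b b1 * low_chr c1 c a1) = (\<lambda>t. (\<lambda>(a, a1, b, b1, c, c1). H a b b1 * H c a1 c1) t
      + (\<lambda>(a, a1, b, b1, c, c1). H a b b1 * H a1 c c1) t
      - (\<lambda>(a, a1, b, b1, c, c1). H a b b1 * H c1 a1 c) t)"
    by (rule ext) (auto simp: low_chr_def algebra_simps H_sym)
  then show ?thesis by (simp only: contr_add contr_diff contr_monomial9 contr_monomial10 contr_monomial11)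
qed

lemma contr_term5: "contr G (\<lambda>(a, a1, b, b1, c, c1). low_chr b1 a a1 * low_chr c1 b c) = 0 + 2 * quad_inv0 - 1 * quad_inv2"
proof -
  have "(\<lambda>(a, a1, b, b1, c, c1). low_chr b1 a a1 * low_chr c1 b c) = (\<lambda>t. (\<lambda>(a, a1, b, b1, c, c1). H a a1 b1 * H b c c1) t
      + (\<lambda>(a, a1, b, b1, c, c1). H a a1 b1 * H c b c1) t
      + (\<lambda>(a, a1, b, b1, c, c1). H a1 a b1 * H b c c1) t
      + (\<lambda>(a, a1, b, b1, c, c1). H a1 a b1 * H c b c1) t
      + (\<lambda>(a, a1, b, b1, c, c1). H b1 a a1 * H c1 b c) t
      - (\<lambda>(a, a1, b, b1, c, c1). H a a1 b1 * H c1 b c) t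
      - (\<lambda>(a, a1, b, b1, c, c1). H a1 a b1 * H c1 b c) t
      - (\<lambda>(a, a1, b, b1, c, c1). H b1 a a1 * H b c c1) t
      - (\<lambda>(a, a1, b, b1, c, c1). H b1 a a1 * H c b c1) t)"
    by (rule ext) (auto simp: low_chr_def algebra_simps H_sym)
  then show ?thesis by (simp only: contr_add contr_diff contr_monomial7 contr_monomial6 contr_monomial12 contr_monomial13 contr_monomial17 contr_monomial8 contr_monomial14 contr_monomial15 contr_monomial16)
qed

lemma contr_term6: "contr G (\<lambda>(a, a1, b, b1, c, c1). low_chr b1 c a1 * low_chr c1 b a) = 0 - 1 * quad_inv3 + 2 * quad_inv4"
proof -
  have "(\<lambda>(a, a1, b, b1, c, c1). low_chr b1 c a1 * low_chr c1 b a) = (\<lambda>t. (\<lambda>(a, a1, b, b1, c, c1). H c a1 b1 * H b a c1) t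
      + (\<lambda>(a, a1, b, b1, c, c1). H c a1 b1 * H a b c1) t
      + (\<lambda>(a, a1, b, b1, c, c1). H a1 b1 c * H b a c1) t
      + (\<lambda>(a, a1, b, b1, c, c1). H a1 b1 c * H a b c1) t
      + (\<lambda>(a, a1, b, b1, c, c1). H b1 a1 c * H c1 a b) t
      - (\<lambda>(a, a1, b, b1, c, c1). H c a1 b1 * H c1 a b) t
      - (\<lambda>(a, a1, b, b1, c, c1). H a1 b1 c * H c1 a b) t
      - (\<lambda>(a, a1, b, b1, c, c1). H b1 a1 c * H b a c1) t
      - (\<lambda>(a, a1, b, b1, c, c1). H b1 a1 c * H a b c1) t)"
    by (rule ext) (auto simp: low_chr_def algebra_simps H_sym)
  then show ?thesis by (simp only: contr_add contr_diff contr_monomial1 contr_monomial0 contr_monomial18 contr_monomial19 contr_monomial23 contr_monomial2 contr_monomial20 contr_monomial21 contr_monomial22)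
qed

lemma contr_nested:
  "contr G (\<lambda>(a, a1, b, b1, c, c1). F a a1 b b1 c c1)
    = (\<Sum>a\<in>UNIV. \<Sum>a1\<in>UNIV. \<Sum>b\<in>UNIV. \<Sum>b1\<in>UNIV. \<Sum>c\<in>UNIV. \<Sum>c1\<in>UNIV.
        G a a1 * G b b1 * G c c1 * F a a1 b b1 c c1)"
  unfolding contr_def by (simp only: sum.cartesian_product UNIV_Times_UNIV split_conv)

text \<open>\<open>contr\<close> puts every index next to its partner under \<open>G\<close>, while
  the Ricci terms sum over the tensor indices first. These are the three interleavings that occur:
  the partners are (a,i), (d,j), (b,m), then (a,d), (i,j), (b,m), then (a,d), (f,m), (b,n).\<close>

lemma sum6_reorder:
  fixes F :: "4 \<Rightarrow> 4 \<Rightarrow> 4 \<Rightarrow> 4 \<Rightarrow> 4 \<Rightarrow> 4 \<Rightarrow> real"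
  shows "(\<Sum>a\<in>UNIV. \<Sum>d\<in>UNIV. \<Sum>b\<in>UNIV. \<Sum>i\<in>UNIV. \<Sum>j\<in>UNIV. \<Sum>m\<in>UNIV. F a i d j b m)
      = (\<Sum>a\<in>UNIV. \<Sum>i\<in>UNIV. \<Sum>d\<in>UNIV. \<Sum>j\<in>UNIV. \<Sum>b\<in>UNIV. \<Sum>m\<in>UNIV. F a i d j b m)"
    and "(\<Sum>a\<in>UNIV. \<Sum>d\<in>UNIV. \<Sum>b\<in>UNIV. \<Sum>i\<in>UNIV. \<Sum>j\<in>UNIV. \<Sum>m\<in>UNIV. F a d i j b m)
      = (\<Sum>a\<in>UNIV. \<Sum>d\<in>UNIV. \<Sum>i\<in>UNIV. \<Sum>j\<in>UNIV. \<Sum>b\<in>UNIV. \<Sum>m\<in>UNIV. F a d i j b m)"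
    and "(\<Sum>a\<in>UNIV. \<Sum>d\<in>UNIV. \<Sum>b\<in>UNIV. \<Sum>f\<in>UNIV. \<Sum>m\<in>UNIV. \<Sum>n\<in>UNIV. F a d f m b n)
      = (\<Sum>a\<in>UNIV. \<Sum>d\<in>UNIV. \<Sum>f\<in>UNIV. \<Sum>m\<in>UNIV. \<Sum>b\<in>UNIV. \<Sum>n\<in>UNIV. F a d f m b n)"
proof -
  show "(\<Sum>a\<in>UNIV. \<Sum>d\<in>UNIV. \<Sum>b\<in>UNIV. \<Sum>i\<in>UNIV. \<Sum>j\<in>UNIV. \<Sum>m\<in>UNIV. F a i d j b m)
      = (\<Sum>a\<in>UNIV. \<Sum>i\<in>UNIV. \<Sum>d\<in>UNIV. \<Sum>j\<in>UNIV. \<Sum>b\<in>UNIV. \<Sum>m\<in>UNIV. F a i d j b m)"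
    unfolding sum.cartesian_product UNIV_Times_UNIV
    by (rule sum.reindex_bij_witness[where j = "\<lambda>(a, d, b, i, j, m). (a, i, d, j, b, m)"
          and i = "\<lambda>(a, i, d, j, b, m). (a, d, b, i, j, m)"]) auto
  show "(\<Sum>a\<in>UNIV. \<Sum>d\<in>UNIV. \<Sum>b\<in>UNIV. \<Sum>i\<in>UNIV. \<Sum>j\<in>UNIV. \<Sum>m\<in>UNIV. F a d i j b m)
      = (\<Sum>a\<in>UNIV. \<Sum>d\<in>UNIV. \<Sum>i\<in>UNIV. \<Sum>j\<in>UNIV. \<Sum>b\<in>UNIV. \<Sum>m\<in>UNIV. F a d i j b m)"
    unfolding sum.cartesian_product UNIV_Times_UNIV
    by (rule sum.reindex_bij_witness[where j = "\<lambda>(a, d, b, i, j, m). (a, d, i, j, b, m)"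
          and i = "\<lambda>(a, d, i, j, b, m). (a, d, b, i, j, m)"]) auto
  show "(\<Sum>a\<in>UNIV. \<Sum>d\<in>UNIV. \<Sum>b\<in>UNIV. \<Sum>f\<in>UNIV. \<Sum>m\<in>UNIV. \<Sum>n\<in>UNIV. F a d f m b n)
      = (\<Sum>a\<in>UNIV. \<Sum>d\<in>UNIV. \<Sum>f\<in>UNIV. \<Sum>m\<in>UNIV. \<Sum>b\<in>UNIV. \<Sum>n\<in>UNIV. F a d f m b n)"
    unfolding sum.cartesian_product UNIV_Times_UNIV
    by (rule sum.reindex_bij_witness[where j = "\<lambda>(a, d, b, f, m, n). (a, d, f, m, b, n)"
          and i = "\<lambda>(a, d, f, m, b, n). (a, d, b, f, m, n)"]) auto
qed

definition "lin_chr i j k = (1/2) * (\<Sum>m\<in>UNIV. G i m * low_chr m j k)"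
definition "raised c a b = (\<Sum>i\<in>UNIV. \<Sum>j\<in>UNIV. G a i * G b j * H c i j)"
definition "traced c = (\<Sum>i\<in>UNIV. \<Sum>j\<in>UNIV. G i j * H c i j)"
text \<open>The derivative of the first-order part of \<open>S\<close> with \<open>G\<close> frozen,
  that is, with the derivatives of the background metric left out.\<close>

definition "lin_weight c a b = (-1/2) * (raised c a b - (1/2) * G a b * traced c)"

lemma double_sum_times:
  fixes X :: "4 \<Rightarrow> 4 \<Rightarrow> real" and Y :: "4 \<Rightarrow> real"
  shows "(\<Sum>i\<in>UNIV. \<Sum>j\<in>UNIV. X i j) * ((1/2) * (\<Sum>m\<in>UNIV. Y m))
    = (\<Sum>i\<in>UNIV. \<Sum>j\<in>UNIV. \<Sum>m\<in>UNIV. (1/2) * (X i j * Y m))"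
  unfolding sum_distrib_right
  by (intro sum.cong refl) (simp add: sum_distrib_left sum_distrib_right sum_divide_distrib mult_ac)

lemma quad_term1: "(\<Sum>a\<in>UNIV. \<Sum>d\<in>UNIV. \<Sum>b\<in>UNIV. raised b a d * lin_chr b a d)
    = (1/2) * contr G (\<lambda>(a, a1, b, b1, c, c1). H c a1 b1 * low_chr c1 a b)"
proof -
  have "(\<Sum>a\<in>UNIV. \<Sum>d\<in>UNIV. \<Sum>b\<in>UNIV. raised b a d * lin_chr b a d)
   
        = (1/2) * (\<Sum>a\<in>UNIV. \<Sum>d\<in>UNIV. \<Sum>b\<in>UNIV. \<Sum>i\<in>UNIV. \<Sum>j\<in>UNIV. \<Sum>m\<in>UNIV. G a i * G d j * G b m * (H b i j * low_chr m a d))"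
    unfolding raised_def traced_def lin_chr_def
    unfolding mult.assoc[of _ "sum _ _"]
    unfolding double_sum_times
    unfolding sum_distrib_left
    by (intro sum.cong refl) simp
  also have "(\<Sum>a\<in>UNIV. \<Sum>d\<in>UNIV. \<Sum>b\<in>UNIV. \<Sum>i\<in>UNIV. \<Sum>j\<in>UNIV. \<Sum>m\<in>UNIV. G a i * G d j * G b m * (H b i j * low_chr m a d))
      = contr G (\<lambda>(a, a1, b, b1, c, c1). H c a1 b1 * low_chr c1 a b)"
    unfolding contr_nested by (rule sum6_reorder(1))
  finally show ?thesis .
qed

lemma quad_term2: "(\<Sum>a\<in>UNIV. \<Sum>d\<in>UNIV. \<Sum>b\<in>UNIV. G a d * traced b * lin_chr b a d)
    = (1/2) * contr G (\<lambda>(a, a1, b, b1, c, c1). H c b b1 * low_chr c1 a a1)"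
proof -
  have "(\<Sum>a\<in>UNIV. \<Sum>d\<in>UNIV. \<Sum>b\<in>UNIV. G a d * traced b * lin_chr b a d)
   
        = (1/2) * (\<Sum>a\<in>UNIV. \<Sum>d\<in>UNIV. \<Sum>b\<in>UNIV. \<Sum>i\<in>UNIV. \<Sum>j\<in>UNIV. \<Sum>m\<in>UNIV. G a d * G i j * G b m * (H b i j * low_chr m a d))"
    unfolding raised_def traced_def lin_chr_def
    unfolding mult.assoc[of _ "sum _ _"]
    unfolding double_sum_times
    unfolding sum_distrib_left
    by (intro sum.cong refl) simp
  also have "(\<Sum>a\<in>UNIV. \<Sum>d\<in>UNIV. \<Sum>b\<in>UNIV. \<Sum>i\<in>UNIV. \<Sum>j\<in>UNIV. \<Sum>m\<in>UNIV. G a d * G i j * G b m * (H b i j * low_chr m a d))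
      = contr G (\<lambda>(a, a1, b, b1, c, c1). H c b b1 * low_chr c1 a a1)"
    unfolding contr_nested by (rule sum6_reorder(2))
  finally show ?thesis .
qed

lemma quad_term3: "(\<Sum>a\<in>UNIV. \<Sum>d\<in>UNIV. \<Sum>b\<in>UNIV. raised a a d * lin_chr b b d)
    = (1/2) * contr G (\<lambda>(a, a1, b, b1, c, c1). H a a1 b1 * low_chr c1 c b)"
proof -
  have "(\<Sum>a\<in>UNIV. \<Sum>d\<in>UNIV. \<Sum>b\<in>UNIV. raised a a d * lin_chr b b d)
   
        = (1/2) * (\<Sum>a\<in>UNIV. \<Sum>d\<in>UNIV. \<Sum>b\<in>UNIV. \<Sum>i\<in>UNIV. \<Sum>j\<in>UNIV. \<Sum>m\<in>UNIV. G a i * G d j * G b m * (H a i j * low_chr m b d))"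
    unfolding raised_def traced_def lin_chr_def
    unfolding mult.assoc[of _ "sum _ _"]
    unfolding double_sum_times
    unfolding sum_distrib_left
    by (intro sum.cong refl) simp
  also have "(\<Sum>a\<in>UNIV. \<Sum>d\<in>UNIV. \<Sum>b\<in>UNIV. \<Sum>i\<in>UNIV. \<Sum>j\<in>UNIV. \<Sum>m\<in>UNIV. G a i * G d j * G b m * (H a i j * low_chr m b d))
      = contr G (\<lambda>(a, a1, b, b1, c, c1). H a a1 b1 * low_chr c1 c b)"
    unfolding contr_nested by (rule sum6_reorder(1))
  finally show ?thesis .
qed

lemma quad_term4: "(\<Sum>a\<in>UNIV. \<Sum>d\<in>UNIV. \<Sum>b\<in>UNIV. G a d * traced a * lin_chr b b d)
    = (1/2) * contr G (\<lambda>(a, a1, b, b1, c, c1). H a b b1 * low_chr c1 c a1)"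
proof -
  have "(\<Sum>a\<in>UNIV. \<Sum>d\<in>UNIV. \<Sum>b\<in>UNIV. G a d * traced a * lin_chr b b d)
   
        = (1/2) * (\<Sum>a\<in>UNIV. \<Sum>d\<in>UNIV. \<Sum>b\<in>UNIV. \<Sum>i\<in>UNIV. \<Sum>j\<in>UNIV. \<Sum>m\<in>UNIV. G a d * G i j * G b m * (H a i j * low_chr m b d))"
    unfolding raised_def traced_def lin_chr_def
    unfolding mult.assoc[of _ "sum _ _"]
    unfolding double_sum_times
    unfolding sum_distrib_left
    by (intro sum.cong refl) simp
  also have "(\<Sum>a\<in>UNIV. \<Sum>d\<in>UNIV. \<Sum>b\<in>UNIV. \<Sum>i\<in>UNIV. \<Sum>j\<in>UNIV. \<Sum>m\<in>UNIV. G a d * G i j * G b m * (H a i j * low_chr m b d))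
      = contr G (\<lambda>(a, a1, b, b1, c, c1). H a b b1 * low_chr c1 c a1)"
    unfolding contr_nested by (rule sum6_reorder(2))
  finally show ?thesis .
qed

lemma quad_term5: "(\<Sum>a\<in>UNIV. \<Sum>d\<in>UNIV. \<Sum>b\<in>UNIV. \<Sum>f\<in>UNIV. G a d * (lin_chr f a d * lin_chr b f b))
    = (1/4) * contr G (\<lambda>(a, a1, b, b1, c, c1). low_chr b1 a a1 * low_chr c1 b c)"
proof -
  have "(\<Sum>a\<in>UNIV. \<Sum>d\<in>UNIV. \<Sum>b\<in>UNIV. \<Sum>f\<in>UNIV. G a d * (lin_chr f a d * lin_chr b f b))
   
        = (1/4) * (\<Sum>a\<in>UNIV. \<Sum>d\<in>UNIV. \<Sum>b\<in>UNIV. \<Sum>f\<in>UNIV. \<Sum>m\<in>UNIV. \<Sum>n\<in>UNIV. G a d * G f m * G b n * (low_chr m a d * low_chr n f b))"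
    by (simp add: lin_chr_def sum_distrib_left sum_distrib_right mult_ac)
  also have "(\<Sum>a\<in>UNIV. \<Sum>d\<in>UNIV. \<Sum>b\<in>UNIV. \<Sum>f\<in>UNIV. \<Sum>m\<in>UNIV. \<Sum>n\<in>UNIV. G a d * G f m * G b n * (low_chr m a d * low_chr n f b))
      = contr G (\<lambda>(a, a1, b, b1, c, c1). low_chr b1 a a1 * low_chr c1 b c)"
    unfolding contr_nested by (rule sum6_reorder(3))
  finally show ?thesis .
qed

lemma quad_term6: "(\<Sum>a\<in>UNIV. \<Sum>d\<in>UNIV. \<Sum>b\<in>UNIV. \<Sum>f\<in>UNIV. G a d * (lin_chr f b d * lin_chr b f a))
    = (1/4) * contr G (\<lambda>(a, a1, b, b1, c, c1). low_chr b1 c a1 * low_chr c1 b a)"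
proof -
  have "(\<Sum>a\<in>UNIV. \<Sum>d\<in>UNIV. \<Sum>b\<in>UNIV. \<Sum>f\<in>UNIV. G a d * (lin_chr f b d * lin_chr b f a))
   
        = (1/4) * (\<Sum>a\<in>UNIV. \<Sum>d\<in>UNIV. \<Sum>b\<in>UNIV. \<Sum>f\<in>UNIV. \<Sum>m\<in>UNIV. \<Sum>n\<in>UNIV. G a d * G f m * G b n * (low_chr m b d * low_chr n f a))"
    by (simp add: lin_chr_def sum_distrib_left sum_distrib_right mult_ac)
  also have "(\<Sum>a\<in>UNIV. \<Sum>d\<in>UNIV. \<Sum>b\<in>UNIV. \<Sum>f\<in>UNIV. \<Sum>m\<in>UNIV. \<Sum>n\<in>UNIV. G a d * G f m * G b n * (low_chr m b d * low_chr n f a))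
      = contr G (\<lambda>(a, a1, b, b1, c, c1). low_chr b1 c a1 * low_chr c1 b a)"
    unfolding contr_nested by (rule sum6_reorder(3))
  finally show ?thesis .
qed

text \<open>The first two products come from derivatives of Christoffel symbols after integration by
  parts, the inner sum from their products. Term 1 with weight 1/2 cancels term 6, which removes
  \<open>quad_inv3\<close> and \<open>quad_inv4\<close>; what remains is \<open>quad_inv0\<close>
  with -1/4 - 1/4 + 1/2 and \<open>quad_inv2\<close> with 1/8 + 1/8 - 1/4.\<close>

lemma quadratic_cancellation:
  "(\<Sum>a\<in>UNIV. \<Sum>d\<in>UNIV. \<Sum>b\<in>UNIV. lin_weight a a d * lin_chr b b d - lin_weight b a d * lin_chr b a d
      + (\<Sum>f\<in>UNIV. G a d * (lin_chr f a d * lin_chr b f b) - G a d * (lin_chr f b d * lin_chr b f a))) = 0"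
proof -
  have "(\<Sum>a\<in>UNIV. \<Sum>d\<in>UNIV. \<Sum>b\<in>UNIV. lin_weight a a d * lin_chr b b d - lin_weight b a d * lin_chr b a d
      + (\<Sum>f\<in>UNIV. G a d * (lin_chr f a d * lin_chr b f b) - G a d * (lin_chr f b d * lin_chr b f a)))
    = (-1/2) * (\<Sum>a\<in>UNIV. \<Sum>d\<in>UNIV. \<Sum>b\<in>UNIV. raised a a d * lin_chr b b d) + (1/4) * (\<Sum>a\<in>UNIV. \<Sum>d\<in>UNIV. \<Sum>b\<in>UNIV. G a d * traced a * lin_chr b b d)
      + (1/2) * (\<Sum>a\<in>UNIV. \<Sum>d\<in>UNIV. \<Sum>b\<in>UNIV. raised b a d * lin_chr b a d) - (1/4) * (\<Sum>a\<in>UNIV. \<Sum>d\<in>UNIV. \<Sum>b\<in>UNIV. G a d * traced b * lin_chr b a d)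
      + (\<Sum>a\<in>UNIV. \<Sum>d\<in>UNIV. \<Sum>b\<in>UNIV. \<Sum>f\<in>UNIV. G a d * (lin_chr f a d * lin_chr b f b)) - (\<Sum>a\<in>UNIV. \<Sum>d\<in>UNIV. \<Sum>b\<in>UNIV. \<Sum>f\<in>UNIV. G a d * (lin_chr f b d * lin_chr b f a))"
    unfolding sum_distrib_left sum.distrib[symmetric] sum_subtractf[symmetric]
    by (intro sum.cong refl) (simp add: lin_weight_def sum_subtractf algebra_simps)
  also have "\<dots> = 0"
    unfolding quad_term1 quad_term2 quad_term3 quad_term4 quad_term5 quad_term6
      contr_term1 contr_term2 contr_term3 contr_term4 contr_term5 contr_term6 by (simp add: field_simps)
  finally show ?thesis .
qed

end

subsection \<open>The Ricci tensor of the perturbed metrics\<close>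

text \<open>\<open>gam\<close> is the part of \<open>dchr\<close>, and \<open>sig\<close> the part of the derivative of the first-order term of
  \<open>S\<close>, that does not tend to zero uniformly.\<close>

locale metric_family = weak_setting +
  fixes g gi :: "real \<Rightarrow> 4 \<Rightarrow> 4 \<Rightarrow> real^4 \<Rightarrow> real"
  assumes smooth_g: "l \<ge> 0 \<Longrightarrow> smooth_on U (g l i j)"
    and smooth_gi: "l \<ge> 0 \<Longrightarrow> smooth_on U (gi l i j)"
    and g_sym: "l \<ge> 0 \<Longrightarrow> x \<in> U \<Longrightarrow> g l i j x = g l j i x"
    and gi_sym: "l \<ge> 0 \<Longrightarrow> x \<in> U \<Longrightarrow> gi l i j x = gi l j i x"
    and gi_g: "l \<ge> 0 \<Longrightarrow> x \<in> U \<Longrightarrow> (\<Sum>k\<in>UNIV. gi l i k x * g l k j x) = (if i = j then 1 else 0)"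
    and h_null: "unif_null (\<lambda>l x. g l i j x - g 0 i j x)"
    and dh_bounded: "unif_bounded (\<lambda>l. partial k (\<lambda>x. g l i j x - g 0 i j x))"
begin

definition "h l i j x = g l i j x - g 0 i j x"
definition "dh l k i j x = partial k (h l i j) x"
definition "chr l i j k x = (1/2) * (\<Sum>m\<in>UNIV. gi l i m x *
  (partial j (g l m k) x + partial k (g l m j) x - partial m (g l j k) x))"
definition "ric l a d x = (\<Sum>b\<in>UNIV. partial b (chr l b a d) x - partial a (chr l b b d) x
  + (\<Sum>f\<in>UNIV. chr l f a d x * chr l b f b x - chr l f b d x * chr l b f a x))"
definition "gam l i j k x = (1/2) * (\<Sum>m\<in>UNIV. gi 0 i m x * (dh l j m k x + dh l k m j x - dh l m j k x))"
definition "dchr l i j k x = chr l i j k x - chr 0 i j k x"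
text \<open>Separated from \<open>h\<close> because it depends on the background alone: in
  \<open>S\<close> and \<open>sig\<close> it is then a fixed smooth coefficient, and all dependence
  on \<open>l\<close> sits in \<open>h\<close> and \<open>dh\<close>.\<close>

definition "wgt a b i j x = (-1/2) * (gi 0 a i x * gi 0 b j x - (1/2) * gi 0 a b x * gi 0 i j x)"
definition "S l a b x = gi 0 a b x + (\<Sum>i\<in>UNIV. \<Sum>j\<in>UNIV. wgt a b i j x * h l i j x)"
definition "sig l c a b x = (\<Sum>i\<in>UNIV. \<Sum>j\<in>UNIV. wgt a b i j x * dh l c i j x)"

lemma smooth_chr: "l \<ge> 0 \<Longrightarrow> smooth_on U (chr l i j k)"
  unfolding chr_def[abs_def]
  by (intro smooth_on_mult smooth_on_sum smooth_on_diff smooth_on_add smooth_on_const smooth_on_partial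
      smooth_g smooth_gi open_U)

lemma smooth_ric: "l \<ge> 0 \<Longrightarrow> smooth_on U (ric l a d)"
  unfolding ric_def[abs_def]
  by (intro smooth_on_mult smooth_on_sum smooth_on_diff smooth_on_add smooth_on_partial smooth_chr open_U)

lemma smooth_wgt: "smooth_on U (wgt a b i j)"
  unfolding wgt_def[abs_def]
  by (intro smooth_on_mult smooth_on_diff smooth_on_const smooth_gi open_U order_refl)

lemma smooth_h: "l \<ge> 0 \<Longrightarrow> smooth_on U (h l i j)"
  unfolding h_def[abs_def] by (intro smooth_on_diff smooth_g open_U order_refl)

lemma smooth_S: "l \<ge> 0 \<Longrightarrow> smooth_on U (S l a b)"
  unfolding S_def[abs_def]
  by (intro smooth_on_add smooth_on_mult smooth_on_sum smooth_wgt smooth_gi smooth_h open_U order_refl)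

lemma smooth_dchr: "l \<ge> 0 \<Longrightarrow> smooth_on U (dchr l i j k)"
  unfolding dchr_def[abs_def] by (intro smooth_on_diff smooth_chr open_U order_refl)

lemma families:
  "family (\<lambda>l. g l i j)" "family (\<lambda>l. gi l i j)" "family (\<lambda>l. h l i j)" "family (\<lambda>l. chr l i j k)"
  "family (\<lambda>l. ric l i j)" "family (\<lambda>l. S l i j)" "family (\<lambda>l. dchr l i j k)"
  by (simp_all add: family_def smooth_g smooth_gi smooth_h smooth_chr smooth_ric smooth_S smooth_dchr)

lemma h_null': "unif_null (\<lambda>l. h l i j)"
  using h_null[of i j] by (simp add: h_def[abs_def])

lemma dh_bounded': "unif_bounded (\<lambda>l. dh l k i j)"
  using dh_bounded[of k i j] by (simp add: dh_def[abs_def] h_def[abs_def])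

text \<open>The derivative of a uniformly null family is weakly null. No smallness of
  \<open>dh\<close> stronger than this is available.\<close>

lemma dh_weak_null: "weak_null (\<lambda>l. dh l k i j)"
  using weak_null_partial[OF unif_null_weak_null[OF h_null'[of i j]], of k] by (simp add: dh_def[abs_def])

lemma partial_g_eq: "l \<ge> 0 \<Longrightarrow> x \<in> U \<Longrightarrow> partial k (g l i j) x = dh l k i j x + partial k (g 0 i j) x"
  unfolding dh_def h_def[abs_def]
  by (subst partial_diff) (auto intro: smooth_on_imp_differentiable smooth_g)

lemma g_gi: "l \<ge> 0 \<Longrightarrow> x \<in> U \<Longrightarrow> (\<Sum>k\<in>UNIV. g l i k x * gi l k j x) = (if i = j then 1 else 0)"
  using gi_g[of l x j i] by (simp add: g_sym[of l x i] gi_sym[of l x _ j] mult.commute)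

text \<open>The resolvent identity for the inverses of \<open>g l\<close> and \<open>g 0\<close>:
  insert \<open>h = g l - g 0\<close> between the two inverses and contract each metric with its own
  inverse.\<close>

lemma gi_diff:
  assumes l: "l \<ge> 0" and x: "x \<in> U"
  shows "gi l i j x - gi 0 i j x = - (\<Sum>m\<in>UNIV. \<Sum>n\<in>UNIV. gi l i m x * h l m n x * gi 0 n j x)"
proof -
  have "(\<Sum>m\<in>UNIV. \<Sum>n\<in>UNIV. gi l i m x * g l m n x * gi 0 n j x)
      = (\<Sum>n\<in>UNIV. (\<Sum>m\<in>UNIV. gi l i m x * g l m n x) * gi 0 n j x)"
    by (subst sum.swap) (simp add: sum_distrib_right)
  also have "\<dots> = gi 0 i j x"
    by (simp add: gi_g[OF l x] if_distrib[of "\<lambda>t. t * _"] cong: if_cong)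
  finally have 1: "(\<Sum>m\<in>UNIV. \<Sum>n\<in>UNIV. gi l i m x * g l m n x * gi 0 n j x) = gi 0 i j x" .
  have "(\<Sum>m\<in>UNIV. \<Sum>n\<in>UNIV. gi l i m x * g 0 m n x * gi 0 n j x)
      = (\<Sum>m\<in>UNIV. gi l i m x * (\<Sum>n\<in>UNIV. g 0 m n x * gi 0 n j x))"
    by (simp add: sum_distrib_left mult.assoc)
  also have "\<dots> = gi l i j x"
    by (simp add: g_gi[OF order_refl x] if_distrib[of "\<lambda>t. _ * t"] cong: if_cong)
  finally have 2: "(\<Sum>m\<in>UNIV. \<Sum>n\<in>UNIV. gi l i m x * g 0 m n x * gi 0 n j x) = gi l i j x" .
  have "(\<Sum>m\<in>UNIV. \<Sum>n\<in>UNIV. gi l i m x * h l m n x * gi 0 n j x)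
      = (\<Sum>m\<in>UNIV. \<Sum>n\<in>UNIV. gi l i m x * g l m n x * gi 0 n j x)
        - (\<Sum>m\<in>UNIV. \<Sum>n\<in>UNIV. gi l i m x * g 0 m n x * gi 0 n j x)"
    by (simp add: h_def sum_subtractf algebra_simps)
  then show ?thesis using 1 2 by simp
qed

text \<open>The sum of the entries of the inverse is absorbed: with the perturbation small it bounds
  itself by the background value plus half of itself.\<close>

lemma gi_bounded: "unif_bounded (\<lambda>l. gi l i j)"
proof -
  define N where "N l x = (\<Sum>i\<in>UNIV. \<Sum>m\<in>UNIV. \<bar>gi l i m x\<bar>)" for l x
  have Nge: "\<bar>gi l i j x\<bar> \<le> N l x" for l i j x
    unfolding N_def
    by (rule order_trans[OF member_le_sum[of j UNIV "\<lambda>m. \<bar>gi l i m x\<bar>"]])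
      (auto intro!: member_le_sum[of i UNIV "\<lambda>i. \<Sum>m\<in>UNIV. \<bar>gi l i m x\<bar>"] sum_nonneg)
  have N0: "N l x \<ge> 0" for l x unfolding N_def by (intro sum_nonneg) auto
  have "continuous_on K (N 0)" unfolding N_def[abs_def]
    by (intro continuous_on_sum continuous_on_rabs continuous_on_subset[OF smooth_on_imp_continuous_on[OF smooth_gi] K_subset] order_refl)
  then have "bounded (N 0 ` K)" by (intro compact_imp_bounded compact_continuous_image compact_K)
  then obtain C where C: "\<And>x. x \<in> K \<Longrightarrow> N 0 x \<le> C" "C > 0"
    unfolding bounded_pos by (auto intro: order_trans[OF abs_ge_self])
  \<comment> \<open>With entries of \<open>h\<close> below this value the error term is at most
    \<open>\<epsilon> * (N l x * C) = N l x / 2\<close>.\<close>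
  define \<epsilon> where "\<epsilon> = 1 / (2 * C)"
  have e: "\<epsilon> > 0" using C by (simp add: \<epsilon>_def)
  have "\<forall>\<^sub>F l in at_right 0. \<forall>(m, n)\<in>UNIV. \<forall>x\<in>K. \<bar>h l m n x\<bar> \<le> \<epsilon>"
    by (rule eventually_ball_finite) (use h_null' e in \<open>auto simp: unif_null_def\<close>)
  then have "\<forall>\<^sub>F l in at_right 0. \<forall>x\<in>K. \<bar>gi l i j x\<bar> \<le> 2 * C"
    using pos_at_right
  proof eventually_elim
    case (elim l)
    show ?case
    proof
      fix x assume x: "x \<in> K"
      then have xU: "x \<in> U" using K_subset by blast
      have b: "\<bar>gi l i j x\<bar> \<le> \<bar>gi 0 i j x\<bar> + (\<Sum>m\<in>UNIV. \<Sum>n\<in>UNIV. \<bar>gi l i m x\<bar> * (\<epsilon> * \<bar>gi 0 n j x\<bar>))" for i j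
      proof -
        have "\<bar>\<Sum>m\<in>UNIV. \<Sum>n\<in>UNIV. gi l i m x * h l m n x * gi 0 n j x\<bar>
            \<le> (\<Sum>m\<in>UNIV. \<Sum>n\<in>UNIV. \<bar>gi l i m x * h l m n x * gi 0 n j x\<bar>)"
          by (intro order_trans[OF sum_abs] sum_mono sum_abs)
        also have "\<dots> \<le> (\<Sum>m\<in>UNIV. \<Sum>n\<in>UNIV. \<bar>gi l i m x\<bar> * (\<epsilon> * \<bar>gi 0 n j x\<bar>))"
        proof (intro sum_mono)
          fix m n
          have "\<bar>h l m n x\<bar> \<le> \<epsilon>" using elim(1) x by auto
          then have "\<bar>gi l i m x\<bar> * (\<bar>h l m n x\<bar> * \<bar>gi 0 n j x\<bar>) \<le> \<bar>gi l i m x\<bar> * (\<epsilon> * \<bar>gi 0 n j x\<bar>)"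
            by (intro mult_left_mono mult_right_mono) auto
          then show "\<bar>gi l i m x * h l m n x * gi 0 n j x\<bar> \<le> \<bar>gi l i m x\<bar> * (\<epsilon> * \<bar>gi 0 n j x\<bar>)"
            by (simp only: abs_mult mult.assoc)
        qed
        finally show ?thesis using gi_diff[of l x i j] elim(2) xU by linarith
      qed
      have "N l x \<le> N 0 x + (\<Sum>i\<in>UNIV. \<Sum>j\<in>UNIV. \<Sum>m\<in>UNIV. \<Sum>n\<in>UNIV. \<bar>gi l i m x\<bar> * (\<epsilon> * \<bar>gi 0 n j x\<bar>))"
        unfolding N_def sum.distrib[symmetric] by (intro sum_mono b)
      also have "(\<Sum>i\<in>UNIV. \<Sum>j\<in>UNIV. \<Sum>m\<in>UNIV. \<Sum>n\<in>UNIV. \<bar>gi l i m x\<bar> * (\<epsilon> * \<bar>gi 0 n j x\<bar>)) = \<epsilon> * (N l x * N 0 x)"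
      proof -
        have "(\<Sum>i\<in>UNIV. \<Sum>j\<in>UNIV. \<Sum>m\<in>UNIV. \<Sum>n\<in>UNIV. \<bar>gi l i m x\<bar> * (\<epsilon> * \<bar>gi 0 n j x\<bar>))
           
                = (\<Sum>i\<in>UNIV. \<Sum>j\<in>UNIV. (\<Sum>m\<in>UNIV. \<bar>gi l i m x\<bar>) * (\<epsilon> * (\<Sum>n\<in>UNIV. \<bar>gi 0 n j x\<bar>)))"
          by (simp only: sum_distrib_left[symmetric] sum_distrib_right[symmetric])
        also have "\<dots> = N l x * (\<epsilon> * (\<Sum>j\<in>UNIV. \<Sum>n\<in>UNIV. \<bar>gi 0 n j x\<bar>))"
          by (simp only: N_def sum_distrib_left[symmetric] sum_distrib_right[symmetric])
        also have "(\<Sum>j\<in>UNIV. \<Sum>n\<in>UNIV. \<bar>gi 0 n j x\<bar>) = N 0 x" unfolding N_def by (rule sum.swap)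
        finally show ?thesis by simp
      qed
      also have "\<epsilon> * (N l x * N 0 x) \<le> \<epsilon> * (N l x * C)"
        using e C(1)[OF x] N0 by (intro mult_left_mono) auto
      also have "\<epsilon> * (N l x * C) = N l x / 2" using C(2) by (simp add: \<epsilon>_def)
      finally have "N l x \<le> 2 * C" using C(1)[OF x] by linarith
      then show "\<bar>gi l i j x\<bar> \<le> 2 * C" using Nge[of l i j x] by linarith
    qed
  qed
  then show ?thesis unfolding unif_bounded_def using families(2) by blast
qed

lemma gi0_bounded: "unif_bounded (\<lambda>l. gi 0 i j)"
  by (rule unif_bounded_const[OF smooth_gi[OF order_refl]])

lemma gi_null: "unif_null (\<lambda>l x. gi l i j x - gi 0 i j x)"
proof -
  have "unif_null (\<lambda>l x. \<Sum>m\<in>UNIV. \<Sum>n\<in>UNIV. -1 * (gi l i m x * h l m n x * gi 0 n j x))"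
    by (intro unif_null_sum unif_null_cmult unif_null_mult unif_null_mult' h_null' gi_bounded gi0_bounded finite)
  then show ?thesis by (rule unif_null_cong) (simp add: gi_diff sum_negf)
qed

lemma partial_g_bounded: "unif_bounded (\<lambda>l. partial k (g l i j))"
proof -
  have "unif_bounded (\<lambda>l x. dh l k i j x + partial k (g 0 i j) x)"
    by (intro unif_bounded_add dh_bounded' unif_bounded_const smooth_on_partial smooth_g order_refl)
  then show ?thesis by (rule unif_bounded_cong) (rule partial_g_eq[symmetric], auto)
qed

text \<open>Replacing the perturbed inverse metric by the background one in \<open>chr l\<close>
  costs a null factor times bounded derivatives. After that the metric derivatives subtract to
  derivatives of \<open>h\<close>.\<close>

lemma dchr_gam: "unif_null (\<lambda>l x. dchr l i j k x - gam l i j k x)"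
proof -
  have "unif_null (\<lambda>l x. (1/2) * (\<Sum>m\<in>UNIV. (gi l i m x - gi 0 i m x) *
      (partial j (g l m k) x + partial k (g l m j) x - partial m (g l j k) x)))"
    by (intro unif_null_cmult unif_null_sum unif_null_mult gi_null unif_bounded_diff unif_bounded_add partial_g_bounded finite)
  then show ?thesis
  proof (rule unif_null_cong)
    fix l :: real and x assume "l > 0" "x \<in> U"
    then have p: "partial a (g 0 b c) x = partial a (g l b c) x - dh l a b c x" for a b c
      using partial_g_eq[of l x a b c] by simp
    show "(1/2) * (\<Sum>m\<in>UNIV. (gi l i m x - gi 0 i m x) *
      (partial j (g l m k) x + partial k (g l m j) x - partial m (g l j k) x)) = dchr l i j k x - gam l i j k x"
      unfolding dchr_def chr_def gam_def p right_diff_distrib[symmetric] sum_subtractf[symmetric]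
      by (intro arg_cong[where f = "\<lambda>t. (1/2) * t"] sum.cong refl) (simp add: algebra_simps)
  qed
qed

lemma gam_bounded: "unif_bounded (\<lambda>l. gam l i j k)"
  unfolding gam_def[abs_def]
  by (intro unif_bounded_cmult unif_bounded_sum unif_bounded_mult unif_bounded_diff unif_bounded_add gi0_bounded dh_bounded' finite)

lemma gam_weak_null: "weak_null (\<lambda>l. gam l i j k)"
  unfolding gam_def[abs_def]
  by (intro weak_null_cmult weak_null_sum weak_null_smooth_mult weak_null_diff weak_null_add smooth_gi dh_weak_null finite order_refl)

text \<open>Together with \<open>dchr_bounded\<close> this is all that is known about
  \<open>dchr\<close>. A product of two such families need not be weakly null, which is where the
  quadratic terms come from.\<close>

lemma dchr_weak_null: "weak_null (\<lambda>l. dchr l i j k)"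
  using weak_null_add[OF unif_null_weak_null[OF dchr_gam[of i j k]] gam_weak_null[of i j k]] by simp

lemma dchr_bounded: "unif_bounded (\<lambda>l. dchr l i j k)"
  using unif_bounded_add[OF unif_null_bounded[OF dchr_gam[of i j k]] gam_bounded[of i j k]] by simp

lemma S_null: "unif_null (\<lambda>l x. S l a b x - gi 0 a b x)"
  unfolding S_def add_diff_cancel_left'
  by (intro unif_null_sum unif_null_mult' unif_bounded_const smooth_wgt h_null' finite)

lemma sig_bounded: "unif_bounded (\<lambda>l. sig l c a b)"
  unfolding sig_def[abs_def]
  by (intro unif_bounded_sum unif_bounded_mult unif_bounded_const smooth_wgt dh_bounded' finite)

lemma S_bounded: "unif_bounded (\<lambda>l. S l a b)"
  using unif_bounded_add[OF unif_null_bounded[OF S_null[of a b]] gi0_bounded[of a b]] by simp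

text \<open>By the product rule only the derivative that hits \<open>h\<close> survives; the one
  that hits \<open>wgt\<close> is multiplied by \<open>h\<close> and tends to zero
  uniformly.\<close>

lemma partial_S: "unif_null (\<lambda>l x. partial c (S l a b) x - (partial c (gi 0 a b) x + sig l c a b x))"
proof -
  have "unif_null (\<lambda>l x. \<Sum>i\<in>UNIV. \<Sum>j\<in>UNIV. partial c (wgt a b i j) x * h l i j x)"
    by (intro unif_null_sum unif_null_mult' unif_bounded_const smooth_on_partial smooth_wgt h_null' finite)
  then show ?thesis
  proof (rule unif_null_cong)
    fix l :: real and x assume l: "l > 0" and x: "x \<in> U"
    have d: "wgt a b i j differentiable (at x)" "h l i j differentiable (at x)" "gi 0 a b differentiable (at x)" for i j
      by (rule smooth_on_imp_differentiable[OF smooth_wgt x] smooth_on_imp_differentiable[OF smooth_h x]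
          smooth_on_imp_differentiable[OF smooth_gi x] less_imp_le[OF l] order_refl)+
    have "partial c (S l a b) x = partial c (gi 0 a b) x
        + (\<Sum>i\<in>UNIV. \<Sum>j\<in>UNIV. wgt a b i j x * dh l c i j x + partial c (wgt a b i j) x * h l i j x)"
      unfolding S_def[abs_def] dh_def
      by (subst partial_add partial_sum partial_mult; (intro differentiable_sum differentiable_mult d finite ballI)?)+ (rule refl)
    then show "(\<Sum>i\<in>UNIV. \<Sum>j\<in>UNIV. partial c (wgt a b i j) x * h l i j x)
        = partial c (S l a b) x - (partial c (gi 0 a b) x + sig l c a b x)"
      by (simp add: sig_def sum.distrib)
  qed
qed

section \<open>Weak equivalence and the weak limit of the contracted Ricci difference\<close>

definition weq :: "(real \<Rightarrow> real^4 \<Rightarrow> real) \<Rightarrow> (real \<Rightarrow> real^4 \<Rightarrow> real) \<Rightarrow> bool" where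
  "weq f f' \<longleftrightarrow> weak_null (\<lambda>l x. f l x - f' l x)"

lemma weq_add: "weq f f' \<Longrightarrow> weq k k' \<Longrightarrow> weq (\<lambda>l x. f l x + k l x) (\<lambda>l x. f' l x + k' l x)"
  unfolding weq_def using weak_null_add[of "\<lambda>l x. f l x - f' l x" "\<lambda>l x. k l x - k' l x"]
  by (simp add: algebra_simps)

lemma weq_diff: "weq f f' \<Longrightarrow> weq k k' \<Longrightarrow> weq (\<lambda>l x. f l x - k l x) (\<lambda>l x. f' l x - k' l x)"
  unfolding weq_def using weak_null_diff[of "\<lambda>l x. f l x - f' l x" "\<lambda>l x. k l x - k' l x"]
  by (simp add: algebra_simps)

lemma weq_sum:
  assumes "finite I" "\<And>i. i \<in> I \<Longrightarrow> weq (f i) (f' i)"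
  shows "weq (\<lambda>l x. \<Sum>i\<in>I. f i l x) (\<lambda>l x. \<Sum>i\<in>I. f' i l x)"
  using weak_null_sum[OF assms[unfolded weq_def]] by (simp add: weq_def sum_subtractf)

lemma weq_mult_null:
  assumes "unif_null (\<lambda>l x. f l x - f' l x)" "unif_null (\<lambda>l x. k l x - k' l x)"
    "unif_bounded f'" "unif_bounded k"
  shows "weq (\<lambda>l x. f l x * k l x) (\<lambda>l x. f' l x * k' l x)"
proof -
  have "unif_null (\<lambda>l x. (f l x - f' l x) * k l x + f' l x * (k l x - k' l x))"
    by (intro unif_null_add unif_null_mult unif_null_mult' assms)
  then show ?thesis unfolding weq_def by (intro unif_null_weak_null) (simp add: algebra_simps)
qed

text \<open>\<open>S\<close> depends on \<open>l\<close> and cannot be absorbed into a test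
  function. Its deviation from \<open>gi 0\<close> is uniformly null and meets a bounded factor; the
  remaining coefficient is fixed and smooth.\<close>

lemma S_dchr_weak_null: "weak_null (\<lambda>l x. S l a b x * dchr l i j k x)"
proof -
  have "weak_null (\<lambda>l x. (S l a b x - gi 0 a b x) * dchr l i j k x + gi 0 a b x * dchr l i j k x)"
    by (intro weak_null_add unif_null_weak_null unif_null_mult S_null dchr_bounded weak_null_smooth_mult
        smooth_gi dchr_weak_null order_refl)
  then show ?thesis by (simp add: algebra_simps)
qed

text \<open>Since the derivative of the weakly null product \<open>S * dchr\<close> is weakly null,
  the left side equals minus the derivative of \<open>S\<close> times \<open>dchr\<close>. Of that
  derivative only \<open>sig\<close> matters: its background part is a smooth coefficient of a
  weakly null family, the rest is uniformly null.\<close>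

lemma S_partial_dchr:
  "weq (\<lambda>l x. S l a d x * partial c (dchr l i j k) x) (\<lambda>l x. - (sig l c a d x * gam l i j k x))"
proof -
  have 1: "weak_null (\<lambda>l. partial c (\<lambda>x. S l a d x * dchr l i j k x))"
    by (rule weak_null_partial[OF S_dchr_weak_null])
  have 2: "weak_null (\<lambda>l x. (partial c (S l a d) x - (partial c (gi 0 a d) x + sig l c a d x)) * dchr l i j k x
      + partial c (gi 0 a d) x * dchr l i j k x + sig l c a d x * (dchr l i j k x - gam l i j k x))"
    by (intro weak_null_add unif_null_weak_null[OF unif_null_mult[OF partial_S dchr_bounded]]
        unif_null_weak_null[OF unif_null_mult'[OF sig_bounded dchr_gam]]
        weak_null_smooth_mult smooth_on_partial smooth_gi dchr_weak_null order_refl)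
  have "weak_null (\<lambda>l x. partial c (\<lambda>x. S l a d x * dchr l i j k x) x
      - ((partial c (S l a d) x - (partial c (gi 0 a d) x + sig l c a d x)) * dchr l i j k x
      + partial c (gi 0 a d) x * dchr l i j k x + sig l c a d x * (dchr l i j k x - gam l i j k x)))"
    by (rule weak_null_diff[OF 1 2])
  then show ?thesis unfolding weq_def
  proof (rule weak_null_cong)
    fix l :: real and x assume l: "l > 0" and x: "x \<in> U"
    have "partial c (\<lambda>x. S l a d x * dchr l i j k x) x
        = S l a d x * partial c (dchr l i j k) x + partial c (S l a d) x * dchr l i j k x"
      by (rule partial_mult) (rule smooth_on_imp_differentiable[OF smooth_S x] smooth_on_imp_differentiable[OF smooth_dchr x] less_imp_le[OF l])+
    then show "partial c (\<lambda>x. S l a d x * dchr l i j k x) x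
      - ((partial c (S l a d) x - (partial c (gi 0 a d) x + sig l c a d x)) * dchr l i j k x
      + partial c (gi 0 a d) x * dchr l i j k x + sig l c a d x * (dchr l i j k x - gam l i j k x))
      = S l a d x * partial c (dchr l i j k) x - - (sig l c a d x * gam l i j k x)"
      by (simp add: algebra_simps)
  qed
qed

text \<open>With \<open>chr l = chr 0 + dchr l\<close> the mixed terms are fixed smooth coefficients
  times \<open>S * dchr\<close> and hence weakly null. In the purely quadratic term \<open>S\<close>
  and both \<open>dchr\<close> may be replaced by their leading parts.\<close>

lemma S_chr_chr:
  "weq (\<lambda>l x. S l a d x * (chr l i j k x * chr l i' j' k' x - chr 0 i j k x * chr 0 i' j' k' x))
    (\<lambda>l x. gi 0 a d x * (gam l i j k x * gam l i' j' k' x))"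
proof -
  have c0: "smooth_on U (chr 0 i j k)" for i j k by (rule smooth_chr[OF order_refl])
  have 1: "weak_null (\<lambda>l x. chr 0 i j k x * (S l a d x * dchr l i' j' k' x) + chr 0 i' j' k' x * (S l a d x * dchr l i j k x))"
    by (intro weak_null_add weak_null_smooth_mult S_dchr_weak_null c0)
  have n: "unif_null (\<lambda>l x. dchr l i j k x * dchr l i' j' k' x - gam l i j k x * gam l i' j' k' x)"
  proof -
    have "unif_null (\<lambda>l x. (dchr l i j k x - gam l i j k x) * dchr l i' j' k' x + gam l i j k x * (dchr l i' j' k' x - gam l i' j' k' x))"
      by (intro unif_null_add unif_null_mult unif_null_mult' dchr_gam dchr_bounded gam_bounded)
    then show ?thesis by (simp add: algebra_simps)
  qed
  have 2: "weq (\<lambda>l x. S l a d x * (dchr l i j k x * dchr l i' j' k' x)) (\<lambda>l x. gi 0 a d x * (gam l i j k x * gam l i' j' k' x))"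
    by (rule weq_mult_null[OF S_null n gi0_bounded unif_bounded_mult[OF dchr_bounded dchr_bounded]])
  have "weak_null (\<lambda>l x. chr 0 i j k x * (S l a d x * dchr l i' j' k' x) + chr 0 i' j' k' x * (S l a d x * dchr l i j k x)
      + (S l a d x * (dchr l i j k x * dchr l i' j' k' x) - gi 0 a d x * (gam l i j k x * gam l i' j' k' x)))"
    by (rule weak_null_add[OF 1 2[unfolded weq_def]])
  then show ?thesis unfolding weq_def
    by (rule weak_null_cong) (simp add: dchr_def algebra_simps)
qed

lemma h_sym: "l \<ge> 0 \<Longrightarrow> x \<in> U \<Longrightarrow> h l i j x = h l j i x"
  by (simp add: h_def g_sym[of _ x i j])

lemma dh_sym: "l \<ge> 0 \<Longrightarrow> x \<in> U \<Longrightarrow> dh l c i j x = dh l c j i x"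
  unfolding dh_def by (rule partial_cong[OF open_U]) (auto simp: h_sym[of _ _ i j])

text \<open>The two preceding equivalences replace every term of the contracted Ricci difference by
  a product of first derivatives of \<open>h\<close>; the sum of these products vanishes at each
  point.\<close>

lemma S_ric_diff: "weak_null (\<lambda>l x. \<Sum>a\<in>UNIV. \<Sum>d\<in>UNIV. S l a d x * (ric l a d x - ric 0 a d x))"
proof -
  have "weq (\<lambda>l x. \<Sum>a\<in>UNIV. \<Sum>d\<in>UNIV. \<Sum>b\<in>UNIV.
        S l a d x * partial b (dchr l b a d) x - S l a d x * partial a (dchr l b b d) x
        + (\<Sum>f\<in>UNIV. S l a d x * (chr l f a d x * chr l b f b x - chr 0 f a d x * chr 0 b f b x)
            - S l a d x * (chr l f b d x * chr l b f a x - chr 0 f b d x * chr 0 b f a x)))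
      (\<lambda>l x. \<Sum>a\<in>UNIV. \<Sum>d\<in>UNIV. \<Sum>b\<in>UNIV.
        - (sig l b a d x * gam l b a d x) - - (sig l a a d x * gam l b b d x)
        + (\<Sum>f\<in>UNIV. gi 0 a d x * (gam l f a d x * gam l b f b x)
            - gi 0 a d x * (gam l f b d x * gam l b f a x)))"
    by (intro weq_sum weq_add weq_diff S_partial_dchr S_chr_chr finite)
  then show ?thesis unfolding weq_def
  proof (rule weak_null_cong)
    fix l :: real and x assume l: "l > 0" and x: "x \<in> U"
    have G: "gi 0 i j x = gi 0 j i x" for i j by (rule gi_sym[OF order_refl x])
    have H: "dh l c i j x = dh l c j i x" for c i j by (rule dh_sym[OF less_imp_le[OF l] x])
    \<comment> \<open>The pointwise algebra is applied with the background inverse at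
      \<open>x\<close> as \<open>G\<close> and the derivatives of \<open>h\<close> at
      \<open>x\<close> as \<open>H\<close>.\<close>
    have gam: "gam l i j k x = lin_chr (\<lambda>i j. gi 0 i j x) (\<lambda>c i j. dh l c i j x) i j k" for i j k
      by (simp add: gam_def lin_chr_def[OF G H] low_chr_def[OF G H])
    have sig: "sig l c a b x = lin_weight (\<lambda>i j. gi 0 i j x) (\<lambda>c i j. dh l c i j x) c a b" for c a b
      by (simp add: sig_def wgt_def lin_weight_def[OF G H] raised_def[OF G H] traced_def[OF G H]
          sum_distrib_left sum_subtractf sum_negf algebra_simps)
    have q: "(\<Sum>a\<in>UNIV. \<Sum>d\<in>UNIV. \<Sum>b\<in>UNIV.
        - (sig l b a d x * gam l b a d x) - - (sig l a a d x * gam l b b d x)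
        + (\<Sum>f\<in>UNIV. gi 0 a d x * (gam l f a d x * gam l b f b x)
            - gi 0 a d x * (gam l f b d x * gam l b f a x))) = 0"
      using quadratic_cancellation[OF G H] unfolding gam sig by simp
    have pd: "partial c (dchr l i j k) x = partial c (chr l i j k) x - partial c (chr 0 i j k) x" for c i j k
      unfolding dchr_def[abs_def]
      by (rule partial_diff) (rule smooth_on_imp_differentiable[OF smooth_chr x] less_imp_le[OF l] order_refl)+
    show "(\<Sum>a\<in>UNIV. \<Sum>d\<in>UNIV. \<Sum>b\<in>UNIV.
        S l a d x * partial b (dchr l b a d) x - S l a d x * partial a (dchr l b b d) x
        + (\<Sum>f\<in>UNIV. S l a d x * (chr l f a d x * chr l b f b x - chr 0 f a d x * chr 0 b f b x)
            - S l a d x * (chr l f b d x * chr l b f a x - chr 0 f b d x * chr 0 b f a x)))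
      - (\<Sum>a\<in>UNIV. \<Sum>d\<in>UNIV. \<Sum>b\<in>UNIV.
        - (sig l b a d x * gam l b a d x) - - (sig l a a d x * gam l b b d x)
        + (\<Sum>f\<in>UNIV. gi 0 a d x * (gam l f a d x * gam l b f b x)
            - gi 0 a d x * (gam l f b d x * gam l b f a x)))
      = (\<Sum>a\<in>UNIV. \<Sum>d\<in>UNIV. S l a d x * (ric l a d x - ric 0 a d x))"
      unfolding q pd ric_def diff_0_right sum_subtractf[symmetric] sum_distrib_left
      by (intro sum.cong refl) (simp add: sum_distrib_left sum_subtractf sum.distrib algebra_simps)
  qed
qed

end

subsection \<open>The weak energy condition\<close>

text \<open>The cutoff \<open>\<theta>\<close> is positive on \<open>K\<close>, where the test functions live; its support \<open>K'\<close> has to be larger.\<close>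

locale matter_family = metric_family +
  fixes T :: "real \<Rightarrow> 4 \<Rightarrow> 4 \<Rightarrow> real^4 \<Rightarrow> real" and T0 :: "4 \<Rightarrow> 4 \<Rightarrow> real^4 \<Rightarrow> real"
    and \<Lambda> :: real and \<theta> :: "real^4 \<Rightarrow> real" and K' :: "(real^4) set" and v0 :: "real^4" and \<epsilon> :: real
  assumes smooth_T: "l > 0 \<Longrightarrow> smooth_on U (T l i j)"
    and smooth_T0: "smooth_on U (T0 i j)"
    and einstein_eq: "l > 0 \<Longrightarrow> x \<in> U \<Longrightarrow>
      ric l a b x - (1/2) * (\<Sum>c\<in>UNIV. \<Sum>d\<in>UNIV. gi l c d x * ric l c d x) * g l a b x + \<Lambda> * g l a b x = 8 * pi * T l a b x"
    and wec: "l > 0 \<Longrightarrow> x \<in> U \<Longrightarrow> (\<Sum>i\<in>UNIV. \<Sum>j\<in>UNIV. v $ i * v $ j * g l i j x) < 0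
      \<Longrightarrow> (\<Sum>i\<in>UNIV. \<Sum>j\<in>UNIV. v $ i * v $ j * T l i j x) \<ge> 0"
    and T_lim: "smooth_on UNIV \<psi> \<Longrightarrow> (\<And>x. x \<notin> K' \<Longrightarrow> \<psi> x = 0) \<Longrightarrow>
      ((\<lambda>l. \<integral>x. \<psi> x * T l i j x \<partial>lborel) \<longlongrightarrow> (\<integral>x. \<psi> x * T0 i j x \<partial>lborel)) (at_right 0)"
    and K'_compact: "compact K'" and K_K': "K \<subseteq> K'" and K'_U: "K' \<subseteq> U"
    and \<theta>_smooth: "smooth_on UNIV \<theta>" and \<theta>_zero: "x \<notin> K' \<Longrightarrow> \<theta> x = 0"
    and \<theta>_nonneg: "\<theta> x \<ge> 0" and \<theta>_pos: "x \<in> K \<Longrightarrow> \<theta> x > 0"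
    and eps: "\<epsilon> > 0"
    and timelike: "\<forall>\<^sub>F l in at_right 0. \<forall>x\<in>U. \<forall>w. norm (w - v0) \<le> \<epsilon> \<longrightarrow> (\<Sum>i\<in>UNIV. \<Sum>j\<in>UNIV. w $ i * w $ j * g l i j x) < 0"
begin

lemma T_weak_null: "weak_null (\<lambda>l x. T l i j x - T0 i j x)"
  unfolding weak_null_def
proof (intro conjI allI impI)
  show "family (\<lambda>l x. T l i j x - T0 i j x)"
    using smooth_T smooth_T0 by (simp add: family_def smooth_on_diff open_U)
  fix \<psi> assume \<psi>: "test_fun \<psi>"
  have "((\<lambda>l. \<integral>x. \<psi> x * T l i j x \<partial>lborel) \<longlongrightarrow> (\<integral>x. \<psi> x * T0 i j x \<partial>lborel)) (at_right 0)"
    by (rule T_lim) (use \<psi> K_K' in \<open>auto simp: test_fun_def\<close>)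
  then have *: "((\<lambda>l. (\<integral>x. \<psi> x * T l i j x \<partial>lborel) - (\<integral>x. \<psi> x * T0 i j x \<partial>lborel)) \<longlongrightarrow> 0) (at_right 0)"
    by (simp add: LIM_zero)
  show "((\<lambda>l. \<integral>x. \<psi> x * (T l i j x - T0 i j x) \<partial>lborel) \<longlongrightarrow> 0) (at_right 0)"
  proof (rule Lim_transform_eventually[OF *], use pos_at_right in eventually_elim)
    fix l :: real assume "l > 0"
    then show "(\<integral>x. \<psi> x * T l i j x \<partial>lborel) - (\<integral>x. \<psi> x * T0 i j x \<partial>lborel) = (\<integral>x. \<psi> x * (T l i j x - T0 i j x) \<partial>lborel)"
      using Bochner_Integration.integral_diff[OF integrable_test[OF \<psi> smooth_T] integrable_test[OF \<psi> smooth_T0]]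
      by (simp add: right_diff_distrib)
  qed
qed

definition "P l w x = (\<Sum>i\<in>UNIV. \<Sum>j\<in>UNIV. w $ i * w $ j * T l i j x)" for w :: "real^4"

lemma smooth_P: "l > 0 \<Longrightarrow> smooth_on U (P l w)"
  unfolding P_def[abs_def] by (intro smooth_on_sum smooth_on_mult smooth_on_const smooth_T open_U)

lemma integrable_\<theta>: "smooth_on U f \<Longrightarrow> integrable lborel (\<lambda>x. \<theta> x * f x)"
  by (rule integrable_compact_support[OF smooth_on_imp_continuous_on K'_compact])
    (simp_all add: \<theta>_zero smooth_on_times_support[OF open_U K'_compact K'_U \<theta>_smooth])

text \<open>The cutoff is itself an admissible test function on \<open>K'\<close>, so these
  integrals converge and are eventually bounded above. There is no absolute value here; an L1 bound
  follows only when positivity is added.\<close>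

lemma P_integral_bounded: "\<exists>B. \<forall>\<^sub>F l in at_right 0. (\<integral>x. \<theta> x * P l w x \<partial>lborel) \<le> B"
proof -
  define L0 where "L0 = (\<Sum>i\<in>UNIV. \<Sum>j\<in>UNIV. w $ i * w $ j * (\<integral>x. \<theta> x * T0 i j x \<partial>lborel))"
  have "((\<lambda>l. \<Sum>i\<in>UNIV. \<Sum>j\<in>UNIV. w $ i * w $ j * (\<integral>x. \<theta> x * T l i j x \<partial>lborel)) \<longlongrightarrow> L0) (at_right 0)"
    unfolding L0_def by (intro tendsto_sum tendsto_mult tendsto_const T_lim \<theta>_smooth \<theta>_zero)
  then have "\<forall>\<^sub>F l in at_right 0. (\<Sum>i\<in>UNIV. \<Sum>j\<in>UNIV. w $ i * w $ j * (\<integral>x. \<theta> x * T l i j x \<partial>lborel)) < L0 + 1"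
    by (rule order_tendstoD(2)) simp
  then have "\<forall>\<^sub>F l in at_right 0. (\<integral>x. \<theta> x * P l w x \<partial>lborel) \<le> L0 + 1"
    using pos_at_right
  proof eventually_elim
    case (elim l)
    have i: "integrable lborel (\<lambda>x. w $ i * w $ j * (\<theta> x * T l i j x))" for i j
      using integrable_\<theta>[OF smooth_T[OF elim(2)]] by simp
    have "(\<integral>x. \<theta> x * P l w x \<partial>lborel) = (\<integral>x. (\<Sum>i\<in>UNIV. \<Sum>j\<in>UNIV. w $ i * w $ j * (\<theta> x * T l i j x)) \<partial>lborel)"
      by (simp add: P_def sum_distrib_left mult_ac)
    also have "\<dots> = (\<Sum>i\<in>UNIV. \<Sum>j\<in>UNIV. w $ i * w $ j * (\<integral>x. \<theta> x * T l i j x \<partial>lborel))"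
    proof -
      have "(\<integral>x. (\<Sum>i\<in>UNIV. \<Sum>j\<in>UNIV. w $ i * w $ j * (\<theta> x * T l i j x)) \<partial>lborel)
          = (\<Sum>i\<in>UNIV. \<integral>x. (\<Sum>j\<in>UNIV. w $ i * w $ j * (\<theta> x * T l i j x)) \<partial>lborel)"
        by (rule Bochner_Integration.integral_sum) (rule Bochner_Integration.integrable_sum, rule i)
      also have "\<dots> = (\<Sum>i\<in>UNIV. \<Sum>j\<in>UNIV. \<integral>x. w $ i * w $ j * (\<theta> x * T l i j x) \<partial>lborel)"
        by (intro sum.cong refl, rule Bochner_Integration.integral_sum, rule i)
      finally show ?thesis by (simp only: integral_mult_right_zero)
    qed
    finally show ?case using elim(1) by simp
  qed
  then show ?thesis by blast
qed

lemma P_nonneg: "\<forall>\<^sub>F l in at_right 0. \<forall>x\<in>U. \<forall>w. norm (w - v0) \<le> \<epsilon> \<longrightarrow> P l w x \<ge> 0"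
  using timelike pos_at_right by eventually_elim (auto simp: P_def intro: wec)

lemma P_parallelogram: "P l (v + w) x + P l (v - w) x = 2 * P l v x + 2 * P l w x"
  by (simp add: P_def sum_distrib_left sum.distrib[symmetric] algebra_simps)

lemma P_scale: "P l (s *\<^sub>R w) x = s\<^sup>2 * P l w x"
  by (simp add: P_def sum_distrib_left power2_eq_square mult_ac)

text \<open>Both \<open>P l (v0 + (\<epsilon>/2) u)\<close> and \<open>P l (v0 - (\<epsilon>/2) u)\<close> are nonnegative, so the parallelogram law
  controls \<open>P l u\<close> from both sides by nonnegative terms only.\<close>

definition "M l u x = (P l (v0 + (\<epsilon>/2) *\<^sub>R u) x + P l (v0 - (\<epsilon>/2) *\<^sub>R u) x + 2 * P l v0 x) / (2 * (\<epsilon>/2)\<^sup>2)"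

text \<open>The factor \<epsilon>/2 and the bound 2 match, so that both shifted vectors stay within
  \<epsilon> of \<open>v0\<close>. The bound is 2 because sums of two basis vectors occur in the
  polarization of \<open>T\<close>.\<close>

lemma P_le_M:
  "\<forall>\<^sub>F l in at_right 0. \<forall>x\<in>U. \<forall>u. norm u \<le> 2 \<longrightarrow> \<bar>P l u x\<bar> \<le> M l u x"
  using P_nonneg
proof eventually_elim
  case (elim l)
  show ?case
  proof (intro ballI allI impI)
    fix x u assume x: "x \<in> U" and u: "norm (u::real^4) \<le> 2"
    have n: "norm ((\<epsilon>/2) *\<^sub>R u) \<le> \<epsilon>" using u eps by simp
    have "P l (v0 + (\<epsilon>/2) *\<^sub>R u) x \<ge> 0" "P l (v0 - (\<epsilon>/2) *\<^sub>R u) x \<ge> 0" "P l v0 x \<ge> 0"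
      using elim x n eps by auto
    moreover have "P l (v0 + (\<epsilon>/2) *\<^sub>R u) x + P l (v0 - (\<epsilon>/2) *\<^sub>R u) x = 2 * P l v0 x + (2 * (\<epsilon>/2)\<^sup>2) * P l u x"
      using P_parallelogram[of l v0 "(\<epsilon>/2) *\<^sub>R u" x] by (simp add: P_scale)
    ultimately have "\<bar>(2 * (\<epsilon>/2)\<^sup>2) * P l u x\<bar> \<le> P l (v0 + (\<epsilon>/2) *\<^sub>R u) x + P l (v0 - (\<epsilon>/2) *\<^sub>R u) x + 2 * P l v0 x"
      by linarith
    moreover have "2 * (\<epsilon>/2)\<^sup>2 > 0" using eps by simp
    ultimately show "\<bar>P l u x\<bar> \<le> M l u x"
      unfolding M_def by (simp add: abs_mult pos_le_divide_eq mult.commute)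
  qed
qed

lemma smooth_M: "l > 0 \<Longrightarrow> smooth_on U (M l u)"
  unfolding M_def[abs_def] divide_inverse
  by (intro smooth_on_mult smooth_on_add smooth_on_const smooth_P open_U)

lemma M_integral_bounded: "\<exists>B. \<forall>\<^sub>F l in at_right 0. (\<integral>x. \<theta> x * M l u x \<partial>lborel) \<le> B"
proof -
  let ?s = "(\<epsilon>/2) *\<^sub>R u" and ?c = "2 * (\<epsilon>/2)\<^sup>2"
  obtain B1 where B1: "\<forall>\<^sub>F l in at_right 0. (\<integral>x. \<theta> x * P l (v0 + ?s) x \<partial>lborel) \<le> B1"
    using P_integral_bounded[of "v0 + ?s"] by (elim exE)
  obtain B2 where B2: "\<forall>\<^sub>F l in at_right 0. (\<integral>x. \<theta> x * P l (v0 - ?s) x \<partial>lborel) \<le> B2"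
    using P_integral_bounded[of "v0 - ?s"] by (elim exE)
  obtain B3 where B3: "\<forall>\<^sub>F l in at_right 0. (\<integral>x. \<theta> x * P l v0 x \<partial>lborel) \<le> B3"
    using P_integral_bounded[of v0] by (elim exE)
  have "\<forall>\<^sub>F l in at_right 0. (\<integral>x. \<theta> x * M l u x \<partial>lborel) \<le> (B1 + B2 + 2 * B3) / ?c"
    using B1 B2 B3 pos_at_right
  proof eventually_elim
    case (elim l)
    have i: "integrable lborel (\<lambda>x. \<theta> x * P l w x)" for w by (rule integrable_\<theta>[OF smooth_P[OF elim(4)]])
    have "(\<integral>x. \<theta> x * M l u x \<partial>lborel)
        = (\<integral>x. (\<theta> x * P l (v0 + ?s) x + \<theta> x * P l (v0 - ?s) x + 2 * (\<theta> x * P l v0 x)) / ?c \<partial>lborel)"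
      by (simp add: M_def algebra_simps)
    also have "\<dots> = ((\<integral>x. \<theta> x * P l (v0 + ?s) x \<partial>lborel) + (\<integral>x. \<theta> x * P l (v0 - ?s) x \<partial>lborel)
        + 2 * (\<integral>x. \<theta> x * P l v0 x \<partial>lborel)) / ?c"
      by (simp only: integral_divide_zero Bochner_Integration.integral_add i
          Bochner_Integration.integrable_add integrable_mult_right integral_mult_right_zero)
    also have "\<dots> \<le> (B1 + B2 + 2 * B3) / ?c" using elim eps by (intro divide_right_mono) auto
    finally show ?case .
  qed
  then show ?thesis by blast
qed

text \<open>On \<open>K\<close> the integrand is at most sup |\<psi>| times sup |k| times the
  nonnegative \<open>M\<close>, and \<open>M\<close> is at most \<open>\<theta> * M / m\<close>
  there. The integral of \<open>\<theta> * M\<close> stays bounded, so the sup of \<open>k\<close>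
  makes everything small.\<close>

lemma null_times_P:
  assumes k: "unif_null k" and u: "norm u \<le> 2"
  shows "weak_null (\<lambda>l x. k l x * P l u x)"
  unfolding weak_null_def
proof (intro conjI allI impI family_mult unif_null_family[OF k])
  show fP: "family (\<lambda>l. P l u)" by (simp add: family_def smooth_P)
  fix \<psi> assume \<psi>: "test_fun \<psi>"
  have "smooth_on UNIV \<psi>" using \<psi> by (simp add: test_fun_def)
  then have "bounded (\<psi> ` K)"
    by (intro compact_imp_bounded compact_continuous_image compact_K
        continuous_on_subset[OF smooth_on_imp_continuous_on subset_UNIV])
  then obtain \<Psi> where \<Psi>0: "\<Psi> > 0" "\<forall>y\<in>\<psi> ` K. norm y \<le> \<Psi>"
    unfolding bounded_pos by (elim exE conjE)
  have \<Psi>: "\<Psi> > 0" "\<And>x. x \<in> K \<Longrightarrow> \<bar>\<psi> x\<bar> \<le> \<Psi>" using \<Psi>0 by auto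
  \<comment> \<open>The minimum of the cutoff over the compact set; it is positive because the
    cutoff is positive on \<open>K\<close>.\<close>
  obtain m where m: "m > 0" "\<And>x. x \<in> K \<Longrightarrow> m \<le> \<theta> x"
  proof (cases "K = {}")
    case True
    then show ?thesis using that[of 1] by simp
  next
    case False
    obtain y where "y \<in> K" "\<forall>x\<in>K. \<theta> y \<le> \<theta> x"
      using continuous_attains_inf[OF compact_K False, of \<theta>]
        continuous_on_subset[OF smooth_on_imp_continuous_on[OF \<theta>_smooth] subset_UNIV] by blast
    then show ?thesis using that[of "\<theta> y"] \<theta>_pos by blast
  qed
  obtain B where B: "\<forall>\<^sub>F l in at_right 0. (\<integral>x. \<theta> x * M l u x \<partial>lborel) \<le> B" using M_integral_bounded by blast
  define B' where "B' = \<bar>B\<bar> + 1"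
  have B': "B' > 0" "B \<le> B'" by (auto simp: B'_def)
  show "((\<lambda>l. \<integral>x. \<psi> x * (k l x * P l u x) \<partial>lborel) \<longlongrightarrow> 0) (at_right 0)"
  proof (rule tendstoI)
    fix e :: real assume e: "e > 0"
    \<comment> \<open>Chosen so that \<open>(\<Psi> * \<eta> / m) * B'\<close> comes out as
      \<open>e / 2\<close>.\<close>
    define \<eta> where "\<eta> = e * m / (2 * \<Psi> * B')"
    have \<eta>: "\<eta> > 0" using e m \<Psi> B' by (simp add: \<eta>_def)
    have "\<forall>\<^sub>F l in at_right 0. \<forall>x\<in>K. \<bar>k l x\<bar> \<le> \<eta>" using k \<eta> by (simp add: unif_null_def)
    then show "\<forall>\<^sub>F l in at_right 0. dist (\<integral>x. \<psi> x * (k l x * P l u x) \<partial>lborel) 0 < e"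
      using B P_le_M pos_at_right
    proof eventually_elim
      case (elim l)
      have "norm (\<integral>x. \<psi> x * (k l x * P l u x) \<partial>lborel) \<le> (\<integral>x. (\<Psi> * \<eta> / m) * (\<theta> x * M l u x) \<partial>lborel)"
      proof (rule order_trans[OF integral_norm_bound integral_mono])
        have "smooth_on U (\<lambda>x. k l x * P l u x)"
          using family_mult[OF unif_null_family[OF k] fP] elim(4) by (simp add: family_def)
        then show "integrable lborel (\<lambda>x. norm (\<psi> x * (k l x * P l u x)))"
          by (intro integrable_norm integrable_test \<psi>)
        show "integrable lborel (\<lambda>x. (\<Psi> * \<eta> / m) * (\<theta> x * M l u x))"
          by (intro integrable_mult_right integrable_\<theta> smooth_M elim(4))
        fix x
        show "norm (\<psi> x * (k l x * P l u x)) \<le> (\<Psi> * \<eta> / m) * (\<theta> x * M l u x)"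
        proof (cases "x \<in> K")
          case True
          then have PM: "\<bar>P l u x\<bar> \<le> M l u x" using elim(3) K_subset u by blast
          have "\<bar>\<psi> x\<bar> * (\<bar>k l x\<bar> * \<bar>P l u x\<bar>) \<le> \<Psi> * (\<eta> * M l u x)"
            using \<Psi> elim(1) True PM \<eta> by (intro mult_mono) auto
          also have "\<dots> = (\<Psi> * \<eta> / m) * (m * M l u x)" using m by simp
          also have "\<dots> \<le> (\<Psi> * \<eta> / m) * (\<theta> x * M l u x)"
            using m True PM \<Psi> \<eta> by (intro mult_left_mono mult_right_mono) (auto intro: order_trans[OF abs_ge_zero])
          finally show ?thesis by (simp only: real_norm_def abs_mult)
        next
          case False
          \<comment> \<open>Off \<open>K\<close> the left side is zero, but the right side still has
            to be nonnegative: in \<open>U\<close> because \<open>M\<close> dominates an absolute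
            value, outside \<open>U\<close> because the cutoff vanishes there.\<close>
          have "\<theta> x * M l u x \<ge> 0"
          proof (cases "x \<in> U")
            case True
            then have "\<bar>P l u x\<bar> \<le> M l u x" using elim(3) u by blast
            then show ?thesis using \<theta>_nonneg by (intro mult_nonneg_nonneg) auto
          next
            case False
            then have "x \<notin> K'" using K'_U by (rule contra_subsetD[rotated])
            then show ?thesis by (simp add: \<theta>_zero)
          qed
          moreover have "\<psi> x = 0" using False \<psi> by (simp add: test_fun_def)
          ultimately show ?thesis using m \<Psi> \<eta> by simp
        qed
      qed
      also have "\<dots> = (\<Psi> * \<eta> / m) * (\<integral>x. \<theta> x * M l u x \<partial>lborel)" by simp
      also have "\<dots> \<le> (\<Psi> * \<eta> / m) * B'"
        using elim(2) B' m \<Psi> \<eta> by (intro mult_left_mono) auto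
      also have "\<dots> = e / 2" using m \<Psi> B' by (simp add: \<eta>_def)
      also have "\<dots> < e" using e by simp
      finally show ?case by simp
    qed
  qed
qed

lemma T_polarization:
  "T l i j x + T l j i x = P l (axis i 1 + axis j 1) x - P l (axis i 1) x - P l (axis j 1) x"
proof -
  have bil: "(\<Sum>a\<in>UNIV. \<Sum>b\<in>UNIV. (axis i 1 :: real^4) $ a * (axis j 1 :: real^4) $ b * T l a b x) = T l i j x" for i j
  proof -
    have "(\<Sum>a\<in>UNIV. \<Sum>b\<in>UNIV. (axis i 1 :: real^4) $ a * (axis j 1 :: real^4) $ b * T l a b x)
        = (\<Sum>a\<in>UNIV. \<Sum>b\<in>UNIV. if a = i then (if b = j then T l a b x else 0) else 0)"
      by (intro sum.cong refl) (auto simp: axis_def)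
    also have "\<dots> = (\<Sum>a\<in>UNIV. if a = i then T l a j x else 0)"
      by (intro sum.cong refl) auto
    finally show ?thesis by simp
  qed
  have "P l (axis i 1 + axis j 1) x = P l (axis i 1) x + P l (axis j 1) x
      + ((\<Sum>a\<in>UNIV. \<Sum>b\<in>UNIV. (axis i 1 :: real^4) $ a * (axis j 1 :: real^4) $ b * T l a b x)
        + (\<Sum>a\<in>UNIV. \<Sum>b\<in>UNIV. (axis j 1 :: real^4) $ a * (axis i 1 :: real^4) $ b * T l a b x))"
    unfolding P_def sum.distrib[symmetric]
    by (intro sum.cong refl) (simp add: algebra_simps)
  then show ?thesis unfolding bil by simp
qed

text \<open>The quadratic form \<open>P\<close> determines only the symmetric part of
  \<open>T\<close>, so the coefficients are asked to be symmetric; polarization then expresses the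
  sum through \<open>P\<close> at basis vectors and sums of two of them.\<close>

lemma null_times_T:
  assumes k: "\<And>i j. unif_null (k i j)" and sym: "\<And>l x i j. l > 0 \<Longrightarrow> x \<in> U \<Longrightarrow> k i j l x = k j i l x"
  shows "weak_null (\<lambda>l x. \<Sum>i\<in>UNIV. \<Sum>j\<in>UNIV. k i j l x * T l i j x)"
proof -
  have n: "norm (axis i 1 :: real^4) \<le> 2" "norm (axis i 1 + axis j 1 :: real^4) \<le> 2" for i j
    using norm_triangle_ineq[of "axis i 1 :: real^4" "axis j 1"] by auto
  have "weak_null (\<lambda>l x. (1/2) * (\<Sum>i\<in>UNIV. \<Sum>j\<in>UNIV. k i j l x * P l (axis i 1 + axis j 1) x
      - k i j l x * P l (axis i 1) x - k i j l x * P l (axis j 1) x))"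
    by (intro weak_null_cmult weak_null_sum weak_null_diff null_times_P k n finite)
  then show ?thesis
  proof (rule weak_null_cong)
    fix l :: real and x assume l: "l > 0" and x: "x \<in> U"
    have "(\<Sum>i\<in>UNIV. \<Sum>j\<in>UNIV. k i j l x * T l j i x) = (\<Sum>i\<in>UNIV. \<Sum>j\<in>UNIV. k i j l x * T l i j x)"
      by (subst sum.swap) (simp add: sym[OF l x])
    moreover have "(\<Sum>i\<in>UNIV. \<Sum>j\<in>UNIV. k i j l x * P l (axis i 1 + axis j 1) x
      - k i j l x * P l (axis i 1) x - k i j l x * P l (axis j 1) x)
      = (\<Sum>i\<in>UNIV. \<Sum>j\<in>UNIV. k i j l x * T l i j x) + (\<Sum>i\<in>UNIV. \<Sum>j\<in>UNIV. k i j l x * T l j i x)"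
      unfolding sum.distrib[symmetric] distrib_left[symmetric] T_polarization right_diff_distrib[symmetric] ..
    ultimately show "(1/2) * (\<Sum>i\<in>UNIV. \<Sum>j\<in>UNIV. k i j l x * P l (axis i 1 + axis j 1) x
      - k i j l x * P l (axis i 1) x - k i j l x * P l (axis j 1) x) = (\<Sum>i\<in>UNIV. \<Sum>j\<in>UNIV. k i j l x * T l i j x)"
      by simp
  qed
qed

section \<open>Einstein's equation contracted with \<open>S\<close>\<close>

definition "strace l x = (\<Sum>a\<in>UNIV. \<Sum>b\<in>UNIV. S l a b x * g l a b x)"
text \<open>After Einstein's equation, \<open>8 * pi * T l a b\<close> enters the contraction with
  the coefficient \<open>S - (1/2) * strace * gi l\<close>, whose limit is \<open>- gi 0\<close>.
  This is the deviation from that limit.\<close>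

definition "kern a b l x = S l a b x - (1/2) * strace l x * gi l a b x + gi 0 a b x"

lemma trace_gi_g: "l \<ge> 0 \<Longrightarrow> x \<in> U \<Longrightarrow> (\<Sum>a\<in>UNIV. \<Sum>b\<in>UNIV. gi l a b x * g l a b x) = 4"
proof -
  assume l: "l \<ge> 0" and x: "x \<in> U"
  have "(\<Sum>b\<in>UNIV. gi l a b x * g l a b x) = 1" for a
  proof -
    have "(\<Sum>b\<in>UNIV. gi l a b x * g l a b x) = (\<Sum>b\<in>UNIV. gi l a b x * g l b a x)"
      by (intro sum.cong refl arg_cong[where f = "\<lambda>t. _ * t"] g_sym[OF l x])
    then show ?thesis using gi_g[OF l x, of a a] by simp
  qed
  then show ?thesis by simp
qed

lemma strace_null: "unif_null (\<lambda>l x. strace l x - 4)"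
proof -
  have gb: "unif_bounded (\<lambda>l. g 0 i j)" for i j by (rule unif_bounded_const[OF smooth_g[OF order_refl]])
  have "unif_null (\<lambda>l x. \<Sum>a\<in>UNIV. \<Sum>b\<in>UNIV. S l a b x * h l a b x + (S l a b x - gi 0 a b x) * g 0 a b x)"
    by (intro unif_null_sum unif_null_add unif_null_mult unif_null_mult' S_bounded S_null h_null' gb finite)
  then show ?thesis
  proof (rule unif_null_cong)
    fix l :: real and x assume x: "x \<in> U"
    have "strace l x - (\<Sum>a\<in>UNIV. \<Sum>b\<in>UNIV. gi 0 a b x * g 0 a b x)
        = (\<Sum>a\<in>UNIV. \<Sum>b\<in>UNIV. S l a b x * h l a b x + (S l a b x - gi 0 a b x) * g 0 a b x)"
      unfolding strace_def sum_subtractf[symmetric] by (intro sum.cong refl) (simp add: h_def algebra_simps)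
    then show "(\<Sum>a\<in>UNIV. \<Sum>b\<in>UNIV. S l a b x * h l a b x + (S l a b x - gi 0 a b x) * g 0 a b x) = strace l x - 4"
      by (simp add: trace_gi_g[OF order_refl x])
  qed
qed

text \<open>\<open>S\<close> and \<open>gi l\<close> tend to \<open>gi 0\<close> and
  \<open>strace\<close> tends to the dimension 4, so the coefficient of \<open>gi 0\<close> in the
  limit is 1 - 4/2 + 1 = 0.\<close>

lemma kern_null: "unif_null (kern a b)"
proof -
  have "unif_null (\<lambda>l x. (S l a b x - gi 0 a b x) - ((1/2) * ((strace l x - 4) * gi l a b x) + 2 * (gi l a b x - gi 0 a b x)))"
    by (intro unif_null_diff unif_null_add unif_null_cmult unif_null_mult S_null strace_null gi_null gi_bounded)
  then show ?thesis
    by (rule unif_null_cong) (simp add: kern_def algebra_simps)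
qed

lemma S_sym:
  assumes "l \<ge> 0" "x \<in> U"
  shows "S l a b x = S l b a x"
proof -
  have "(\<Sum>i\<in>UNIV. \<Sum>j\<in>UNIV. wgt a b i j x * h l i j x) = (\<Sum>i\<in>UNIV. \<Sum>j\<in>UNIV. wgt b a i j x * h l i j x)"
    by (subst sum.swap, intro sum.cong refl)
      (simp add: wgt_def h_sym[OF assms] gi_sym[OF order_refl assms(2)] mult.commute mult.left_commute)
  then show ?thesis by (simp add: S_def gi_sym[OF order_refl assms(2), of a b])
qed

lemma kern_sym: "l > 0 \<Longrightarrow> x \<in> U \<Longrightarrow> kern a b l x = kern b a l x"
  using S_sym[of l x a b] gi_sym[of l x a b] gi_sym[of 0 x a b] by (simp add: kern_def)

text \<open>Tracing Einstein's equation in dimension four gives R = 8 pi t + 2 R - 4 \<Lambda>. This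
  removes the scalar curvature, so that only \<open>T\<close> and \<Lambda> remain on the
  right.\<close>

lemma S_ric_eq:
  assumes l: "l > 0" and x: "x \<in> U"
  shows "(\<Sum>a\<in>UNIV. \<Sum>b\<in>UNIV. S l a b x * ric l a b x)
    = 8 * pi * (\<Sum>a\<in>UNIV. \<Sum>b\<in>UNIV. kern a b l x * T l a b x)
      - 8 * pi * (\<Sum>a\<in>UNIV. \<Sum>b\<in>UNIV. gi 0 a b x * T l a b x) + \<Lambda> * strace l x"
proof -
  define R where "R = (\<Sum>c\<in>UNIV. \<Sum>d\<in>UNIV. gi l c d x * ric l c d x)"
  define t where "t = (\<Sum>c\<in>UNIV. \<Sum>d\<in>UNIV. gi l c d x * T l c d x)"
  have ric: "ric l a b x = 8 * pi * T l a b x + ((1/2) * R - \<Lambda>) * g l a b x" for a b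
    using einstein_eq[OF l x, of a b] by (simp add: R_def algebra_simps)
  have "R = (\<Sum>c\<in>UNIV. \<Sum>d\<in>UNIV. gi l c d x * (8 * pi * T l c d x + ((1/2) * R - \<Lambda>) * g l c d x))"
    by (subst (1) R_def) (simp only: ric)
  also have "\<dots> = 8 * pi * t + ((1/2) * R - \<Lambda>) * (\<Sum>c\<in>UNIV. \<Sum>d\<in>UNIV. gi l c d x * g l c d x)"
    unfolding t_def sum_distrib_left sum.distrib[symmetric]
    by (intro sum.cong refl) (simp add: algebra_simps)
  finally have "R = 8 * pi * t + ((1/2) * R - \<Lambda>) * (\<Sum>c\<in>UNIV. \<Sum>d\<in>UNIV. gi l c d x * g l c d x)" .
  then have R: "(1/2) * R - \<Lambda> = \<Lambda> - 4 * pi * t"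
    using trace_gi_g[OF less_imp_le[OF l] x] by simp
  have A: "(\<Sum>a\<in>UNIV. \<Sum>b\<in>UNIV. S l a b x * ric l a b x)
      = 8 * pi * (\<Sum>a\<in>UNIV. \<Sum>b\<in>UNIV. S l a b x * T l a b x) + (\<Lambda> - 4 * pi * t) * strace l x"
    unfolding ric R strace_def sum_distrib_left sum.distrib[symmetric]
    by (intro sum.cong refl) (simp add: algebra_simps)
  have B: "(\<Sum>a\<in>UNIV. \<Sum>b\<in>UNIV. kern a b l x * T l a b x)
      = (\<Sum>a\<in>UNIV. \<Sum>b\<in>UNIV. S l a b x * T l a b x) - (1/2) * strace l x * t
        + (\<Sum>a\<in>UNIV. \<Sum>b\<in>UNIV. gi 0 a b x * T l a b x)"
    unfolding t_def sum_distrib_left sum.distrib[symmetric] sum_subtractf[symmetric]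
    by (intro sum.cong refl) (simp add: kern_def algebra_simps)
  show ?thesis unfolding A B by (simp add: algebra_simps)
qed

text \<open>By \<open>S_ric_diff\<close> the contraction of \<open>S\<close> with the perturbed
  Ricci tensor has the background scalar curvature as weak limit. \<open>S_ric_eq\<close> computes
  the same limit from the matter. A smooth function independent of \<open>l\<close> that is weakly
  null is zero inside \<open>K\<close>.\<close>

theorem background_trace:
  assumes "ball a r \<subseteq> K" "r > 0"
  shows "(\<Sum>i\<in>UNIV. \<Sum>j\<in>UNIV. gi 0 i j a * ric 0 i j a)
    + 8 * pi * (\<Sum>i\<in>UNIV. \<Sum>j\<in>UNIV. gi 0 i j a * T0 i j a) - 4 * \<Lambda> = 0"
proof -
  have rb: "unif_bounded (\<lambda>l. ric 0 i j)" for i j by (rule unif_bounded_const[OF smooth_ric[OF order_refl]])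
  have 1: "weak_null (\<lambda>l x. \<Sum>i\<in>UNIV. \<Sum>j\<in>UNIV. (S l i j x - gi 0 i j x) * ric 0 i j x)"
    by (intro unif_null_weak_null unif_null_sum unif_null_mult S_null rb finite)
  have 2: "weak_null (\<lambda>l x. 8 * pi * (\<Sum>i\<in>UNIV. \<Sum>j\<in>UNIV. kern i j l x * T l i j x))"
    by (intro weak_null_cmult null_times_T kern_null kern_sym)
  have 3: "weak_null (\<lambda>l x. 8 * pi * (\<Sum>i\<in>UNIV. \<Sum>j\<in>UNIV. gi 0 i j x * (T l i j x - T0 i j x)))"
    by (intro weak_null_cmult weak_null_sum weak_null_smooth_mult smooth_gi T_weak_null order_refl finite)
  have 4: "weak_null (\<lambda>l x. \<Lambda> * (strace l x - 4))"
    by (intro unif_null_weak_null unif_null_cmult strace_null)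
  \<comment> \<open>The signs are such that by \<open>S_ric_eq\<close> everything depending on
    \<open>l\<close> cancels pointwise.\<close>
  have "weak_null (\<lambda>l x.
      (8 * pi * (\<Sum>i\<in>UNIV. \<Sum>j\<in>UNIV. kern i j l x * T l i j x)
        - 8 * pi * (\<Sum>i\<in>UNIV. \<Sum>j\<in>UNIV. gi 0 i j x * (T l i j x - T0 i j x))
        + \<Lambda> * (strace l x - 4))
      - ((\<Sum>i\<in>UNIV. \<Sum>j\<in>UNIV. S l i j x * (ric l i j x - ric 0 i j x))
        + (\<Sum>i\<in>UNIV. \<Sum>j\<in>UNIV. (S l i j x - gi 0 i j x) * ric 0 i j x)))"
    by (rule weak_null_diff[OF weak_null_add[OF weak_null_diff[OF 2 3] 4] weak_null_add[OF S_ric_diff 1]])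
  then have "weak_null (\<lambda>l x. (\<Sum>i\<in>UNIV. \<Sum>j\<in>UNIV. gi 0 i j x * ric 0 i j x)
    + 8 * pi * (\<Sum>i\<in>UNIV. \<Sum>j\<in>UNIV. gi 0 i j x * T0 i j x) - 4 * \<Lambda>)"
  proof (rule weak_null_cong)
    fix l :: real and x assume l: "l > 0" and x: "x \<in> U"
    have a: "(\<Sum>i\<in>UNIV. \<Sum>j\<in>UNIV. S l i j x * (ric l i j x - ric 0 i j x))
        + (\<Sum>i\<in>UNIV. \<Sum>j\<in>UNIV. (S l i j x - gi 0 i j x) * ric 0 i j x)
        = (\<Sum>i\<in>UNIV. \<Sum>j\<in>UNIV. S l i j x * ric l i j x) - (\<Sum>i\<in>UNIV. \<Sum>j\<in>UNIV. gi 0 i j x * ric 0 i j x)"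
      unfolding sum.distrib[symmetric] sum_subtractf[symmetric] by (intro sum.cong refl) (simp add: algebra_simps)
    have b: "(\<Sum>i\<in>UNIV. \<Sum>j\<in>UNIV. gi 0 i j x * (T l i j x - T0 i j x))
        = (\<Sum>i\<in>UNIV. \<Sum>j\<in>UNIV. gi 0 i j x * T l i j x) - (\<Sum>i\<in>UNIV. \<Sum>j\<in>UNIV. gi 0 i j x * T0 i j x)"
      unfolding sum_subtractf[symmetric] by (intro sum.cong refl) (simp add: algebra_simps)
    show "(8 * pi * (\<Sum>i\<in>UNIV. \<Sum>j\<in>UNIV. kern i j l x * T l i j x)
        - 8 * pi * (\<Sum>i\<in>UNIV. \<Sum>j\<in>UNIV. gi 0 i j x * (T l i j x - T0 i j x))
        + \<Lambda> * (strace l x - 4))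
      - ((\<Sum>i\<in>UNIV. \<Sum>j\<in>UNIV. S l i j x * (ric l i j x - ric 0 i j x))
        + (\<Sum>i\<in>UNIV. \<Sum>j\<in>UNIV. (S l i j x - gi 0 i j x) * ric 0 i j x))
      = (\<Sum>i\<in>UNIV. \<Sum>j\<in>UNIV. gi 0 i j x * ric 0 i j x)
    + 8 * pi * (\<Sum>i\<in>UNIV. \<Sum>j\<in>UNIV. gi 0 i j x * T0 i j x) - 4 * \<Lambda>"
      unfolding a b S_ric_eq[OF l x] by (simp add: algebra_simps)
  qed
  then show ?thesis by (rule weak_null_const[OF _ assms])
qed

end

subsection \<open>Charts and tensor fields\<close>

lemma finite_idx [simp]: "finite (idx k)"
  using finite_lists_length_eq[of "UNIV :: 4 set" k] by (simp add: idx_def)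

lemma idx_0: "idx 0 = {[]}" by (auto simp: idx_def)

lemma sum_idx_Suc: "(\<Sum>I\<in>idx (Suc k). f I) = (\<Sum>a\<in>UNIV. \<Sum>I\<in>idx k. f (a # I))"
proof -
  have "idx (Suc k) = (\<lambda>(a, I). a # I) ` (UNIV \<times> idx k)"
    by (auto simp: idx_def length_Suc_conv image_iff)
  moreover have "inj_on (\<lambda>(a, I). a # I) (UNIV \<times> idx k)" by (auto simp: inj_on_def)
  ultimately have "(\<Sum>I\<in>idx (Suc k). f I) = (\<Sum>(a, I)\<in>UNIV \<times> idx k. f (a # I))"
    by (simp add: sum.reindex case_prod_beta')
  then show ?thesis by (simp add: sum.cartesian_product)
qed

lemma sum_idx_2: "(\<Sum>I\<in>idx 2. f I) = (\<Sum>a\<in>UNIV. \<Sum>b\<in>UNIV. f [a, b])"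
  by (simp add: numeral_2_eq_2 sum_idx_Suc idx_0)

lemma idx_2: "[a, b] \<in> idx 2" by (simp add: idx_def)

lemma idx_2_cases: assumes "I \<in> idx 2" obtains a b where "I = [a, b]"
  using assms by (auto simp: idx_def length_Suc_conv numeral_2_eq_2)

lemma prod_lessThan_2: "(\<Prod>m<2. f m) = f 0 * f (Suc 0)" for f :: "nat \<Rightarrow> real"
  by (simp add: numeral_2_eq_2)

lemma prod_jac_2: "(\<Prod>m<2. u ([a, b] ! m) ([i, j] ! m)) = u a i * u b j" for u :: "4 \<Rightarrow> 4 \<Rightarrow> real"
  by (simp add: prod_lessThan_2)

locale smooth_manifold =
  fixes X :: "'a topology" and A :: "'a chart set"
  assumes manifold: "manifold4 X A"
begin

lemma
  assumes "c \<in> A"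
  shows openin_cdom: "openin X (cdom c)" and open_cran: "open (cran c)"
    and homeo: "homeomorphic_map (subtopology X (cdom c)) (top_of_set (cran c)) (crd c)"
  using manifold assms by (auto simp: manifold4_def smooth_atlas_def)

lemma cdom_subset: "c \<in> A \<Longrightarrow> cdom c \<subseteq> topspace X"
  by (rule openin_subset[OF openin_cdom])

lemma ex_chart: "p \<in> topspace X \<Longrightarrow> \<exists>c\<in>A. p \<in> cdom c"
  using manifold by (auto simp: manifold4_def smooth_atlas_def)

lemma inj_crd: "c \<in> A \<Longrightarrow> inj_on (crd c) (cdom c)"
  using homeo[of c] cdom_subset[of c] unfolding homeomorphic_map_def by (simp add: Int_absorb1)

lemma cinv_crd: "c \<in> A \<Longrightarrow> p \<in> cdom c \<Longrightarrow> cinv c (crd c p) = p"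
  by (rule inv_into_f_f[OF inj_crd])

lemma crd_cinv: "x \<in> cran c \<Longrightarrow> crd c (cinv c x) = x"
  by (rule f_inv_into_f)

lemma cinv_cdom: "x \<in> cran c \<Longrightarrow> cinv c x \<in> cdom c"
  by (rule inv_into_into)

lemma image_crd: "c \<in> A \<Longrightarrow> S \<subseteq> cdom c \<Longrightarrow> crd c ` S = cinv c -` S \<inter> cran c"
  using cinv_crd by (fastforce simp: crd_cinv image_iff)

lemma open_image_crd:
  assumes "c \<in> A" "openin X W"
  shows "open (crd c ` (W \<inter> cdom c))"
proof -
  have "openin (subtopology X (cdom c)) (W \<inter> cdom c)" using assms(2) by (auto simp: openin_subtopology)
  then have "openin (top_of_set (cran c)) (crd c ` (W \<inter> cdom c))"
    using homeo[OF assms(1)] by (simp add: homeomorphic_map_openness_eq)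
  then show ?thesis using open_cran[OF assms(1)] openin_open_trans by blast
qed

lemma openin_image_cinv:
  assumes "c \<in> A" "open V" "V \<subseteq> cran c"
  shows "openin X (cinv c ` V)"
proof -
  have "openin (top_of_set (cran c)) V" using assms by (auto intro: open_subset)
  moreover have "crd c ` (cinv c ` V) = V"
  proof -
    have "crd c (cinv c x) = x" if "x \<in> V" for x using assms(3) that by (intro crd_cinv) blast
    then show ?thesis by (simp add: image_image)
  qed
  moreover have "cinv c ` V \<subseteq> cdom c" by (intro image_subsetI cinv_cdom subsetD[OF assms(3)])
  ultimately have "openin (subtopology X (cdom c)) (cinv c ` V)"
    using homeomorphic_map_openness[OF homeo[OF assms(1)], of "cinv c ` V"] cdom_subset[OF assms(1)]
    by (simp add: Int_absorb1)
  then show ?thesis using openin_cdom[OF assms(1)] openin_trans_full by blast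
qed

text \<open>The continuous inverse \<open>k\<close> supplied by the homeomorphism carries the
  compactness; on the coordinate range it coincides with \<open>cinv\<close>, whose values elsewhere
  are arbitrary.\<close>

lemma compactin_image_cinv:
  assumes "c \<in> A" "compact V" "V \<subseteq> cran c"
  shows "compactin X (cinv c ` V)"
proof -
  obtain k where k: "homeomorphic_maps (subtopology X (cdom c)) (top_of_set (cran c)) (crd c) k"
    using homeo[OF assms(1)] homeomorphic_map_maps by blast
  then have cont: "continuous_map (top_of_set (cran c)) (subtopology X (cdom c)) k"
    and inv: "\<And>p. p \<in> cdom c \<Longrightarrow> k (crd c p) = p"
    using cdom_subset[OF assms(1)] by (auto simp: homeomorphic_maps_def)
  have "compactin (top_of_set (cran c)) V" using assms by (simp add: compactin_subtopology)
  then have "compactin (subtopology X (cdom c)) (k ` V)" using cont by (rule image_compactin)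
  then have "compactin X (k ` V)" by (simp add: compactin_subtopology)
  moreover have "k x = cinv c x" if "x \<in> V" for x
    using inv[of "cinv c x"] that assms(3) crd_cinv[of x c] cinv_cdom[of x c] by auto
  ultimately show ?thesis by (metis (no_types, lifting) image_cong)
qed

lemma closedin_compact: "compactin X S \<Longrightarrow> closedin X S"
  using manifold by (intro compactin_imp_closedin) (auto simp: manifold4_def)

lemma smooth_transition: "c \<in> A \<Longrightarrow> d \<in> A \<Longrightarrow> smooth_on (crd c ` (cdom c \<inter> cdom d)) (crd d \<circ> cinv c)"
  using manifold by (auto simp: manifold4_def smooth_atlas_def)

lemma open_overlap: "c \<in> A \<Longrightarrow> d \<in> A \<Longrightarrow> open (crd c ` (cdom c \<inter> cdom d))"
  using open_image_crd[of c "cdom d"] openin_cdom[of d] by (simp add: Int_commute)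

text \<open>The derivative of the coordinate change as a linear map, with \<open>jac\<close> as its
  matrix. As maps, chain rule and inverses are plain composition.\<close>

definition Dtr :: "'a chart \<Rightarrow> 'a chart \<Rightarrow> 'a \<Rightarrow> real^4 \<Rightarrow> real^4" where
  "Dtr c d p = frechet_derivative (crd d \<circ> cinv c) (at (crd c p))"

lemma has_derivative_transition:
  assumes "c \<in> A" "d \<in> A" "p \<in> cdom c \<inter> cdom d"
  shows "((crd d \<circ> cinv c) has_derivative Dtr c d p) (at (crd c p))"
proof -
  have "crd c p \<in> crd c ` (cdom c \<inter> cdom d)" using assms(3) by blast
  from smooth_on_imp_differentiable[OF smooth_transition[OF assms(1,2)] this]
  show ?thesis unfolding Dtr_def frechet_derivative_works .
qed

lemma jac_Dtr:
  assumes "c \<in> A" "d \<in> A" "p \<in> cdom c \<inter> cdom d"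
  shows "jac c d p i j = Dtr c d p (axis j 1) $ i"
proof -
  have "((\<lambda>x. (crd d \<circ> cinv c) x $ i) has_derivative (\<lambda>v. Dtr c d p v $ i)) (at (crd c p))"
    by (rule bounded_linear.has_derivative[OF bounded_linear_vec_nth has_derivative_transition[OF assms]])
  from frechet_derivative_at[OF this, symmetric] show ?thesis by (simp add: jac_def pd_def comp_def)
qed

lemma Dtr_chain:
  assumes "c \<in> A" "d \<in> A" "e \<in> A" and p: "p \<in> cdom c" "p \<in> cdom d" "p \<in> cdom e"
  shows "Dtr c e p = Dtr d e p \<circ> Dtr c d p"
proof -
  have cp: "(crd d \<circ> cinv c) (crd c p) = crd d p" by (simp add: cinv_crd assms)
  have "((crd e \<circ> cinv d) \<circ> (crd d \<circ> cinv c) has_derivative (Dtr d e p \<circ> Dtr c d p)) (at (crd c p))"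
  proof (rule diff_chain_at)
    show "(crd d \<circ> cinv c has_derivative Dtr c d p) (at (crd c p))"
      by (rule has_derivative_transition) (use assms in simp_all)
    show "(crd e \<circ> cinv d has_derivative Dtr d e p) (at ((crd d \<circ> cinv c) (crd c p)))"
      unfolding cp by (rule has_derivative_transition) (use assms in simp_all)
  qed
  then have "((crd e \<circ> cinv c) has_derivative (Dtr d e p \<circ> Dtr c d p)) (at (crd c p))"
  proof (rule has_derivative_transform_within_open[OF _ open_overlap[OF assms(1,2)]])
    show "crd c p \<in> crd c ` (cdom c \<inter> cdom d)" using p by blast
    fix x assume "x \<in> crd c ` (cdom c \<inter> cdom d)"
    then show "((crd e \<circ> cinv d) \<circ> (crd d \<circ> cinv c)) x = (crd e \<circ> cinv c) x"
      using assms(1,2) by (auto simp: cinv_crd)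
  qed
  then show ?thesis
    using has_derivative_unique[OF has_derivative_transition[OF assms(1,3)]] p by blast
qed

lemma Dtr_same: "c \<in> A \<Longrightarrow> p \<in> cdom c \<Longrightarrow> Dtr c c p = id"
proof -
  assume c: "c \<in> A" and p: "p \<in> cdom c"
  have "((\<lambda>x. x) has_derivative id) (at (crd c p))" by (simp add: id_def)
  then have "((crd c \<circ> cinv c) has_derivative id) (at (crd c p))"
    by (rule has_derivative_transform_within_open[OF _ open_cran[OF c]]) (use p in \<open>auto simp: crd_cinv\<close>)
  then show "Dtr c c p = id"
    using has_derivative_unique[OF has_derivative_transition[OF c c]] p by blast
qed

lemma jac_chain:
  assumes "c \<in> A" "d \<in> A" "e \<in> A" and p: "p \<in> cdom c" "p \<in> cdom d" "p \<in> cdom e"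
  shows "jac c e p i k = (\<Sum>j\<in>UNIV. jac d e p i j * jac c d p j k)"
proof -
  have lin: "linear (Dtr d e p)"
    using has_derivative_transition[of d e p] assms has_derivative_linear by blast
  have "Dtr c e p (axis k 1) = Dtr d e p (Dtr c d p (axis k 1))"
    using Dtr_chain[OF assms] by simp
  also have "\<dots> = matrix (Dtr d e p) *v Dtr c d p (axis k 1)"
    using matrix_works[of "Dtr d e p"] lin by simp
  finally have "Dtr c e p (axis k 1) $ i = (\<Sum>j\<in>UNIV. Dtr d e p (axis j 1) $ i * Dtr c d p (axis k 1) $ j)"
    by (simp add: matrix_vector_mult_def matrix_def)
  then show ?thesis using assms by (simp add: jac_Dtr)
qed

lemma cov_tensor_2:
  assumes "cov_tensor A 2 T" "c \<in> A" "d \<in> A" "p \<in> cdom c" "p \<in> cdom d"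
  shows "T c p [i, j] = (\<Sum>a\<in>UNIV. \<Sum>b\<in>UNIV. jac c d p a i * jac c d p b j * T d p [a, b])"
proof -
  have "T c p [i, j] = (\<Sum>J\<in>idx 2. (\<Prod>m<2. jac c d p (J ! m) ([i, j] ! m)) * T d p J)"
    using assms idx_2[of i j] unfolding cov_tensor_def by blast
  then show ?thesis by (simp only: sum_idx_2 prod_jac_2)
qed

lemma det_mat_of:
  assumes "cov_tensor A 2 T" "c \<in> A" "d \<in> A" "p \<in> cdom c" "p \<in> cdom d"
  shows "det (mat_of T c p) = (det (matrix (Dtr c d p)))\<^sup>2 * det (mat_of T d p)"
proof -
  let ?J = "matrix (Dtr c d p)"
  have "mat_of T c p = transpose ?J ** (mat_of T d p ** ?J)"
    using cov_tensor_2[OF assms] assms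
    by (simp add: vec_eq_iff mat_of_def matrix_matrix_mult_def transpose_def matrix_def jac_Dtr sum_distrib_left mult_ac)
  then show ?thesis by (simp add: det_mul power2_eq_square mult_ac)
qed

section \<open>Borel sets of the manifold and their coordinate images\<close>

definition BX :: "'a measure" where
  "BX = sigma (topspace X) {U. openin X U}"

lemma openin_Pow: "{U. openin X U} \<subseteq> Pow (topspace X)"
  using openin_subset by auto

lemma space_BX [simp]: "space BX = topspace X"
  by (simp add: BX_def space_measure_of openin_Pow)

lemma sets_BX: "sets BX = sigma_sets (topspace X) {U. openin X U}"
  by (simp add: BX_def sets_measure_of openin_Pow)

lemma openin_sets: "openin X W \<Longrightarrow> W \<in> sets BX"
  by (simp add: sets_BX sigma_sets.Basic)

lemma cran_borel: "c \<in> A \<Longrightarrow> cran c \<in> sets borel"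
  using open_cran by auto

lemma measurable_cinv:
  assumes "c \<in> A"
  shows "cinv c \<in> measurable (restrict_space borel (cran c)) BX"
  unfolding BX_def
proof (rule measurable_measure_of[OF openin_Pow])
  show "cinv c \<in> space (restrict_space borel (cran c)) \<rightarrow> topspace X"
    using cdom_subset[OF assms] cinv_crd[OF assms] by (auto simp: space_restrict_space)
  fix W assume "W \<in> {U. openin X U}"
  then have "open (crd c ` (W \<inter> cdom c))" by (intro open_image_crd assms) simp
  moreover have "crd c ` (W \<inter> cdom c) = cinv c -` W \<inter> space (restrict_space borel (cran c))"
    using image_crd[OF assms, of "W \<inter> cdom c"] cinv_crd[OF assms] by (auto simp: space_restrict_space)
  ultimately show "cinv c -` W \<inter> space (restrict_space borel (cran c)) \<in> sets (restrict_space borel (cran c))"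
    using assms cran_borel by (auto simp: sets_restrict_space_iff space_restrict_space)
qed

lemma image_crd_borel:
  assumes "c \<in> A" "S \<in> sets BX" "S \<subseteq> cdom c"
  shows "crd c ` S \<in> sets borel"
proof -
  have "cinv c -` S \<inter> space (restrict_space borel (cran c)) \<in> sets (restrict_space borel (cran c))"
    by (rule measurable_sets[OF measurable_cinv[OF assms(1)] assms(2)])
  then show ?thesis
    using image_crd[OF assms(1,3)] cran_borel[OF assms(1)] by (simp add: sets_restrict_space_iff space_restrict_space)
qed

end

subsection \<open>Change of variables for nonnegative functions\<close>

text \<open>The change of variables formula is an equivalence between finite integrals, so it
  transfers a finite value in either direction. If one side is infinite, a finite value of the other
  would be transferred back, a contradiction.\<close>

lemma nn_integral_change_of_variables:
  fixes f :: "real^4 \<Rightarrow> real" and \<tau> h :: "real^4 \<Rightarrow> real^4"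
  assumes der: "\<And>x. x \<in> S \<Longrightarrow> (\<tau> has_derivative \<tau>' x) (at x within S)"
      and der_h: "\<And>y. y \<in> T \<Longrightarrow> (h has_derivative h' y) (at y within T)"
      and f0: "\<And>y. y \<in> T \<Longrightarrow> 0 \<le> f y"
      and \<tau>h: "\<And>x. x \<in> S \<Longrightarrow> \<tau> x \<in> T \<and> h (\<tau> x) = x"
      and h\<tau>: "\<And>y. y \<in> T \<Longrightarrow> h y \<in> S \<and> \<tau> (h y) = y"
      and id: "\<And>y. y \<in> T \<Longrightarrow> h' y \<circ> \<tau>' (h y) = id"
      and meas: "(\<lambda>x. indicator T x * f x) \<in> borel_measurable borel"
        "(\<lambda>x. indicator S x * (\<bar>det (matrix (\<tau>' x))\<bar> * f (\<tau> x))) \<in> borel_measurable borel"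
  shows "(\<integral>\<^sup>+x. ennreal (indicator S x * (\<bar>det (matrix (\<tau>' x))\<bar> * f (\<tau> x))) \<partial>lborel)
    = (\<integral>\<^sup>+x. ennreal (indicator T x * f x) \<partial>lborel)"
proof -
  have ind: "(\<lambda>x. indicator Q x * k x) = (\<lambda>x. if x \<in> Q then k x else 0)" for Q :: "(real^4) set" and k :: "real^4 \<Rightarrow> real"
    by (auto simp: indicator_def)
  have iff: "((\<lambda>x. \<bar>det (matrix (\<tau>' x))\<bar> * f (\<tau> x)) has_integral b) S \<longleftrightarrow> (f has_integral b) T" for b
    by (rule cov_invertible_nonneg_eq[OF der der_h f0 \<tau>h h\<tau> id])
  have f0': "0 \<le> \<bar>det (matrix (\<tau>' x))\<bar> * f (\<tau> x)" if "x \<in> S" for x using f0 \<tau>h[OF that] by simp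
  have S1: "((\<lambda>x. \<bar>det (matrix (\<tau>' x))\<bar> * f (\<tau> x)) has_integral r) S"
    if "(\<integral>\<^sup>+x. ennreal (indicator S x * (\<bar>det (matrix (\<tau>' x))\<bar> * f (\<tau> x))) \<partial>lborel) = ennreal r" "0 \<le> r" for r
  proof -
    have "((\<lambda>x. indicator S x * (\<bar>det (matrix (\<tau>' x))\<bar> * f (\<tau> x))) has_integral r) UNIV"
      by (rule nn_integral_has_integral[OF meas(2) _ that]) (use f0' in \<open>auto simp: indicator_def\<close>)
    then show ?thesis unfolding ind has_integral_restrict_UNIV .
  qed
  have T1: "(f has_integral r) T"
    if "(\<integral>\<^sup>+x. ennreal (indicator T x * f x) \<partial>lborel) = ennreal r" "0 \<le> r" for r
  proof -
    have "((\<lambda>x. indicator T x * f x) has_integral r) UNIV"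
      by (rule nn_integral_has_integral[OF meas(1) _ that]) (use f0 in \<open>auto simp: indicator_def\<close>)
    then show ?thesis unfolding ind has_integral_restrict_UNIV .
  qed
  have S2: "(\<integral>\<^sup>+x. ennreal (indicator S x * (\<bar>det (matrix (\<tau>' x))\<bar> * f (\<tau> x))) \<partial>lborel) = ennreal r"
    if "((\<lambda>x. \<bar>det (matrix (\<tau>' x))\<bar> * f (\<tau> x)) has_integral r) S" for r
    using nn_integral_has_integral_lebesgue[OF f0' that] by simp
  have T2: "(\<integral>\<^sup>+x. ennreal (indicator T x * f x) \<partial>lborel) = ennreal r" if "(f has_integral r) T" for r
    using nn_integral_has_integral_lebesgue[OF f0 that] by simp
  show ?thesis
  proof (cases "\<integral>\<^sup>+x. ennreal (indicator T x * f x) \<partial>lborel")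
    case (real r)
    then show ?thesis using S2 iff T1 by simp
  next
    case top
    show ?thesis
    proof (cases "\<integral>\<^sup>+x. ennreal (indicator S x * (\<bar>det (matrix (\<tau>' x))\<bar> * f (\<tau> x))) \<partial>lborel")
      case (real r)
      then have "(f has_integral r) T" using S1 iff by simp
      from T2[OF this] top show ?thesis by simp
    qed (use top in simp)
  qed
qed

lemma smooth_on_det:
  fixes M :: "real^4 \<Rightarrow> real^4^4"
  assumes "open S" "\<And>i j. smooth_on S (\<lambda>x. M x $ i $ j)"
  shows "smooth_on S (\<lambda>x. det (M x))"
  unfolding det_def
  by (intro smooth_on_sum smooth_on_mult smooth_on_const smooth_on_prod assms)

text \<open>Writes the density through the square of the determinant, which is smooth and positive,
  so that its smoothness follows without a case distinction on the sign.\<close>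

lemma sqrt_abs_eq: "sqrt \<bar>d\<bar> = sqrt (sqrt (d * d))"
  by (simp add: real_sqrt_mult_self)

subsection \<open>The metric volume\<close>

locale spacetime = smooth_manifold +
  fixes g0 :: "'a tfield"
  assumes cov: "cov_tensor A 2 g0" and smooth: "smooth_comps A 2 g0"
    and nondegenerate: "c \<in> A \<Longrightarrow> p \<in> cdom c \<Longrightarrow> det (mat_of g0 c p) \<noteq> 0"
    and A_nonempty: "A \<noteq> {}"
begin

definition dens :: "'a chart \<Rightarrow> real^4 \<Rightarrow> real" where
  "dens c x = sqrt \<bar>det (mat_of g0 c (cinv c x))\<bar>"

lemma dens_nonneg: "dens c x \<ge> 0" by (simp add: dens_def)

lemma dens_pos: "c \<in> A \<Longrightarrow> x \<in> cran c \<Longrightarrow> dens c x > 0"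
  using nondegenerate[of c "cinv c x"] cinv_cdom[of x c] by (simp add: dens_def)

lemma smooth_dens:
  assumes "c \<in> A"
  shows "smooth_on (cran c) (dens c)"
proof -
  let ?d = "\<lambda>x. det (mat_of g0 c (cinv c x))"
  have o: "open (cran c)" by (rule open_cran[OF assms])
  have d: "smooth_on (cran c) ?d"
    by (rule smooth_on_det[OF o]) (use smooth assms idx_2 in \<open>simp add: mat_of_def smooth_comps_def\<close>)
  have p: "?d x * ?d x > 0" if "x \<in> cran c" for x
    using nondegenerate[OF assms, of "cinv c x"] cinv_cdom[OF that] by (simp add: zero_less_mult_iff linorder_neq_iff) linarith
  have p': "sqrt (?d x * ?d x) > 0" if "x \<in> cran c" for x by (rule real_sqrt_gt_zero[OF p[OF that]])
  have "smooth_on (cran c) (\<lambda>x. sqrt (sqrt (?d x * ?d x)))"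
    by (rule smooth_on_sqrt[OF o smooth_on_sqrt[OF o smooth_on_mult[OF o d d] p] p'])
  then show ?thesis unfolding dens_def[abs_def] sqrt_abs_eq .
qed

definition vol :: "'a chart \<Rightarrow> 'a set \<Rightarrow> ennreal" where
  "vol c S = (\<integral>\<^sup>+x. ennreal (indicator (crd c ` S) x * dens c x) \<partial>lborel)"

lemma vol_alt: "vol c S = (\<integral>\<^sup>+x\<in>crd c ` S. ennreal (sqrt \<bar>det (mat_of g0 c (cinv c x))\<bar>) \<partial>lborel)"
  unfolding vol_def by (intro nn_integral_cong) (simp add: dens_def indicator_def)

lemma measurable_dens:
  assumes "c \<in> A" "S \<in> sets BX" "S \<subseteq> cdom c"
  shows "(\<lambda>x. indicator (crd c ` S) x * dens c x) \<in> borel_measurable borel"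
proof -
  have "continuous_on (crd c ` S) (dens c)"
    using continuous_on_subset[OF smooth_on_imp_continuous_on[OF smooth_dens[OF assms(1)]]] assms(3) by blast
  from borel_measurable_continuous_on_indicator[OF image_crd_borel[OF assms] this] show ?thesis by simp
qed

text \<open>The determinant of the metric changes by the squared Jacobian determinant, so the
  density changes by its absolute value, exactly the factor in the change of variables
  formula.\<close>

lemma vol_chart_independent:
  assumes c: "c \<in> A" and d: "d \<in> A" and S: "S \<in> sets BX" "S \<subseteq> cdom c" "S \<subseteq> cdom d"
  shows "vol c S = vol d S"
proof -
  have tr: "dens c x = \<bar>det (matrix (Dtr c d (cinv c x)))\<bar> * dens d ((crd d \<circ> cinv c) x)" if x: "x \<in> crd c ` S" for x
  proof -
    obtain p where p: "p \<in> S" "x = crd c p" using x by blast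
    then have q: "p \<in> cdom c" "p \<in> cdom d" using S by auto
    have i: "cinv c x = p" "cinv d ((crd d \<circ> cinv c) x) = p"
      using p by (simp_all add: cinv_crd[OF c q(1)] cinv_crd[OF d q(2)])
    have "det (mat_of g0 c p) = (det (matrix (Dtr c d p)))\<^sup>2 * det (mat_of g0 d p)"
      by (rule det_mat_of[OF cov c d q])
    then show ?thesis unfolding dens_def i by (simp add: abs_mult real_sqrt_mult)
  qed
  have eq: "(\<lambda>x. indicator (crd c ` S) x * (\<bar>det (matrix (Dtr c d (cinv c x)))\<bar> * dens d ((crd d \<circ> cinv c) x)))
      = (\<lambda>x. indicator (crd c ` S) x * dens c x)"
    by (rule ext) (simp add: indicator_def tr)
  have "(\<integral>\<^sup>+x. ennreal (indicator (crd c ` S) x * (\<bar>det (matrix (Dtr c d (cinv c x)))\<bar> * dens d ((crd d \<circ> cinv c) x))) \<partial>lborel)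
    = (\<integral>\<^sup>+x. ennreal (indicator (crd d ` S) x * dens d x) \<partial>lborel)"
  proof (rule nn_integral_change_of_variables[where h = "crd c \<circ> cinv d" and h' = "\<lambda>y. Dtr d c (cinv d y)"])
    show "(crd d \<circ> cinv c has_derivative Dtr c d (cinv c x)) (at x within crd c ` S)" if x: "x \<in> crd c ` S" for x
    proof -
      obtain p where p: "p \<in> S" "x = crd c p" using x by blast
      have "p \<in> cdom c \<inter> cdom d" using p S by blast
      from has_derivative_at_withinI[OF has_derivative_transition[OF c d this]]
      show ?thesis using p S c by (simp add: cinv_crd subset_iff)
    qed
    show "(crd c \<circ> cinv d has_derivative Dtr d c (cinv d y)) (at y within crd d ` S)" if x: "y \<in> crd d ` S" for y
    proof -
      obtain p where p: "p \<in> S" "y = crd d p" using x by blast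
      have "p \<in> cdom d \<inter> cdom c" using p S by blast
      from has_derivative_at_withinI[OF has_derivative_transition[OF d c this]]
      show ?thesis using p S d by (simp add: cinv_crd subset_iff)
    qed
    show "0 \<le> dens d y" for y by (rule dens_nonneg)
    show "(crd d \<circ> cinv c) x \<in> crd d ` S \<and> (crd c \<circ> cinv d) ((crd d \<circ> cinv c) x) = x" if x: "x \<in> crd c ` S" for x
    proof -
      obtain p where p: "p \<in> S" "x = crd c p" using x by blast
      then show ?thesis using S c d by (simp add: cinv_crd subset_iff)
    qed
    show "(crd c \<circ> cinv d) y \<in> crd c ` S \<and> (crd d \<circ> cinv c) ((crd c \<circ> cinv d) y) = y" if x: "y \<in> crd d ` S" for y
    proof -
      obtain p where p: "p \<in> S" "y = crd d p" using x by blast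
      then show ?thesis using S c d by (simp add: cinv_crd subset_iff)
    qed
    show "Dtr d c (cinv d y) \<circ> Dtr c d (cinv c ((crd c \<circ> cinv d) y)) = id" if x: "y \<in> crd d ` S" for y
    proof -
      obtain p where p: "p \<in> S" "y = crd d p" using x by blast
      then have q: "p \<in> cdom c" "p \<in> cdom d" using S by auto
      have "Dtr d c p \<circ> Dtr c d p = id"
        using Dtr_chain[OF c d c q(1) q(2) q(1)] Dtr_same[OF c q(1)] by simp
      then show ?thesis using p q c d by (simp add: cinv_crd)
    qed
    show "(\<lambda>x. indicator (crd d ` S) x * dens d x) \<in> borel_measurable borel"
      by (rule measurable_dens[OF d S(1,3)])
    show "(\<lambda>x. indicator (crd c ` S) x * (\<bar>det (matrix (Dtr c d (cinv c x)))\<bar> * dens d ((crd d \<circ> cinv c) x))) \<in> borel_measurable borel"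
      unfolding eq by (rule measurable_dens[OF c S(1,2)])
  qed
  then show ?thesis unfolding vol_def fun_cong[OF eq] .
qed

lemma vol_suminf:
  assumes c: "c \<in> A" and F: "\<And>n. F n \<in> sets BX" "\<And>n. F n \<subseteq> cdom c" "disjoint_family F"
  shows "vol c (\<Union>n. F n) = (\<Sum>n::nat. vol c (F n))"
proof -
  have "(\<Sum>n. vol c (F n)) = (\<integral>\<^sup>+x. (\<Sum>n. ennreal (indicator (crd c ` F n) x * dens c x)) \<partial>lborel)"
    unfolding vol_def
    by (rule nn_integral_suminf[symmetric]) (use measurable_dens[OF c F(1,2)] in simp)
  also have "\<dots> = vol c (\<Union>n. F n)"
    unfolding vol_def
  proof (rule nn_integral_cong)
    fix x
    have dj: "disjoint_family (\<lambda>n. crd c ` F n)"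
      unfolding disjoint_family_on_def
    proof (intro ballI impI)
      fix m n :: nat assume "m \<noteq> n"
      then have "F m \<inter> F n = {}" using F(3) by (simp add: disjoint_family_on_def)
      then show "crd c ` F m \<inter> crd c ` F n = {}"
        using inj_on_image_Int[OF inj_crd[OF c] F(2)[of m] F(2)[of n]] by simp
    qed
    have "(\<Sum>n. ennreal (indicator (crd c ` F n) x * dens c x)) = (\<Sum>n. indicator (crd c ` F n) x) * ennreal (dens c x)"
      unfolding ennreal_suminf_multc[symmetric] by (intro suminf_cong) (simp add: indicator_def)
    also have "(\<Sum>n. indicator (crd c ` F n) x) = (indicator (\<Union>n. crd c ` F n) x :: ennreal)"
      by (rule suminf_indicator[OF dj])
    also have "(indicator (\<Union>n. crd c ` F n) x :: ennreal) * ennreal (dens c x) = ennreal (indicator (crd c ` (\<Union>n. F n)) x * dens c x)"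
      by (simp add: indicator_def image_UN)
    finally show "(\<Sum>n. ennreal (indicator (crd c ` F n) x * dens c x)) = ennreal (indicator (crd c ` (\<Union>n. F n)) x * dens c x)" .
  qed
  finally show ?thesis ..
qed

section \<open>Gluing the chart volumes to one measure\<close>

lemma ex_countable_atlas: "\<exists>C :: nat \<Rightarrow> 'a chart. range C \<subseteq> A \<and> (\<Union>n. cdom (C n)) = topspace X"
proof -
  have L: "Lindelof_space X"
    using manifold by (intro second_countable_imp_Lindelof_space) (simp add: manifold4_def)
  have O: "openin X W" if "W \<in> cdom ` A" for W using that openin_cdom by auto
  have U: "\<Union>(cdom ` A) = topspace X" using manifold by (simp add: manifold4_def smooth_atlas_def)
  have "\<exists>V. countable V \<and> V \<subseteq> cdom ` A \<and> \<Union>V = topspace X"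
    by (rule Lindelof_spaceD[OF L O U])
  then obtain V where V: "countable V" "V \<subseteq> cdom ` A" "\<Union>V = topspace X"
    by (elim exE conjE)
  obtain A' where A': "countable A'" "A' \<subseteq> A" "V = cdom ` A'"
    using iffD1[OF countable_subset_image[of V cdom A]] V(1,2) by auto
  \<comment> \<open>Adding one chart makes the countable subatlas nonempty, so that a sequence can
    enumerate it, with repetitions if it is finite.\<close>
  obtain c0 where c0: "c0 \<in> A" using A_nonempty by blast
  have ne: "insert c0 A' \<noteq> {}" "countable (insert c0 A')" using A' by auto
  define C where "C = from_nat_into (insert c0 A')"
  have r: "range C = insert c0 A'" unfolding C_def by (rule range_from_nat_into[OF ne])
  have u: "(\<Union>n. cdom (C n)) = topspace X"
  proof -
    have "(\<Union>n. cdom (C n)) = \<Union>(cdom ` range C)" by (simp add: image_image)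
    also have "\<dots> = topspace X" unfolding r using V A' cdom_subset[OF c0] by auto
    finally show ?thesis .
  qed
  show ?thesis by (rule exI[of _ C]) (use r u A' c0 in simp)
qed

definition Cn :: "nat \<Rightarrow> 'a chart" where
  "Cn = (SOME C. range C \<subseteq> A \<and> (\<Union>n. cdom (C n)) = topspace X)"

lemma Cn: "Cn n \<in> A" "(\<Union>n. cdom (Cn n)) = topspace X"
  using someI_ex[OF ex_countable_atlas] unfolding Cn_def[symmetric] by auto

definition Bn :: "nat \<Rightarrow> 'a set" where
  "Bn = disjointed (\<lambda>n. cdom (Cn n))"

lemma Bn: "Bn n \<in> sets BX" "Bn n \<subseteq> cdom (Cn n)" "disjoint_family Bn" "(\<Union>n. Bn n) = topspace X"
proof -
  have "range (\<lambda>n. cdom (Cn n)) \<subseteq> sets BX" using openin_sets openin_cdom Cn(1) by blast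
  then have "range Bn \<subseteq> sets BX" unfolding Bn_def by (rule sets.range_disjointed_sets)
  then show "Bn n \<in> sets BX" by blast
  show "Bn n \<subseteq> cdom (Cn n)" unfolding Bn_def by (rule disjointed_subset)
  show "disjoint_family Bn" unfolding Bn_def by (rule disjoint_family_disjointed)
  show "(\<Union>n. Bn n) = topspace X" unfolding Bn_def UN_disjointed_eq by (rule Cn(2))
qed

text \<open>Each disjoint piece lies in one chart and is measured there. Countable additivity is
  immediate from this form; that the cut does not matter is \<open>volm_chart\<close>.\<close>

definition volm :: "'a set \<Rightarrow> ennreal" where
  "volm S = (\<Sum>n. vol (Cn n) (S \<inter> Bn n))"

text \<open>Interchange of an integral over the counting measure with a sum of nonnegative
  functions.\<close>

lemma suminf_swap_ennreal: "(\<Sum>n::nat. \<Sum>i::nat. f n i) = (\<Sum>i. \<Sum>n. f n i)" for f :: "nat \<Rightarrow> nat \<Rightarrow> ennreal"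
proof -
  have "(\<Sum>n. \<Sum>i. f n i) = (\<integral>\<^sup>+n. (\<Sum>i. f n i) \<partial>count_space UNIV)" by (simp add: nn_integral_count_space_nat)
  also have "\<dots> = (\<Sum>i. \<integral>\<^sup>+n. f n i \<partial>count_space UNIV)" by (rule nn_integral_suminf) simp
  finally show ?thesis by (simp add: nn_integral_count_space_nat)
qed

definition nu :: "'a measure" where
  "nu = measure_of (topspace X) {U. openin X U} volm"

lemma emeasure_nu: "S \<in> sets BX \<Longrightarrow> emeasure nu S = volm S"
proof (rule emeasure_measure_of[OF nu_def openin_Pow])
  assume "S \<in> sets BX"
  show setsnu: "S \<in> sets nu" using \<open>S \<in> sets BX\<close> by (simp add: nu_def sets_BX sets_measure_of openin_Pow)
  have eqs: "sets nu = sets BX" by (simp add: nu_def sets_BX sets_measure_of openin_Pow)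
  show "positive (sets nu) volm" by (simp add: positive_def volm_def vol_def)
  show "countably_additive (sets nu) volm"
    unfolding countably_additive_def eqs
  proof (intro allI impI)
    fix F :: "nat \<Rightarrow> 'a set" assume F: "range F \<subseteq> sets BX" "disjoint_family F" "(\<Union>i. F i) \<in> sets BX"
    have "vol (Cn n) ((\<Union>i. F i) \<inter> Bn n) = (\<Sum>i. vol (Cn n) (F i \<inter> Bn n))" for n
    proof -
      have "(\<Union>i. F i) \<inter> Bn n = (\<Union>i. F i \<inter> Bn n)" by blast
      moreover have "vol (Cn n) (\<Union>i. F i \<inter> Bn n) = (\<Sum>i. vol (Cn n) (F i \<inter> Bn n))"
      proof (rule vol_suminf[OF Cn(1)])
        show "F i \<inter> Bn n \<in> sets BX" for i using F(1) Bn(1) by blast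
        show "F i \<inter> Bn n \<subseteq> cdom (Cn n)" for i using Bn(2)[of n] by blast
        show "disjoint_family (\<lambda>i. F i \<inter> Bn n)" using F(2) by (fastforce simp: disjoint_family_on_def)
      qed
      ultimately show ?thesis by simp
    qed
    then show "(\<Sum>i. volm (F i)) = volm (\<Union>i. F i)"
      unfolding volm_def by (simp add: suminf_swap_ennreal[of "\<lambda>n i. vol (Cn n) (F i \<inter> Bn n)"])
  qed
qed

lemma space_nu: "space nu = topspace X" by (simp add: nu_def space_measure_of openin_Pow)
lemma sets_nu: "sets nu = sets BX" by (simp add: nu_def sets_BX sets_measure_of openin_Pow)

lemma Bn_decomposition:
  assumes "S \<in> sets BX"
  shows "S \<inter> Bn n \<in> sets BX" "disjoint_family (\<lambda>n. S \<inter> Bn n)" "(\<Union>n. S \<inter> Bn n) = S"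
proof -
  show "S \<inter> Bn n \<in> sets BX" using assms Bn(1) by blast
  show "disjoint_family (\<lambda>n. S \<inter> Bn n)" using Bn(3) by (fastforce simp: disjoint_family_on_def)
  have "S \<subseteq> topspace X" using sets.sets_into_space[OF assms] by simp
  then show "(\<Union>n. S \<inter> Bn n) = S" using Bn(4) by blast
qed

lemma volm_chart:
  assumes c: "c \<in> A" and S: "S \<in> sets BX" "S \<subseteq> cdom c"
  shows "volm S = vol c S"
proof -
  have "vol (Cn n) (S \<inter> Bn n) = vol c (S \<inter> Bn n)" for n
    by (rule vol_chart_independent[OF Cn(1) c]) (use Bn(2)[of n] S Bn_decomposition(1)[OF S(1)] in auto)
  then have "volm S = (\<Sum>n. vol c (S \<inter> Bn n))" by (simp add: volm_def)
  also have "\<dots> = vol c (\<Union>n. S \<inter> Bn n)"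
    by (rule vol_suminf[symmetric, OF c]) (use Bn_decomposition[OF S(1)] S(2) in auto)
  finally show ?thesis using Bn_decomposition(3)[OF S(1)] by simp
qed

lemma is_volume_iff:
  "is_volume X A g0 \<nu> \<longleftrightarrow> space \<nu> = topspace X \<and> sets \<nu> = sets BX \<and>
     (\<forall>c\<in>A. \<forall>S\<in>sets BX. S \<subseteq> cdom c \<longrightarrow> emeasure \<nu> S = vol c S)"
  unfolding is_volume_def vol_alt sets_BX by auto

lemma is_volume_nu: "is_volume X A g0 nu"
  unfolding is_volume_iff using space_nu sets_nu emeasure_nu volm_chart by auto

text \<open>The pieces \<open>S \<inter> Bn n\<close> lie in single charts, where the defining
  condition fixes their measure. With existence this resolves the definite description in
  \<open>volume\<close>.\<close>

lemma is_volume_unique: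
  assumes "is_volume X A g0 \<nu>"
  shows "\<nu> = nu"
proof (rule measure_eqI)
  have s: "sets \<nu> = sets BX" using assms by (simp add: is_volume_iff)
  show "sets \<nu> = sets nu" using s sets_nu by simp
  fix S assume "S \<in> sets \<nu>"
  then have S: "S \<in> sets BX" using s by simp
  note D = Bn_decomposition[OF S]
  have "emeasure \<nu> (S \<inter> Bn n) = vol (Cn n) (S \<inter> Bn n)" for n
    using assms Cn(1)[of n] D(1)[of n] Bn(2)[of n] unfolding is_volume_iff by (meson inf_le2 order_trans)
  moreover have "(\<Sum>n. emeasure \<nu> (S \<inter> Bn n)) = emeasure \<nu> (\<Union>n. S \<inter> Bn n)"
    by (rule suminf_emeasure) (use D s in auto)
  ultimately have "emeasure \<nu> S = volm S" using D(3) by (simp add: volm_def)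
  then show "emeasure \<nu> S = emeasure nu S" using emeasure_nu[OF S] by simp
qed

lemma volume_eq: "volume X A g0 = nu"
  unfolding volume_def using is_volume_nu is_volume_unique by (rule the_equality)

text \<open>Restricted to the chart domain and pushed forward by the coordinates, the volume is
  Lebesgue measure with density \<open>dens c\<close>; the integrand lives in that domain
  only.\<close>

lemma integral_volume:
  assumes c: "c \<in> A" and w: "w \<in> borel_measurable borel"
    and u: "\<And>p. p \<in> cdom c \<Longrightarrow> u p = w (crd c p)" "\<And>p. p \<in> topspace X - cdom c \<Longrightarrow> u p = 0"
  shows "(\<integral>p. u p \<partial>volume X A g0) = (\<integral>x. indicator (cran c) x * dens c x * w x \<partial>lborel)"
proof -
  have dm: "(\<lambda>x. indicator (cran c) x * dens c x) \<in> borel_measurable borel"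
    by (rule measurable_dens[OF c openin_sets[OF openin_cdom[OF c]] subset_refl])
  have cd: "cdom c \<in> sets nu" unfolding sets_nu by (rule openin_sets[OF openin_cdom[OF c]])
  have "cdom c \<inter> space nu = cdom c" using cdom_subset[OF c] by (simp add: space_nu Int_absorb2)
  with cd have ci: "cdom c \<inter> space nu \<in> sets nu" by simp
  have meas: "crd c \<in> measurable (restrict_space nu (cdom c)) borel"
  proof (rule borel_measurableI)
    fix V :: "(real^4) set" assume "open V"
    then have "open (V \<inter> cran c)" using open_cran[OF c] by auto
    then have "openin X (cinv c ` (V \<inter> cran c))" by (intro openin_image_cinv c) auto
    moreover have "cinv c ` (V \<inter> cran c) = crd c -` V \<inter> cdom c"
    proof
      show "cinv c ` (V \<inter> cran c) \<subseteq> crd c -` V \<inter> cdom c" by (auto simp: cinv_crd[OF c])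
      show "crd c -` V \<inter> cdom c \<subseteq> cinv c ` (V \<inter> cran c)"
      proof
        fix p assume "p \<in> crd c -` V \<inter> cdom c"
        then show "p \<in> cinv c ` (V \<inter> cran c)" by (intro image_eqI[of _ _ "crd c p"]) (auto simp: cinv_crd[OF c])
      qed
    qed
    ultimately have "crd c -` V \<inter> cdom c \<in> sets nu" unfolding sets_nu using openin_sets by simp
    moreover have "space (restrict_space nu (cdom c)) = cdom c"
      using cdom_subset[OF c] by (auto simp: space_restrict_space space_nu)
    ultimately show "crd c -` V \<inter> space (restrict_space nu (cdom c)) \<in> sets (restrict_space nu (cdom c))"
      by (simp add: sets_restrict_space_iff[OF ci])
  qed
  have "distr (restrict_space nu (cdom c)) borel (crd c) = density lborel (\<lambda>x. ennreal (indicator (cran c) x * dens c x))"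
  proof (rule measure_eqI)
    fix V assume "V \<in> sets (distr (restrict_space nu (cdom c)) borel (crd c))"
    then have V: "V \<in> sets borel" by simp
    let ?S = "crd c -` V \<inter> cdom c"
    have sp: "space (restrict_space nu (cdom c)) = cdom c"
      using cdom_subset[OF c] by (auto simp: space_restrict_space space_nu)
    have "?S \<in> sets (restrict_space nu (cdom c))" using measurable_sets[OF meas V] sp by simp
    then have S: "?S \<in> sets BX" by (simp add: sets_restrict_space_iff[OF ci] sets_nu)
    have "emeasure (distr (restrict_space nu (cdom c)) borel (crd c)) V = emeasure (restrict_space nu (cdom c)) ?S"
      using emeasure_distr[OF meas V] sp by simp
    also have "\<dots> = emeasure nu ?S"
      by (rule emeasure_restrict_space[OF ci]) auto
    also have "\<dots> = vol c ?S" using emeasure_nu[OF S] volm_chart[OF c S] by simp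
    also have "\<dots> = (\<integral>\<^sup>+x. ennreal (indicator (cran c) x * dens c x) * indicator V x \<partial>lborel)"
      unfolding vol_def
    proof (rule nn_integral_cong)
      fix x
      have "x \<in> crd c ` ?S \<longleftrightarrow> x \<in> cran c \<and> x \<in> V" by blast
      then show "ennreal (indicator (crd c ` ?S) x * dens c x) = ennreal (indicator (cran c) x * dens c x) * indicator V x"
        by (simp add: indicator_def)
    qed
    also have "\<dots> = emeasure (density lborel (\<lambda>x. ennreal (indicator (cran c) x * dens c x))) V"
      by (rule emeasure_density[symmetric]) (use dm V in auto)
    finally show "emeasure (distr (restrict_space nu (cdom c)) borel (crd c)) V
      = emeasure (density lborel (\<lambda>x. ennreal (indicator (cran c) x * dens c x))) V" .
  qed simp
  note dist = this
  have "(\<integral>p. u p \<partial>nu) = (\<integral>p. indicator (cdom c) p *\<^sub>R w (crd c p) \<partial>nu)"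
    by (rule Bochner_Integration.integral_cong) (use u in \<open>auto simp: space_nu indicator_def\<close>)
  also have "\<dots> = (\<integral>p. w (crd c p) \<partial>restrict_space nu (cdom c))"
    by (rule integral_restrict_space[symmetric, OF ci])
  also have "\<dots> = (\<integral>x. w x \<partial>distr (restrict_space nu (cdom c)) borel (crd c))"
    by (rule integral_distr[symmetric, OF meas w])
  also have "\<dots> = (\<integral>x. w x \<partial>density lborel (\<lambda>x. ennreal (indicator (cran c) x * dens c x)))"
    by (simp only: dist)
  also have "\<dots> = (\<integral>x. (indicator (cran c) x * dens c x) *\<^sub>R w x \<partial>lborel)"
    by (rule integral_density) (use w dm dens_nonneg in \<open>auto simp: indicator_def\<close>)
  finally show ?thesis by (simp add: volume_eq)
qed

end

subsection \<open>Weak limits in a chart\<close>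

context smooth_manifold
begin

lemma smooth_component:
  "smooth_cov_tensor A 2 T \<Longrightarrow> c \<in> A \<Longrightarrow> smooth_on (cran c) (\<lambda>x. T c (cinv c x) [i, j])"
  using idx_2 by (simp add: smooth_cov_tensor_def smooth_comps_def)

text \<open>The tensor field whose only nonzero component in the chart \<open>c\<close> is \<open>\<psi>\<close> at position \<open>a b\<close>.\<close>

definition test_field :: "'a chart \<Rightarrow> (real^4 \<Rightarrow> real) \<Rightarrow> 4 \<Rightarrow> 4 \<Rightarrow> 'a tfield" where
  "test_field c \<psi> a b = (\<lambda>d p I.
     if p \<in> cdom c then jac c d p (I ! 0) a * jac c d p (I ! 1) b * \<psi> (crd c p) else 0)"

text \<open>In any other chart the components are the image of one coordinate basis element of
  \<open>c\<close>, so the transformation law is the chain rule for \<open>jac\<close>.\<close>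

lemma contra_test_field:
  assumes c: "c \<in> A"
  shows "contra_tensor A 2 (test_field c \<psi> a b)"
  unfolding contra_tensor_def
proof (intro ballI)
  fix d e p I assume d: "d \<in> A" and e: "e \<in> A" and p: "p \<in> cdom d \<inter> cdom e" and "I \<in> idx 2"
  then obtain i j where I: "I = [i, j]" by (elim idx_2_cases)
  show "test_field c \<psi> a b e p I = (\<Sum>J\<in>idx 2. (\<Prod>m<2. jac d e p (I ! m) (J ! m)) * test_field c \<psi> a b d p J)"
  proof (cases "p \<in> cdom c")
    case True
    have "test_field c \<psi> a b e p I = jac c e p i a * jac c e p j b * \<psi> (crd c p)"
      using True by (simp add: test_field_def I)
    also have "\<dots> = (\<Sum>k\<in>UNIV. jac d e p i k * jac c d p k a) * (\<Sum>m\<in>UNIV. jac d e p j m * jac c d p m b) * \<psi> (crd c p)"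
      using jac_chain[OF c d e True, of i a] jac_chain[OF c d e True, of j b] p by simp
    also have "\<dots> = (\<Sum>k\<in>UNIV. \<Sum>m\<in>UNIV. jac d e p i k * jac d e p j m * test_field c \<psi> a b d p [k, m])"
      unfolding sum_product unfolding sum_distrib_right using True
      by (intro sum.cong refl) (simp add: test_field_def mult_ac)
    finally show ?thesis by (simp only: I sum_idx_2 prod_jac_2)
  qed (simp add: test_field_def)
qed

lemma test_field_zero:
  assumes c: "c \<in> A" and z: "\<And>x. x \<notin> K \<Longrightarrow> \<psi> x = 0" and p: "p \<notin> cinv c ` K"
  shows "test_field c \<psi> a b d p I = 0"
proof (cases "p \<in> cdom c")
  case True
  then have "crd c p \<notin> K" using p cinv_crd[OF c True] by (metis image_eqI)
  then show ?thesis by (simp add: test_field_def z)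
qed (simp add: test_field_def)

lemma smooth_jac:
  assumes c: "c \<in> A" and d: "d \<in> A"
  shows "smooth_on (crd d ` (cdom d \<inter> cdom c)) (\<lambda>y. jac c d (cinv d y) i a)"
proof -
  let ?T = "crd d ` (cdom d \<inter> cdom c)" and ?V = "crd c ` (cdom c \<inter> cdom d)"
  have oT: "open ?T" and oV: "open ?V" using open_overlap c d by auto
  have "smooth_on ?V (\<lambda>x. (crd d \<circ> cinv c) x $ i)"
    by (rule smooth_on_bounded_linear[OF oV bounded_linear_vec_nth smooth_transition[OF c d]])
  then have sV: "smooth_on ?V (partial a (\<lambda>x. (crd d \<circ> cinv c) x $ i))" by (rule smooth_on_partial)
  have im: "(crd c \<circ> cinv d) ` ?T \<subseteq> ?V" using d by (auto simp: cinv_crd)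
  have "smooth_on ?T (\<lambda>y. partial a (\<lambda>x. (crd d \<circ> cinv c) x $ i) ((crd c \<circ> cinv d) y))"
    by (rule smooth_on_compose[OF oT oV im smooth_transition[OF d c] sV])
  then show ?thesis by (simp add: jac_def pd_def partial_def comp_def)
qed

text \<open>Smoothness is checked near each point of each chart \<open>d\<close>: within the domain
  of \<open>c\<close> the components are explicit, and elsewhere the field vanishes nearby.\<close>

lemma test_tensor_field:
  assumes c: "c \<in> A" and K: "compact K" "K \<subseteq> cran c"
    and \<psi>: "smooth_on UNIV \<psi>" and z: "\<And>x. x \<notin> K \<Longrightarrow> \<psi> x = 0"
  shows "test_tensor X A 2 (test_field c \<psi> a b)"
  unfolding test_tensor_def
proof (intro conjI contra_test_field c)
  let ?K = "cinv c ` K"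
  have cK: "compactin X ?K" by (rule compactin_image_cinv[OF c K])
  show "\<exists>K. compactin X K \<and> (\<forall>d\<in>A. \<forall>p\<in>cdom d - K. \<forall>I\<in>idx 2. test_field c \<psi> a b d p I = 0)"
    by (rule exI[of _ ?K]) (use cK test_field_zero[OF c z, of K] in auto)
  show "smooth_comps A 2 (test_field c \<psi> a b)"
    unfolding smooth_comps_def
  proof (intro ballI smooth_on_local)
    fix d I x assume d: "d \<in> A" and I: "I \<in> idx 2" and x: "x \<in> cran d"
    show "\<exists>T. open T \<and> x \<in> T \<and> smooth_on T (\<lambda>x. test_field c \<psi> a b d (cinv d x) I)"
    proof (cases "cinv d x \<in> cdom c")
      case True
      let ?T = "crd d ` (cdom d \<inter> cdom c)"
      have oT: "open ?T" by (rule open_overlap[OF d c])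
      have xT: "x \<in> ?T"
        using True cinv_cdom[OF x] crd_cinv[OF x] by (intro image_eqI[of _ _ "cinv d x"]) auto
      have "smooth_on ?T (\<lambda>y. \<psi> ((crd c \<circ> cinv d) y))"
        by (rule smooth_on_compose[OF oT open_UNIV subset_UNIV smooth_transition[OF d c] \<psi>])
      then have "smooth_on ?T (\<lambda>y. jac c d (cinv d y) (I ! 0) a * jac c d (cinv d y) (I ! 1) b * \<psi> ((crd c \<circ> cinv d) y))"
        by (intro smooth_on_mult oT smooth_jac c d)
      then have "smooth_on ?T (\<lambda>x. test_field c \<psi> a b d (cinv d x) I)"
        by (rule smooth_on_cong[OF oT, rotated]) (use d in \<open>auto simp: test_field_def cinv_crd\<close>)
      then show ?thesis using oT xT by (intro exI[of _ ?T]) simp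
    next
      case False
      \<comment> \<open>The support is closed because a compact set in a Hausdorff space is, so its
        complement is an open neighbourhood of the point.\<close>
      let ?W = "topspace X - ?K"
      let ?T = "crd d ` (?W \<inter> cdom d)"
      have oW: "openin X ?W" using closedin_compact[OF cK] by (simp add: openin_diff)
      have oT: "open ?T" by (rule open_image_crd[OF d oW])
      have "cinv c ` K \<subseteq> cdom c" using K(2) by (intro image_subsetI cinv_cdom) auto
      then have "cinv d x \<in> ?W \<inter> cdom d" using False cinv_cdom[OF x] cdom_subset[OF d] by auto
      then have xT: "x \<in> ?T" using crd_cinv[OF x] by (intro image_eqI[of _ _ "cinv d x"]) simp_all
      have "smooth_on ?T (\<lambda>x. test_field c \<psi> a b d (cinv d x) I)"
      proof (rule smooth_on_cong[OF oT _ smooth_on_const[of _ 0]])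
        fix y assume "y \<in> ?T"
        then obtain q where "q \<in> ?W" "q \<in> cdom d" "y = crd d q" by blast
        then have "cinv d y \<notin> ?K" using cinv_crd[OF d] by simp
        then show "0 = test_field c \<psi> a b d (cinv d y) I" using test_field_zero[OF c z, of K] by simp
      qed
      then show ?thesis using oT xT by (intro exI[of _ ?T]) simp
    qed
  qed
qed

text \<open>\<open>contract\<close> evaluates in some unspecified chart \<open>d\<close>; expanding
  the component of \<open>T\<close> in \<open>c\<close> by the tensor law gives the same sum over
  components in \<open>d\<close>.\<close>

lemma contract_test_field:
  assumes c: "c \<in> A" and T: "cov_tensor A 2 T" and p: "p \<in> topspace X"
  shows "contract A 2 (test_field c \<psi> a b) T p = (if p \<in> cdom c then \<psi> (crd c p) * T c p [a, b] else 0)"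
proof -
  define d where "d = (SOME d. d \<in> A \<and> p \<in> cdom d)"
  have d: "d \<in> A" "p \<in> cdom d"
    using someI_ex[of "\<lambda>d. d \<in> A \<and> p \<in> cdom d"] ex_chart[OF p] unfolding d_def[symmetric] by blast+
  have "contract A 2 (test_field c \<psi> a b) T p = (\<Sum>i\<in>UNIV. \<Sum>j\<in>UNIV. test_field c \<psi> a b d p [i, j] * T d p [i, j])"
    by (simp only: contract_def Let_def d_def[symmetric] sum_idx_2)
  also have "\<dots> = (if p \<in> cdom c then \<psi> (crd c p) * T c p [a, b] else 0)"
  proof (cases "p \<in> cdom c")
    case True
    show ?thesis
      unfolding cov_tensor_2[OF T c d(1) True d(2)] sum_distrib_left using True
      by (simp add: test_field_def mult_ac)
  qed (simp add: test_field_def)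
  finally show ?thesis .
qed

end

context spacetime
begin

lemma integral_contract_test_field:
  assumes c: "c \<in> A" and K: "compact K" "K \<subseteq> cran c"
    and \<psi>: "smooth_on UNIV \<psi>" and z: "\<And>x. x \<notin> K \<Longrightarrow> \<psi> x = 0" and T: "smooth_cov_tensor A 2 T"
  shows "(\<integral>p. contract A 2 (test_field c \<psi> a b) T p \<partial>volume X A g0)
    = (\<integral>x. \<psi> x * dens c x * T c (cinv c x) [a, b] \<partial>lborel)"
proof -
  have "smooth_on UNIV (\<lambda>x. \<psi> x * T c (cinv c x) [a, b])"
    by (rule smooth_on_times_support[OF open_cran[OF c] K \<psi> z smooth_component[OF T c]])
  then have w: "(\<lambda>x. \<psi> x * T c (cinv c x) [a, b]) \<in> borel_measurable borel"
    by (intro borel_measurable_continuous_onI smooth_on_imp_continuous_on)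
  have cT: "cov_tensor A 2 T" using T by (simp add: smooth_cov_tensor_def)
  have "(\<integral>p. contract A 2 (test_field c \<psi> a b) T p \<partial>volume X A g0)
      = (\<integral>x. indicator (cran c) x * dens c x * (\<psi> x * T c (cinv c x) [a, b]) \<partial>lborel)"
  proof (rule integral_volume[OF c w])
    show "contract A 2 (test_field c \<psi> a b) T p = \<psi> (crd c p) * T c (cinv c (crd c p)) [a, b]" if "p \<in> cdom c" for p
      using contract_test_field[OF c cT, of p] that cdom_subset[OF c] cinv_crd[OF c that] by auto
    show "contract A 2 (test_field c \<psi> a b) T p = 0" if "p \<in> topspace X - cdom c" for p
      using contract_test_field[OF c cT, of p] that by auto
  qed
  also have "\<dots> = (\<integral>x. \<psi> x * dens c x * T c (cinv c x) [a, b] \<partial>lborel)"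
  proof (rule Bochner_Integration.integral_cong[OF refl])
    fix x
    show "indicator (cran c) x * dens c x * (\<psi> x * T c (cinv c x) [a, b]) = \<psi> x * dens c x * T c (cinv c x) [a, b]"
    proof (cases "x \<in> cran c")
      case False
      then have "x \<notin> K" using K(2) by blast
      then show ?thesis by (simp add: z)
    qed (simp add: indicator_def)
  qed
  finally show ?thesis .
qed

text \<open>The weak limit integrates against the volume of \<open>g0\<close>. Dividing the test
  function by the density, which is smooth and positive, turns this into Lebesgue measure in the
  chart.\<close>

lemma weak_limit_in_chart:
  assumes wl: "weak_limit X A g0 2 T T0"
    and T: "\<And>l. l > 0 \<Longrightarrow> smooth_cov_tensor A 2 (T l)" and T0: "smooth_cov_tensor A 2 T0"
    and c: "c \<in> A" and K: "compact K" "K \<subseteq> cran c"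
    and \<psi>: "smooth_on UNIV \<psi>" and z: "\<And>x. x \<notin> K \<Longrightarrow> \<psi> x = 0"
  shows "((\<lambda>l. \<integral>x. \<psi> x * T l c (cinv c x) [a, b] \<partial>lborel) \<longlongrightarrow> (\<integral>x. \<psi> x * T0 c (cinv c x) [a, b] \<partial>lborel)) (at_right 0)"
proof -
  define \<phi> where "\<phi> x = \<psi> x * inverse (dens c x)" for x
  have dp: "dens c x \<noteq> 0" if "x \<in> cran c" for x using dens_pos[OF c that] by simp
  have s: "smooth_on UNIV \<phi>" unfolding \<phi>_def[abs_def]
    by (rule smooth_on_times_support[OF open_cran[OF c] K \<psi> z
          smooth_on_inverse[OF open_cran[OF c] smooth_dens[OF c] dp]])
  have z': "\<phi> x = 0" if "x \<notin> K" for x using z[OF that] by (simp add: \<phi>_def)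
  have eq: "\<phi> x * dens c x = \<psi> x" for x
    using dp[of x] z[of x] K(2) by (cases "x \<in> cran c") (auto simp: \<phi>_def)
  have int: "(\<integral>p. contract A 2 (test_field c \<phi> a b) S p \<partial>volume X A g0) = (\<integral>x. \<psi> x * S c (cinv c x) [a, b] \<partial>lborel)"
    if S: "smooth_cov_tensor A 2 S" for S
  proof -
    have "(\<integral>p. contract A 2 (test_field c \<phi> a b) S p \<partial>volume X A g0) = (\<integral>x. \<phi> x * dens c x * S c (cinv c x) [a, b] \<partial>lborel)"
      by (rule integral_contract_test_field[OF c K s _ S]) (rule z')
    then show ?thesis by (simp only: eq)
  qed
  have "((\<lambda>l. \<integral>p. contract A 2 (test_field c \<phi> a b) (T l) p \<partial>volume X A g0)
      \<longlongrightarrow> (\<integral>p. contract A 2 (test_field c \<phi> a b) T0 p \<partial>volume X A g0)) (at_right 0)"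
    using wl test_tensor_field[OF c K s z'] unfolding weak_limit_def by (elim allE impE) assumption+
  then have lim: "((\<lambda>l. \<integral>p. contract A 2 (test_field c \<phi> a b) (T l) p \<partial>volume X A g0)
      \<longlongrightarrow> (\<integral>x. \<psi> x * T0 c (cinv c x) [a, b] \<partial>lborel)) (at_right 0)"
    by (simp only: int[OF T0])
  have ev: "\<forall>\<^sub>F l in at_right 0. (\<integral>p. contract A 2 (test_field c \<phi> a b) (T l) p \<partial>volume X A g0)
      = (\<integral>x. \<psi> x * T l c (cinv c x) [a, b] \<partial>lborel)"
    using eventually_at_right_less[of "0::real"] by eventually_elim (rule int[OF T])
  from Lim_transform_eventually[OF lim ev] show ?thesis .
qed

end

subsection \<open>Positive quadratic forms\<close>

text \<open>Completing the square removes one index at a time, so that no spectral decomposition is needed.\<close>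

lemma psd_trace_nonneg:
  fixes a b :: "'i \<Rightarrow> 'i \<Rightarrow> real"
  assumes "finite I" "\<And>i j. a i j = a j i"
    and "\<And>v. 0 \<le> (\<Sum>i\<in>I. \<Sum>j\<in>I. a i j * (v i * v j))"
    and "\<And>v. 0 \<le> (\<Sum>i\<in>I. \<Sum>j\<in>I. b i j * (v i * v j))"
  shows "0 \<le> (\<Sum>i\<in>I. \<Sum>j\<in>I. a i j * b i j)"
  using assms
proof (induction I arbitrary: a rule: finite_induct)
  case empty
  then show ?case by simp
next
  case (insert k I)
  note sym = insert.prems(1) and pa = insert.prems(2) and pb = insert.prems(3)
  have split: "(\<Sum>i\<in>insert k I. \<Sum>j\<in>insert k I. f i j)
      = f k k + (\<Sum>j\<in>I. f k j) + (\<Sum>i\<in>I. f i k) + (\<Sum>i\<in>I. \<Sum>j\<in>I. f i j)" for f :: "'i \<Rightarrow> 'i \<Rightarrow> real"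
    using insert.hyps by (simp add: sum.distrib)
  have ext: "(\<Sum>i\<in>insert k I. \<Sum>j\<in>insert k I. c i j * (w i * w j))
      = c k k * (t * t) + (\<Sum>j\<in>I. c k j * (t * v j)) + (\<Sum>i\<in>I. c i k * (v i * t)) + (\<Sum>i\<in>I. \<Sum>j\<in>I. c i j * (v i * v j))"
    if "w = v(k := t)" for c :: "'i \<Rightarrow> 'i \<Rightarrow> real" and v w t
  proof -
    have "w k = t" "\<And>i. i \<in> I \<Longrightarrow> w i = v i" using that insert.hyps by auto
    then show ?thesis unfolding split by (simp cong: sum.cong)
  qed
  have pbI: "0 \<le> (\<Sum>i\<in>I. \<Sum>j\<in>I. b i j * (v i * v j))" for v
    using pb[of "v(k := 0)"] ext[of "v(k := 0)" v 0 b] by simp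
  have quad: "0 \<le> a k k * (t * t) + 2 * t * (\<Sum>j\<in>I. a k j * v j) + (\<Sum>i\<in>I. \<Sum>j\<in>I. a i j * (v i * v j))" for v t
  proof -
    have "(\<Sum>i\<in>I. a i k * (v i * t)) = (\<Sum>j\<in>I. a k j * (t * v j))"
      by (intro sum.cong refl) (simp add: sym[of _ k] mult_ac)
    moreover have "(\<Sum>j\<in>I. a k j * (t * v j)) = t * (\<Sum>j\<in>I. a k j * v j)"
      by (simp add: sum_distrib_left mult_ac)
    ultimately show ?thesis using pa[of "v(k := t)"] ext[of "v(k := t)" v t a] by simp
  qed
  have akk: "a k k \<ge> 0" using quad[of 1 "\<lambda>_. 0"] by simp
  show ?case
  proof (cases "a k k = 0")
    case True
    have z: "a k j = 0" if j: "j \<in> I" for j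
    proof (rule ccontr)
      assume ne: "a k j \<noteq> 0"
      let ?v = "\<lambda>i. if i = j then 1 else (0::real)"
      have s1: "(\<Sum>i\<in>I. a k i * ?v i) = a k j"
        using insert.hyps(1) j by (simp add: if_distrib[of "\<lambda>t. _ * t"] cong: if_cong)
      have s2: "(\<Sum>i\<in>I. \<Sum>l\<in>I. a i l * (?v i * ?v l)) = a j j"
      proof -
        have "(\<Sum>i\<in>I. \<Sum>l\<in>I. a i l * (?v i * ?v l))
            = (\<Sum>i\<in>I. if i = j then (\<Sum>l\<in>I. if l = j then a i l else 0) else 0)"
          by (intro sum.cong refl) (auto intro: sum.cong)
        then show ?thesis using insert.hyps(1) j by simp
      qed
      \<comment> \<open>With a vanishing diagonal entry the form is affine in \<open>t\<close>; this
        value makes it equal to -1, contradicting nonnegativity.\<close>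
      define t where "t = - (a j j + 1) / (2 * a k j)"
      have "2 * t * a k j = - (a j j + 1)" using ne by (simp add: t_def)
      then show False using quad[of t ?v] s1 s2 True by simp
    qed
    have pI: "0 \<le> (\<Sum>i\<in>I. \<Sum>j\<in>I. a i j * (v i * v j))" for v using quad[of 0 v] True by simp
    have "0 \<le> (\<Sum>i\<in>I. \<Sum>j\<in>I. a i j * b i j)" by (rule insert.IH[OF sym pI pbI])
    moreover have z': "a j k = 0" if "j \<in> I" for j using z[OF that] sym[of j k] by simp
    ultimately show ?thesis unfolding split using True z by (simp cong: sum.cong)
  next
    case False
    then have kk: "a k k > 0" using akk by simp
    \<comment> \<open>The Schur complement of the entry \<open>a k k\<close>: its row and column
      \<open>k\<close> vanish, so the induction hypothesis applies to it on \<open>I\<close>, and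
      what was subtracted is a rank-one form.\<close>
    define a' where "a' i j = a i j - a i k * a k j / a k k" for i j
    have sym': "a' i j = a' j i" for i j by (simp add: a'_def sym[of i j] sym[of i k] sym[of k j] mult.commute)
    have sq: "(\<Sum>i\<in>I. \<Sum>j\<in>I. a i k * a k j / a k k * (v i * v j)) = (\<Sum>j\<in>I. a k j * v j)\<^sup>2 / a k k" for v
    proof -
      have "(\<Sum>j\<in>I. a k j * v j)\<^sup>2 / a k k = (\<Sum>i\<in>I. \<Sum>j\<in>I. (a k i * v i) * (a k j * v j)) / a k k"
        by (simp only: power2_eq_square sum_product)
      also have "\<dots> = (\<Sum>i\<in>I. \<Sum>j\<in>I. a i k * a k j / a k k * (v i * v j))"
        unfolding sum_divide_distrib
      proof (intro sum.cong refl)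
        fix i j
        show "a k i * v i * (a k j * v j) / a k k = a i k * a k j / a k k * (v i * v j)"
          unfolding sym[of k i] by simp
      qed
      finally show ?thesis ..
    qed
    have pa': "0 \<le> (\<Sum>i\<in>I. \<Sum>j\<in>I. a' i j * (v i * v j))" for v
    proof -
      let ?s = "\<Sum>j\<in>I. a k j * v j"
      have "(\<Sum>i\<in>I. \<Sum>j\<in>I. a' i j * (v i * v j)) = (\<Sum>i\<in>I. \<Sum>j\<in>I. a i j * (v i * v j)) - ?s\<^sup>2 / a k k"
        unfolding sq[symmetric] sum_subtractf[symmetric] by (intro sum.cong refl) (simp add: a'_def algebra_simps)
      \<comment> \<open>This value of the coordinate \<open>k\<close> minimises the form for given
        \<open>v\<close>; the minimum is the Schur complement.\<close>
      moreover have "a k k * ((- ?s / a k k) * (- ?s / a k k)) + 2 * (- ?s / a k k) * ?s = - (?s\<^sup>2 / a k k)"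
        using kk by (simp add: field_simps power2_eq_square)
      ultimately show ?thesis using quad[of "- ?s / a k k" v] by linarith
    qed
    have "(\<Sum>i\<in>insert k I. \<Sum>j\<in>insert k I. a i j * b i j)
       
            = (\<Sum>i\<in>insert k I. \<Sum>j\<in>insert k I. a' i j * b i j) + (\<Sum>i\<in>insert k I. \<Sum>j\<in>insert k I. b i j * (a i k * a j k)) / a k k"
      unfolding sum_divide_distrib sum.distrib[symmetric]
    proof (intro sum.cong refl)
      fix i j
      show "a i j * b i j = a' i j * b i j + b i j * (a i k * a j k) / a k k"
        unfolding a'_def sym[of k j] by (simp add: algebra_simps)
    qed
    moreover have "(\<Sum>i\<in>insert k I. \<Sum>j\<in>insert k I. a' i j * b i j) = (\<Sum>i\<in>I. \<Sum>j\<in>I. a' i j * b i j)"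
      unfolding split using kk by (simp add: a'_def)
    moreover have "0 \<le> (\<Sum>i\<in>I. \<Sum>j\<in>I. a' i j * b i j)" by (rule insert.IH[OF sym' pa' pbI])
    moreover have "0 \<le> (\<Sum>i\<in>insert k I. \<Sum>j\<in>insert k I. b i j * (a i k * a j k)) / a k k"
      using pb[of "\<lambda>i. a i k"] kk by simp
    ultimately show ?thesis by linarith
  qed
qed

section \<open>From tensor norms to bounds on components\<close>

definition tensor_form :: "(4 \<Rightarrow> 4 \<Rightarrow> real) \<Rightarrow> nat \<Rightarrow> (4 list \<Rightarrow> real) \<Rightarrow> real" where
  "tensor_form E k T = (\<Sum>I\<in>idx k. \<Sum>J\<in>idx k. (\<Prod>m<k. E (I ! m) (J ! m)) * T I * T J)"

lemma tensor_form_Suc: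
  "tensor_form E (Suc k) T = (\<Sum>i\<in>UNIV. \<Sum>j\<in>UNIV. E i j *
     (\<Sum>I\<in>idx k. \<Sum>J\<in>idx k. (\<Prod>m<k. E (I ! m) (J ! m)) * T (i # I) * T (j # J)))"
proof -
  have "tensor_form E (Suc k) T = (\<Sum>i\<in>UNIV. \<Sum>I\<in>idx k. \<Sum>j\<in>UNIV. \<Sum>J\<in>idx k.
      E i j * ((\<Prod>m<k. E (I ! m) (J ! m)) * T (i # I) * T (j # J)))"
    by (simp add: tensor_form_def sum_idx_Suc prod.lessThan_Suc_shift mult.assoc del: prod.lessThan_Suc)
  also have "\<dots> = (\<Sum>i\<in>UNIV. \<Sum>j\<in>UNIV. \<Sum>I\<in>idx k. \<Sum>J\<in>idx k.
      E i j * ((\<Prod>m<k. E (I ! m) (J ! m)) * T (i # I) * T (j # J)))"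
    by (intro sum.cong refl sum.swap)
  finally show ?thesis by (simp only: sum_distrib_left)
qed

text \<open>Split off the first index. The form pairs \<open>E\<close> with the Gram matrix
  \<open>B\<close> of the slices of \<open>T\<close>, positive semidefinite by the induction
  hypothesis. Since \<open>E - \<kappa>\<close> times the identity is positive semidefinite as well,
  the pairing is at least \<kappa> times the trace of \<open>B\<close>, and each diagonal entry of
  \<open>B\<close> is the form of one slice.\<close>

lemma tensor_form_lower_bound:
  assumes sym: "\<And>i j. E i j = E j i" and \<kappa>: "\<kappa> > 0"
    and low: "\<And>v. \<kappa> * (\<Sum>i\<in>UNIV. (v i)\<^sup>2) \<le> (\<Sum>i\<in>UNIV. \<Sum>j\<in>UNIV. E i j * (v i * v j))"
  shows "\<kappa> ^ k * (\<Sum>I\<in>idx k. (T I)\<^sup>2) \<le> tensor_form E k T"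
proof (induction k arbitrary: T)
  case 0
  then show ?case by (simp add: tensor_form_def idx_0 power2_eq_square)
next
  case (Suc k)
  define B where "B i j = (\<Sum>I\<in>idx k. \<Sum>J\<in>idx k. (\<Prod>m<k. E (I ! m) (J ! m)) * T (i # I) * T (j # J))" for i j
  have Bv: "(\<Sum>i\<in>UNIV. \<Sum>j\<in>UNIV. B i j * (v i * v j)) = tensor_form E k (\<lambda>I. \<Sum>i\<in>UNIV. v i * T (i # I))" for v
  proof -
    have "tensor_form E k (\<lambda>I. \<Sum>i\<in>UNIV. v i * T (i # I))
       
            = (\<Sum>I\<in>idx k. \<Sum>J\<in>idx k. \<Sum>i\<in>UNIV. \<Sum>j\<in>UNIV. (\<Prod>m<k. E (I ! m) (J ! m)) * ((v i * T (i # I)) * (v j * T (j # J))))"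
      unfolding tensor_form_def mult.assoc sum_product by (simp only: sum_distrib_left)
    also have "\<dots>
        = (\<Sum>I\<in>idx k. \<Sum>i\<in>UNIV. \<Sum>j\<in>UNIV. \<Sum>J\<in>idx k. (\<Prod>m<k. E (I ! m) (J ! m)) * ((v i * T (i # I)) * (v j * T (j # J))))"
    proof (rule sum.cong[OF refl])
      fix I
      show "(\<Sum>J\<in>idx k. \<Sum>i\<in>UNIV. \<Sum>j\<in>UNIV. (\<Prod>m<k. E (I ! m) (J ! m)) * ((v i * T (i # I)) * (v j * T (j # J))))
        = (\<Sum>i\<in>UNIV. \<Sum>j\<in>UNIV. \<Sum>J\<in>idx k. (\<Prod>m<k. E (I ! m) (J ! m)) * ((v i * T (i # I)) * (v j * T (j # J))))"
        by (subst sum.swap) (intro sum.cong refl sum.swap)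
    qed
    also have "\<dots>
        = (\<Sum>i\<in>UNIV. \<Sum>j\<in>UNIV. \<Sum>I\<in>idx k. \<Sum>J\<in>idx k. (\<Prod>m<k. E (I ! m) (J ! m)) * ((v i * T (i # I)) * (v j * T (j # J))))"
      by (subst sum.swap) (intro sum.cong refl sum.swap)
    also have "\<dots> = (\<Sum>i\<in>UNIV. \<Sum>j\<in>UNIV. B i j * (v i * v j))"
      unfolding B_def sum_distrib_right by (intro sum.cong refl) (simp add: mult_ac)
    finally show ?thesis ..
  qed
  have Bpos: "0 \<le> (\<Sum>i\<in>UNIV. \<Sum>j\<in>UNIV. B i j * (v i * v j))" for v
  proof -
    have "0 \<le> \<kappa> ^ k * (\<Sum>I\<in>idx k. (\<Sum>i\<in>UNIV. v i * T (i # I))\<^sup>2)"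
      using \<kappa> by (intro mult_nonneg_nonneg sum_nonneg) auto
    also note Suc.IH
    finally show ?thesis unfolding Bv .
  qed
  define a where "a i j = E i j - (if i = j then \<kappa> else 0)" for i j
  have delta: "(\<Sum>i\<in>UNIV. \<Sum>j\<in>UNIV. (if i = j then \<kappa> else 0) * f i j) = \<kappa> * (\<Sum>i\<in>UNIV. f i i)" for f :: "4 \<Rightarrow> 4 \<Rightarrow> real"
  proof -
    have "(\<Sum>j\<in>UNIV. (if i = j then \<kappa> else 0) * f i j) = \<kappa> * f i i" for i
    proof -
      have "(\<Sum>j\<in>UNIV. (if i = j then \<kappa> else 0) * f i j) = (\<Sum>j\<in>UNIV. if i = j then \<kappa> * f i j else 0)"
        by (intro sum.cong refl) auto
      then show ?thesis by simp
    qed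
    then show ?thesis by (simp add: sum_distrib_left)
  qed
  have apos: "0 \<le> (\<Sum>i\<in>UNIV. \<Sum>j\<in>UNIV. a i j * (v i * v j))" for v
  proof -
    have "(\<Sum>i\<in>UNIV. \<Sum>j\<in>UNIV. a i j * (v i * v j))
        = (\<Sum>i\<in>UNIV. \<Sum>j\<in>UNIV. E i j * (v i * v j)) - \<kappa> * (\<Sum>i\<in>UNIV. v i * v i)"
      unfolding delta[of "\<lambda>i j. v i * v j", symmetric] sum_subtractf[symmetric] by (intro sum.cong refl) (simp only: a_def left_diff_distrib)
    then show ?thesis using low[of v] by (simp add: power2_eq_square)
  qed
  have "0 \<le> (\<Sum>i\<in>UNIV. \<Sum>j\<in>UNIV. a i j * B i j)"
    by (rule psd_trace_nonneg[OF finite _ apos Bpos]) (simp add: a_def sym)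
  also have "(\<Sum>i\<in>UNIV. \<Sum>j\<in>UNIV. a i j * B i j) = tensor_form E (Suc k) T - \<kappa> * (\<Sum>i\<in>UNIV. B i i)"
    unfolding delta[of B, symmetric] tensor_form_Suc B_def[symmetric] sum_subtractf[symmetric]
    by (intro sum.cong refl) (simp only: a_def left_diff_distrib)
  finally have 1: "\<kappa> * (\<Sum>i\<in>UNIV. B i i) \<le> tensor_form E (Suc k) T" by simp
  have "\<kappa> ^ Suc k * (\<Sum>I\<in>idx (Suc k). (T I)\<^sup>2) = \<kappa> * (\<Sum>i\<in>UNIV. \<kappa> ^ k * (\<Sum>I\<in>idx k. (T (i # I))\<^sup>2))"
    by (simp add: sum_idx_Suc sum_distrib_left mult.assoc)
  also have "\<dots> \<le> \<kappa> * (\<Sum>i\<in>UNIV. B i i)"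
  proof (intro mult_left_mono sum_mono)
    fix i
    show "\<kappa> ^ k * (\<Sum>I\<in>idx k. (T (i # I))\<^sup>2) \<le> B i i"
      using Suc.IH[of "\<lambda>I. T (i # I)"] by (simp add: B_def tensor_form_def)
  qed (use \<kappa> in simp)
  also note 1
  finally show ?case .
qed

lemma component_le_tnorm:
  assumes sym: "\<And>i j. inv_metric e c p i j = inv_metric e c p j i" and \<kappa>: "\<kappa> > 0"
    and low: "\<And>v. \<kappa> * (\<Sum>i\<in>UNIV. (v i)\<^sup>2) \<le> (\<Sum>i\<in>UNIV. \<Sum>j\<in>UNIV. inv_metric e c p i j * (v i * v j))"
    and I: "I \<in> idx k"
  shows "\<bar>T c p I\<bar> \<le> tnorm e k T c p / sqrt (\<kappa> ^ k)"
proof -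
  have "\<kappa> ^ k * (T c p I)\<^sup>2 \<le> \<kappa> ^ k * (\<Sum>I\<in>idx k. (T c p I)\<^sup>2)"
    using \<kappa> I by (intro mult_left_mono member_le_sum) auto
  also have "\<dots> \<le> tensor_form (inv_metric e c p) k (T c p)"
    by (rule tensor_form_lower_bound[OF sym \<kappa> low])
  finally have "sqrt (\<kappa> ^ k * (T c p I)\<^sup>2) \<le> tnorm e k T c p"
    unfolding tnorm_def tensor_form_def by (rule real_sqrt_le_mono)
  then show ?thesis using \<kappa> by (simp add: real_sqrt_mult pos_le_divide_eq mult.commute)
qed

subsection \<open>Inverse matrices\<close>

lemma matrix_inv_both:
  fixes M :: "real^4^4"
  assumes "det M \<noteq> 0"
  shows "M ** matrix_inv M = mat 1" "matrix_inv M ** M = mat 1"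
proof -
  have "\<exists>N. M ** N = mat 1 \<and> N ** M = mat 1" using assms by (simp add: invertible_det_nz flip: invertible_def)
  from someI_ex[OF this] show "M ** matrix_inv M = mat 1" "matrix_inv M ** M = mat 1"
    by (simp_all add: matrix_inv_def)
qed

lemma matrix_inv_symmetric:
  fixes M :: "real^4^4"
  assumes "det M \<noteq> 0" "transpose M = M"
  shows "transpose (matrix_inv M) = matrix_inv M"
proof -
  let ?N = "matrix_inv M"
  have "transpose ?N ** M = mat 1"
    using matrix_inv_both(1)[OF assms(1)] assms(2) by (metis matrix_transpose_mul transpose_mat)
  then have "transpose ?N ** (M ** ?N) = ?N" by (simp add: matrix_mul_assoc)
  then show ?thesis by (simp add: matrix_inv_both(1)[OF assms(1)])
qed

text \<open>Cramer's rule: every entry of the inverse is a quotient of determinants of smooth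
  matrices.\<close>

lemma smooth_on_matrix_inv:
  fixes M :: "real^4 \<Rightarrow> real^4^4"
  assumes S: "open S" and M: "\<And>i j. smooth_on S (\<lambda>x. M x $ i $ j)" and d: "\<And>x. x \<in> S \<Longrightarrow> det (M x) \<noteq> 0"
  shows "smooth_on S (\<lambda>x. matrix_inv (M x) $ k $ j)"
proof -
  let ?C = "\<lambda>x. (\<chi> i l. if l = k then axis j 1 $ i else M x $ i $ l) :: real^4^4"
  have sC: "smooth_on S (\<lambda>x. det (?C x))"
  proof (rule smooth_on_det[OF S])
    fix i l show "smooth_on S (\<lambda>x. ?C x $ i $ l)"
      by (cases "l = k") (simp_all add: smooth_on_const M)
  qed
  have "smooth_on S (\<lambda>x. det (?C x) * inverse (det (M x)))"
    by (intro smooth_on_mult smooth_on_inverse smooth_on_det S sC M d)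
  then show ?thesis
  proof (rule smooth_on_cong[OF S, rotated])
    fix x assume x: "x \<in> S"
    have "M x *v (matrix_inv (M x) *v axis j 1) = axis j 1"
      by (simp add: matrix_vector_mul_assoc matrix_inv_both(1)[OF d[OF x]])
    then have "matrix_inv (M x) *v axis j 1 = (\<chi> k. det (\<chi> i l. if l = k then axis j 1 $ i else M x $ i $ l) / det (M x))"
      using cramer[OF d[OF x]] by blast
    then have "(matrix_inv (M x) *v axis j 1) $ k = det (?C x) / det (M x)" by simp
    moreover have "(matrix_inv (M x) *v axis j 1) $ k = matrix_inv (M x) $ k $ j"
      by (simp add: matrix_vector_mult_basis column_def)
    ultimately show "det (?C x) * inverse (det (M x)) = matrix_inv (M x) $ k $ j" by (simp add: divide_inverse)
  qed
qed

text \<open>With w = M^-1 u, positivity of \<open>M\<close> at w - u/N gives 0 <= u.w - (2/N) u.u +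
  (1/N^2) u.Mu. As \<open>M\<close> has sixteen entries of size at most N/16, u.Mu is at most N u.u,
  and the bound follows without eigenvalues.\<close>

lemma inverse_form_lower_bound:
  fixes M :: "real^4^4"
  assumes det: "det M \<noteq> 0" and sym: "transpose M = M" and pos: "\<And>v. v \<noteq> 0 \<Longrightarrow> 0 < v \<bullet> (M *v v)"
    and N: "N > 0" and bound: "\<And>i j. 16 * \<bar>M $ i $ j\<bar> \<le> N"
  shows "(1 / N) * (\<Sum>i\<in>UNIV. (v i)\<^sup>2) \<le> (\<Sum>i\<in>UNIV. \<Sum>j\<in>UNIV. matrix_inv M $ i $ j * (v i * v j))"
proof -
  define u :: "real^4" where "u = (\<chi> i. v i)"
  define w where "w = matrix_inv M *v u"
  have Mw: "M *v w = u" by (simp add: w_def matrix_vector_mul_assoc matrix_inv_both(1)[OF det])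
  have uu: "u \<bullet> u = (\<Sum>i\<in>UNIV. (v i)\<^sup>2)" by (simp add: u_def inner_vec_def power2_eq_square)
  have uw: "u \<bullet> w = (\<Sum>i\<in>UNIV. \<Sum>j\<in>UNIV. matrix_inv M $ i $ j * (v i * v j))"
    by (simp add: u_def w_def inner_vec_def matrix_vector_mult_def sum_distrib_left mult_ac)
  have adj: "x \<bullet> (M *v y) = (M *v x) \<bullet> y" for x y
    using dot_lmul_matrix[of x M y] sym by (metis transpose_matrix_vector)
  have uMu: "u \<bullet> (M *v u) \<le> N * (u \<bullet> u)"
  proof -
    have "u \<bullet> (M *v u) = (\<Sum>i\<in>UNIV. \<Sum>j\<in>UNIV. M $ i $ j * (u $ i * u $ j))"
      by (simp add: inner_vec_def matrix_vector_mult_def sum_distrib_left mult_ac)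
    also have "\<dots> \<le> (\<Sum>i\<in>(UNIV::4 set). \<Sum>j\<in>(UNIV::4 set). (N / 16) * (u \<bullet> u))"
    proof (intro sum_mono)
      fix i j
      have "\<bar>u $ i\<bar> * \<bar>u $ j\<bar> \<le> norm u * norm u" by (intro mult_mono component_le_norm_cart) auto
      then have "\<bar>u $ i * u $ j\<bar> \<le> u \<bullet> u" by (simp add: abs_mult power2_norm_eq_inner[symmetric] power2_eq_square)
      moreover have "\<bar>M $ i $ j\<bar> \<le> N / 16" using bound[of i j] by simp
      ultimately have "\<bar>M $ i $ j\<bar> * \<bar>u $ i * u $ j\<bar> \<le> (N / 16) * (u \<bullet> u)" using N by (intro mult_mono) auto
      then show "M $ i $ j * (u $ i * u $ j) \<le> (N / 16) * (u \<bullet> u)"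
        unfolding abs_mult[symmetric] by (rule order_trans[OF abs_ge_self])
    qed
    also have "\<dots> = N * (u \<bullet> u)" by simp
    finally show ?thesis .
  qed
  let ?t = "1 / N"
  have "0 \<le> (w - ?t *\<^sub>R u) \<bullet> (M *v (w - ?t *\<^sub>R u))"
    using pos[of "w - ?t *\<^sub>R u"] by (cases "w - ?t *\<^sub>R u = 0") auto
  also have "\<dots> = u \<bullet> w - 2 * ?t * (u \<bullet> u) + ?t\<^sup>2 * (u \<bullet> (M *v u))"
    using adj[of w u]
    by (simp add: matrix_vector_mult_diff_distrib matrix_vector_mult_scaleR Mw inner_diff_left inner_diff_right
        inner_commute power2_eq_square algebra_simps)
  also have "\<dots> \<le> u \<bullet> w - 2 * ?t * (u \<bullet> u) + ?t\<^sup>2 * (N * (u \<bullet> u))"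
    using uMu by (intro add_left_mono mult_left_mono) auto
  also have "\<dots> = u \<bullet> w - ?t * (u \<bullet> u)" using N by (simp add: power2_eq_square field_simps)
  finally show ?thesis unfolding uu uw by simp
qed

lemma ex_uniform_bound:
  fixes f :: "'i::finite \<Rightarrow> real^4 \<Rightarrow> real"
  assumes K: "compact K" and f: "\<And>i. continuous_on K (f i)"
  shows "\<exists>C>0. \<forall>i. \<forall>x\<in>K. \<bar>f i x\<bar> \<le> C"
proof -
  have "continuous_on K (\<lambda>x. \<Sum>i\<in>UNIV. \<bar>f i x\<bar>)" by (intro continuous_on_sum continuous_on_rabs f)
  then have "bounded ((\<lambda>x. \<Sum>i\<in>UNIV. \<bar>f i x\<bar>) ` K)" using K by (intro compact_imp_bounded compact_continuous_image)
  then obtain C where C: "C > 0" "\<forall>y\<in>(\<lambda>x. \<Sum>i\<in>UNIV. \<bar>f i x\<bar>) ` K. norm y \<le> C"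
    unfolding bounded_pos by (elim exE conjE)
  have "\<bar>f i x\<bar> \<le> C" if "x \<in> K" for i x
  proof -
    have "\<bar>f i x\<bar> \<le> (\<Sum>i\<in>UNIV. \<bar>f i x\<bar>)" by (rule member_le_sum) auto
    also have "\<dots> \<le> C" using C(2) that by (fastforce intro: order_trans[OF abs_ge_self])
    finally show ?thesis .
  qed
  then show ?thesis using C(1) by blast
qed

lemma mat_of_symmetric: "(\<And>i j. T c p [i, j] = T c p [j, i]) \<Longrightarrow> transpose (mat_of T c p) = mat_of T c p"
  by (simp add: transpose_def mat_of_def vec_eq_iff)

lemma inv_metric_sym:
  assumes "det (mat_of T c p) \<noteq> 0" "\<And>i j. T c p [i, j] = T c p [j, i]"
  shows "inv_metric T c p i j = inv_metric T c p j i"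
proof -
  have "transpose (matrix_inv (mat_of T c p)) $ i $ j = matrix_inv (mat_of T c p) $ i $ j"
    by (simp only: matrix_inv_symmetric[OF assms(1) mat_of_symmetric[of T c p, OF assms(2)]])
  then show ?thesis by (simp add: inv_metric_def transpose_def)
qed

lemma inv_metric_mult:
  assumes "det (mat_of T c p) \<noteq> 0"
  shows "(\<Sum>k\<in>UNIV. inv_metric T c p i k * T c p [k, j]) = (if i = j then 1 else 0)"
proof -
  have "(matrix_inv (mat_of T c p) ** mat_of T c p) $ i $ j = mat 1 $ i $ j"
    by (simp only: matrix_inv_both(2)[OF assms])
  then show ?thesis by (simp add: matrix_matrix_mult_def mat_of_def inv_metric_def mat_def)
qed

lemma det_minkowski: "det minkowski \<noteq> 0"
proof -
  have "det minkowski = (\<Prod>i\<in>UNIV. minkowski $ i $ i)" by (rule det_diagonal) (simp add: minkowski_def)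
  then show ?thesis by (simp add: minkowski_def)
qed

lemma lorentzian_det:
  fixes E M :: "real^4^4"
  assumes "transpose E ** M ** E = minkowski"
  shows "det M \<noteq> 0"
  using det_minkowski arg_cong[OF assms, of det] by (auto simp: det_mul)

lemma riemannian_det:
  fixes M :: "real^4^4"
  assumes "\<And>v. v \<noteq> 0 \<Longrightarrow> 0 < v \<bullet> (M *v v)"
  shows "det M \<noteq> 0"
proof -
  have "inj ((*v) M)"
  proof (rule injI)
    fix x y assume "M *v x = M *v y"
    then have "M *v (x - y) = 0" by (simp add: matrix_vector_mult_diff_distrib)
    then show "x = y" using assms[of "x - y"] by (cases "x = y") auto
  qed
  then have "invertible M" using matrix_left_invertible_injective[of M] invertible_left_inverse[of M] by blast
  then show ?thesis by (simp add: invertible_det_nz)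
qed

subsection \<open>Bounds in a chart\<close>

context smooth_manifold
begin

lemma pd_cinv: "x \<in> cran c \<Longrightarrow> pd c i f (cinv c x) = partial i (\<lambda>y. f (cinv c y)) x"
  by (simp add: pd_def partial_def crd_cinv comp_def)

lemma smooth_inv_metric:
  assumes "smooth_cov_tensor A 2 T" "c \<in> A" "\<And>p. p \<in> cdom c \<Longrightarrow> det (mat_of T c p) \<noteq> 0"
  shows "smooth_on (cran c) (\<lambda>x. inv_metric T c (cinv c x) i j)"
  unfolding inv_metric_def
proof (rule smooth_on_matrix_inv[OF open_cran[OF assms(2)]])
  show "smooth_on (cran c) (\<lambda>x. mat_of T c (cinv c x) $ i $ j)" for i j
    using smooth_component[OF assms(1,2)] by (simp add: mat_of_def)
  show "det (mat_of T c (cinv c x)) \<noteq> 0" if "x \<in> cran c" for x by (rule assms(3)[OF cinv_cdom[OF that]])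
qed

lemma smooth_christoffel:
  assumes "smooth_cov_tensor A 2 T" "c \<in> A" "\<And>p. p \<in> cdom c \<Longrightarrow> det (mat_of T c p) \<noteq> 0"
  shows "smooth_on (cran c) (\<lambda>x. christoffel T c i j k (cinv c x))"
proof -
  have o: "open (cran c)" by (rule open_cran[OF assms(2)])
  have "smooth_on (cran c) (\<lambda>x. (1/2) * (\<Sum>l\<in>UNIV. inv_metric T c (cinv c x) i l *
     (partial j (\<lambda>y. T c (cinv c y) [l, k]) x + partial k (\<lambda>y. T c (cinv c y) [l, j]) x
      - partial l (\<lambda>y. T c (cinv c y) [j, k]) x)))"
    by (intro smooth_on_mult smooth_on_sum smooth_on_diff smooth_on_add smooth_on_const smooth_on_partial
        smooth_inv_metric smooth_component assms o)
  then show ?thesis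
    by (rule smooth_on_cong[OF o, rotated]) (simp add: christoffel_def pd_cinv)
qed

lemma riemannian_lower_bound:
  assumes e: "riemannian_metric A e" and c: "c \<in> A" and K: "compact K" "K \<subseteq> cran c"
  shows "\<exists>\<kappa>>0. \<forall>x\<in>K. \<forall>v. \<kappa> * (\<Sum>i\<in>UNIV. (v i)\<^sup>2) \<le> (\<Sum>i\<in>UNIV. \<Sum>j\<in>UNIV. inv_metric e c (cinv c x) i j * (v i * v j))"
proof -
  have se: "smooth_cov_tensor A 2 e" using e by (simp add: riemannian_metric_def)
  obtain C where C: "C > 0" "\<And>ij x. x \<in> K \<Longrightarrow> \<bar>(\<lambda>(i, j) x. e c (cinv c x) [i, j]) ij x\<bar> \<le> C"
    using ex_uniform_bound[OF K(1), of "\<lambda>(i, j) x. e c (cinv c x) [i, j]"]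
      continuous_on_subset[OF smooth_on_imp_continuous_on[OF smooth_component[OF se c]] K(2)] by fastforce
  show ?thesis
  proof (intro exI[of _ "1 / (16 * C)"] conjI ballI allI)
    show "1 / (16 * C) > 0" using C by simp
    fix x v assume x: "x \<in> K"
    then have p: "cinv c x \<in> cdom c" using K(2) by (intro cinv_cdom) blast
    have pos: "\<And>v. v \<noteq> 0 \<Longrightarrow> 0 < v \<bullet> (mat_of e c (cinv c x) *v v)"
      and sym: "\<And>i j. e c (cinv c x) [i, j] = e c (cinv c x) [j, i]"
      using e c p by (auto simp: riemannian_metric_def)
    show "1 / (16 * C) * (\<Sum>i\<in>UNIV. (v i)\<^sup>2) \<le> (\<Sum>i\<in>UNIV. \<Sum>j\<in>UNIV. inv_metric e c (cinv c x) i j * (v i * v j))"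
      unfolding inv_metric_def
    proof (rule inverse_form_lower_bound[OF riemannian_det[OF pos] mat_of_symmetric[of e c "cinv c x", OF sym] pos])
      show "16 * C > 0" using C by simp
      show "16 * \<bar>mat_of e c (cinv c x) $ i $ j\<bar> \<le> 16 * C" for i j
        using C(2)[OF x, of "(i, j)"] by (simp add: mat_of_def)
    qed
  qed
qed

text \<open>The constant depends on neither the tensor nor \<open>M\<close>, so one \<open>B\<close>
  serves all values of \<open>l\<close>; the factor \<open>M\<close> later carries \<open>l\<close>
  for the perturbation and 1 for its derivative.\<close>

lemma component_bound:
  assumes e: "riemannian_metric A e" and c: "c \<in> A" and K: "compact K" "K \<subseteq> cran c" and C: "smooth_scalar A C"
  shows "\<exists>B>0. \<forall>T M. \<forall>x\<in>K. \<forall>I\<in>idx k. 0 \<le> M \<longrightarrow> tnorm e k T c (cinv c x) \<le> M * C (cinv c x) \<longrightarrow> \<bar>T c (cinv c x) I\<bar> \<le> M * B"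
proof -
  obtain \<kappa> where \<kappa>: "\<kappa> > 0" and low: "\<And>x v. x \<in> K \<Longrightarrow> \<kappa> * (\<Sum>i\<in>UNIV. (v i)\<^sup>2) \<le> (\<Sum>i\<in>UNIV. \<Sum>j\<in>UNIV. inv_metric e c (cinv c x) i j * (v i * v j))"
    using riemannian_lower_bound[OF e c K] by blast
  have "smooth_on (cran c) (\<lambda>x. C (cinv c x))" using C c by (simp add: smooth_scalar_def comp_def)
  then obtain B where B: "B > 0" "\<And>x. x \<in> K \<Longrightarrow> \<bar>C (cinv c x)\<bar> \<le> B"
    using ex_uniform_bound[OF K(1), of "\<lambda>(u::unit) x. C (cinv c x)"]
      continuous_on_subset[OF smooth_on_imp_continuous_on _] K(2) by blast
  define s where "s = sqrt (\<kappa> ^ k)"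
  have s: "s > 0" using \<kappa> by (simp add: s_def)
  show ?thesis
  proof (intro exI[of _ "B / s"] conjI allI ballI impI)
    show "B / s > 0" using B s by simp
    fix T M x I assume x: "x \<in> K" and I: "I \<in> idx k" and M: "0 \<le> M" and le: "tnorm e k T c (cinv c x) \<le> M * C (cinv c x)"
    have p: "cinv c x \<in> cdom c" using x K(2) by (intro cinv_cdom) blast
    have pos: "\<And>v. v \<noteq> 0 \<Longrightarrow> 0 < v \<bullet> (mat_of e c (cinv c x) *v v)"
      and sym: "\<And>i j. e c (cinv c x) [i, j] = e c (cinv c x) [j, i]"
      using e c p by (auto simp: riemannian_metric_def)
    have "\<bar>T c (cinv c x) I\<bar> \<le> tnorm e k T c (cinv c x) / s"
      unfolding s_def
      by (rule component_le_tnorm[OF inv_metric_sym[OF riemannian_det[OF pos] sym] \<kappa> low[OF x] I])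
    also have "\<dots> \<le> (M * B) / s"
    proof (rule divide_right_mono)
      have "M * C (cinv c x) \<le> M * B" using B(2)[OF x] M by (intro mult_left_mono) auto
      then show "tnorm e k T c (cinv c x) \<le> M * B" using le by simp
    qed (use s in simp)
    finally show "\<bar>T c (cinv c x) I\<bar> \<le> M * (B / s)" by simp
  qed
qed

text \<open>The hypotheses bound the covariant derivative. It differs from the partial derivative by
  background Christoffel symbols times components of the perturbation, which for l < 1 are bounded
  independently of \<open>l\<close>.\<close>

lemma perturbation_bounds:
  assumes g: "\<And>l. l \<ge> 0 \<Longrightarrow> smooth_cov_tensor A 2 (g l)"
    and nd: "\<And>p. p \<in> cdom c \<Longrightarrow> det (mat_of (g 0) c p) \<noteq> 0"
    and e: "riemannian_metric A e" and C1: "smooth_scalar A C1" and C2: "smooth_scalar A C2"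
    and b1: "\<And>l p. l > 0 \<Longrightarrow> p \<in> cdom c \<Longrightarrow> tnorm e 2 (perturbation g l) c p \<le> l * C1 p"
    and b2: "\<And>l p. l > 0 \<Longrightarrow> p \<in> cdom c \<Longrightarrow> tnorm e 3 (cov_deriv (g 0) (perturbation g l)) c p \<le> C2 p"
    and c: "c \<in> A" and K: "compact K" "K \<subseteq> cran c"
  shows "\<exists>H>0. \<forall>l x i j k. 0 < l \<longrightarrow> x \<in> K \<longrightarrow> \<bar>g l c (cinv c x) [i, j] - g 0 c (cinv c x) [i, j]\<bar> \<le> l * H \<and>
    (l < 1 \<longrightarrow> \<bar>partial k (\<lambda>x. g l c (cinv c x) [i, j] - g 0 c (cinv c x) [i, j]) x\<bar> \<le> H)"
proof -
  obtain B1 where B1: "B1 > 0" "\<forall>T M. \<forall>x\<in>K. \<forall>I\<in>idx 2. 0 \<le> M \<longrightarrow> tnorm e 2 T c (cinv c x) \<le> M * C1 (cinv c x) \<longrightarrow> \<bar>T c (cinv c x) I\<bar> \<le> M * B1"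
    using component_bound[OF e c K C1, of 2] by (elim exE conjE)
  obtain B2 where B2: "B2 > 0" "\<forall>T M. \<forall>x\<in>K. \<forall>I\<in>idx 3. 0 \<le> M \<longrightarrow> tnorm e 3 T c (cinv c x) \<le> M * C2 (cinv c x) \<longrightarrow> \<bar>T c (cinv c x) I\<bar> \<le> M * B2"
    using component_bound[OF e c K C2, of 3] by (elim exE conjE)
  have sg0: "smooth_cov_tensor A 2 (g 0)" by (rule g) simp
  obtain Cg where Cg: "Cg > 0" "\<And>ijk x. x \<in> K \<Longrightarrow> \<bar>(\<lambda>(i, j, k) x. christoffel (g 0) c i j k (cinv c x)) ijk x\<bar> \<le> Cg"
    using ex_uniform_bound[OF K(1), of "\<lambda>(i, j, k) x. christoffel (g 0) c i j k (cinv c x)"]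
      continuous_on_subset[OF smooth_on_imp_continuous_on[OF smooth_christoffel[OF sg0 c nd]] K(2)] by fastforce
  \<comment> \<open>The 8 counts two Christoffel terms for each of the four values of the summed
    index.\<close>
  define H where "H = B1 + B2 + 8 * (Cg * B1)"
  have H: "H > 0" "B1 \<le> H" "B2 + 8 * (Cg * B1) \<le> H" using B1 B2 Cg by (simp_all add: H_def add_pos_pos)
  show ?thesis
  proof (intro exI[of _ H] conjI H(1) allI impI)
    fix l x i j k assume l: "0 < (l::real)" and x: "x \<in> K"
    have p: "cinv c x \<in> cdom c" and xr: "x \<in> cran c" using x K(2) by (auto intro: cinv_cdom)
    have h: "\<bar>perturbation g l c (cinv c x) [i, j]\<bar> \<le> l * B1" for i j
      by (rule B1(2)[rule_format]) (use x idx_2[of i j] b1[OF l p] l in simp_all)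
    show "\<bar>g l c (cinv c x) [i, j] - g 0 c (cinv c x) [i, j]\<bar> \<le> l * H"
      by (rule order_trans[OF h[unfolded perturbation_def] mult_left_mono[OF H(2)]]) (use l in simp)
    assume l1: "l < 1"
    have "\<bar>cov_deriv (g 0) (perturbation g l) c (cinv c x) [k, i, j]\<bar> \<le> 1 * B2"
      by (rule B2(2)[rule_format]) (use x b2[OF l p] in \<open>simp_all add: idx_def\<close>)
    moreover have "cov_deriv (g 0) (perturbation g l) c (cinv c x) [k, i, j]
        = partial k (\<lambda>x. g l c (cinv c x) [i, j] - g 0 c (cinv c x) [i, j]) x
          - (\<Sum>m\<in>UNIV. christoffel (g 0) c m k i (cinv c x) * perturbation g l c (cinv c x) [m, j]
             + christoffel (g 0) c m k j (cinv c x) * perturbation g l c (cinv c x) [i, m])"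
      by (simp add: Let_def cov_deriv_def pd_cinv[OF xr] perturbation_def numeral_2_eq_2 sum.distrib)
    moreover have "\<bar>\<Sum>m\<in>UNIV. christoffel (g 0) c m k i (cinv c x) * perturbation g l c (cinv c x) [m, j]
             + christoffel (g 0) c m k j (cinv c x) * perturbation g l c (cinv c x) [i, m]\<bar> \<le> (\<Sum>m\<in>(UNIV::4 set). 2 * (Cg * B1))"
    proof (intro order_trans[OF sum_abs] sum_mono)
      fix m
      have hb: "\<bar>perturbation g l c (cinv c x) [a, b]\<bar> \<le> B1" for a b
      proof -
        have "l * B1 \<le> 1 * B1" using l1 B1(1) by (intro mult_right_mono) auto
        then show ?thesis using h[of a b] by simp
      qed
      have "\<bar>christoffel (g 0) c m k a (cinv c x) * perturbation g l c (cinv c x) [b, d]\<bar> \<le> Cg * B1" for a b d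
        unfolding abs_mult using Cg(2)[OF x, of "(m, k, a)"] hb[of b d] Cg(1) by (intro mult_mono) auto
      from this[of i m j] this[of j i m]
      show "\<bar>christoffel (g 0) c m k i (cinv c x) * perturbation g l c (cinv c x) [m, j]
             + christoffel (g 0) c m k j (cinv c x) * perturbation g l c (cinv c x) [i, m]\<bar> \<le> 2 * (Cg * B1)" by linarith
    qed
    ultimately show "\<bar>partial k (\<lambda>x. g l c (cinv c x) [i, j] - g 0 c (cinv c x) [i, j]) x\<bar> \<le> H"
      using H(3) by simp
  qed
qed

end

text \<open>Each of the sixteen terms changes by at most
  \<open>2 * \<epsilon> * (norm v + 1) * B\<close> from moving the vector and
  \<open>(norm v + 1)^2 * \<delta>\<close> from moving the form. The total is at most 1/4, less than
  the margin 1/2.\<close>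

lemma timelike_stable:
  fixes q :: "4 \<Rightarrow> 4 \<Rightarrow> real" and q' :: "4 \<Rightarrow> 4 \<Rightarrow> real" and v w :: "real^4"
  assumes v: "(\<Sum>i\<in>UNIV. \<Sum>j\<in>UNIV. v $ i * v $ j * q i j) \<le> - 1/2"
    and w: "norm (w - v) \<le> \<epsilon>" "\<epsilon> \<le> 1" and q: "\<And>i j. \<bar>q i j\<bar> \<le> B" and d: "\<And>i j. \<bar>q' i j - q i j\<bar> \<le> \<delta>"
    and small: "16 * (2 * \<epsilon> * (norm v + 1) * B + (norm v + 1)\<^sup>2 * \<delta>) \<le> 1/4"
  shows "(\<Sum>i\<in>UNIV. \<Sum>j\<in>UNIV. w $ i * w $ j * q' i j) < 0"
proof -
  let ?W = "norm v + 1"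
  have nw: "norm w \<le> ?W" using norm_triangle_ineq[of v "w - v"] w by simp
  have B0: "0 \<le> B" using order_trans[OF abs_ge_zero q] .
  have e0: "0 \<le> \<epsilon>" using order_trans[OF norm_ge_zero w(1)] .
  have c: "\<bar>w $ i\<bar> \<le> ?W" "\<bar>v $ i\<bar> \<le> ?W" "\<bar>w $ i - v $ i\<bar> \<le> \<epsilon>" for i
    using component_le_norm_cart[of w i] component_le_norm_cart[of v i] component_le_norm_cart[of "w - v" i] nw w(1) by auto
  have t: "w $ i * w $ j * q' i j - v $ i * v $ j * q i j \<le> 2 * \<epsilon> * ?W * B + ?W\<^sup>2 * \<delta>" for i j
  proof -
    have "w $ i * w $ j * q' i j - v $ i * v $ j * q i j
        = w $ i * w $ j * (q' i j - q i j) + ((w $ i - v $ i) * w $ j + v $ i * (w $ j - v $ j)) * q i j"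
      by (simp add: algebra_simps)
    also have "\<dots> \<le> ?W * ?W * \<delta> + (\<epsilon> * ?W + ?W * \<epsilon>) * B"
    proof (rule add_mono)
      have "\<bar>w $ i * w $ j * (q' i j - q i j)\<bar> \<le> ?W * ?W * \<delta>"
        unfolding abs_mult using c d norm_ge_zero[of v] by (intro mult_mono) auto
      then show "w $ i * w $ j * (q' i j - q i j) \<le> ?W * ?W * \<delta>" by linarith
      have "\<bar>(w $ i - v $ i) * w $ j\<bar> \<le> \<epsilon> * ?W" "\<bar>v $ i * (w $ j - v $ j)\<bar> \<le> ?W * \<epsilon>"
        unfolding abs_mult using c e0 norm_ge_zero[of v] by (intro mult_mono; auto)+
      then have a: "\<bar>(w $ i - v $ i) * w $ j + v $ i * (w $ j - v $ j)\<bar> \<le> \<epsilon> * ?W + ?W * \<epsilon>" by linarith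
      have "\<bar>((w $ i - v $ i) * w $ j + v $ i * (w $ j - v $ j)) * q i j\<bar> \<le> (\<epsilon> * ?W + ?W * \<epsilon>) * B"
        unfolding abs_mult[of _ "q i j"] using order_trans[OF abs_ge_zero a] by (intro mult_mono a q) auto
      then show "((w $ i - v $ i) * w $ j + v $ i * (w $ j - v $ j)) * q i j \<le> (\<epsilon> * ?W + ?W * \<epsilon>) * B" by linarith
    qed
    finally show ?thesis by (simp add: power2_eq_square algebra_simps)
  qed
  have "(\<Sum>i\<in>UNIV. \<Sum>j\<in>UNIV. w $ i * w $ j * q' i j) - (\<Sum>i\<in>UNIV. \<Sum>j\<in>UNIV. v $ i * v $ j * q i j)
      = (\<Sum>i\<in>UNIV. \<Sum>j\<in>UNIV. w $ i * w $ j * q' i j - v $ i * v $ j * q i j)"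
    by (simp add: sum_subtractf)
  also have "\<dots> \<le> (\<Sum>i\<in>(UNIV::4 set). \<Sum>j\<in>(UNIV::4 set). 2 * \<epsilon> * ?W * B + ?W\<^sup>2 * \<delta>)"
    by (intro sum_mono t)
  also have "\<dots> = 16 * (2 * \<epsilon> * ?W * B + ?W\<^sup>2 * \<delta>)" by simp
  finally show ?thesis using small v by linarith
qed

subsection \<open>Tracelessness\<close>

theorem theorem1:
  fixes X :: "'a topology" and A :: "'a chart set"
    and g T :: "real \<Rightarrow> 'a tfield" and e \<mu> t0 :: "'a tfield"
    and \<Lambda> :: real and C1 C2 :: "'a \<Rightarrow> real"
  assumes "manifold4 X A"
    and "\<forall>l\<ge>0. lorentzian_metric A (g l)"
    and "riemannian_metric A e"
    and "\<forall>l>0. smooth_cov_tensor A 2 (T l)"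
    and "\<forall>l>0. \<forall>c\<in>A. \<forall>p\<in>cdom c. \<forall>a b.
           einstein (g l) c p a b + \<Lambda> * g l c p [a, b] = 8 * pi * T l c p [a, b]"
    and "\<forall>l>0. weak_energy_condition A (g l) (T l)"
    and "smooth_scalar A C1" and "\<forall>p\<in>topspace X. C1 p > 0"
    and "\<forall>l>0. \<forall>c\<in>A. \<forall>p\<in>cdom c. tnorm e 2 (perturbation g l) c p \<le> l * C1 p"
    and "smooth_scalar A C2" and "\<forall>p\<in>topspace X. C2 p > 0"
    and "\<forall>l>0. \<forall>c\<in>A. \<forall>p\<in>cdom c. tnorm e 3 (cov_deriv (g 0) (perturbation g l)) c p \<le> C2 p"
    and "smooth_cov_tensor A 6 \<mu>"
    and "weak_limit X A (g 0) 6 (grad_h_squared g) \<mu>"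
    and "effective_stress_energy X A \<Lambda> g T t0"
  shows "\<forall>c\<in>A. \<forall>p\<in>cdom c. metric_trace (g 0) t0 c p = 0"
proof (intro ballI)
  fix c p assume c: "c \<in> A" and p: "p \<in> cdom c"
  interpret smooth_manifold X A by unfold_locales (rule assms(1))
  have lor: "lorentzian_metric A (g l)" if "l \<ge> 0" for l using assms(2) that by blast
  have sg: "smooth_cov_tensor A 2 (g l)" if "l \<ge> 0" for l using lor[OF that] by (simp add: lorentzian_metric_def)
  have gsym: "g l c' p' [i, j] = g l c' p' [j, i]" if "l \<ge> 0" "c' \<in> A" "p' \<in> cdom c'" for l c' p' i j
    using lor[OF that(1)] that(2,3) by (simp add: lorentzian_metric_def)
  have gdet: "det (mat_of (g l) c' p') \<noteq> 0" if "l \<ge> 0" "c' \<in> A" "p' \<in> cdom c'" for l c' p'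
    using lor[OF that(1)] that(2,3) lorentzian_det unfolding lorentzian_metric_def by blast
  obtain T0 where T0: "smooth_cov_tensor A 2 T0" "weak_limit X A (g 0) 2 T T0"
    and t0: "\<forall>c\<in>A. \<forall>p\<in>cdom c. \<forall>a b. 8 * pi * t0 c p [a, b] =
             einstein (g 0) c p a b + \<Lambda> * g 0 c p [a, b] - 8 * pi * T0 c p [a, b]"
    using assms(15) unfolding effective_stress_energy_def by (elim exE conjE)
  have sT: "smooth_cov_tensor A 2 (T l)" if "l > 0" for l using assms(4) that by blast
  interpret spacetime X A "g 0"
  proof unfold_locales
    show "cov_tensor A 2 (g 0)" "smooth_comps A 2 (g 0)"
      using sg[OF order_refl] by (simp_all add: smooth_cov_tensor_def)
    show "det (mat_of (g 0) c' p') \<noteq> 0" if "c' \<in> A" "p' \<in> cdom c'" for c' p'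
      by (rule gdet[OF order_refl that])
    show "A \<noteq> {}" using c by blast
  qed
  define V where "V = cran c"
  define x0 where "x0 = crd c p"
  have oV: "open V" unfolding V_def by (rule open_cran[OF c])
  have x0V: "x0 \<in> V" using p by (simp add: V_def x0_def)
  have px0: "cinv c x0 = p" unfolding x0_def by (rule cinv_crd[OF c p])
  have pd_V: "cinv c x \<in> cdom c" if "x \<in> V" for x using that unfolding V_def by (rule cinv_cdom)
  define G where "G l i j x = g l c (cinv c x) [i, j]" for l i j x
  define Gi where "Gi l i j x = inv_metric (g l) c (cinv c x) i j" for l i j x
  have sG: "smooth_on V (G l i j)" if "l \<ge> 0" for l i j
    unfolding G_def V_def by (rule smooth_component[OF sg[OF that] c])
  have sGi: "smooth_on V (Gi l i j)" if "l \<ge> 0" for l i j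
    unfolding Gi_def V_def by (rule smooth_inv_metric[OF sg[OF that] c gdet[OF that c]])

  obtain E :: "real^4^4" where E: "transpose E ** mat_of (g 0) c p ** E = minkowski"
    using lor[OF order_refl] c p unfolding lorentzian_metric_def by blast
  \<comment> \<open>The timelike vector of an orthonormal frame at \<open>p\<close>; its components
    are then kept constant over the chart.\<close>
  define v0 where "v0 = E *v axis 0 1"
  define Q where "Q x = (\<Sum>i\<in>UNIV. \<Sum>j\<in>UNIV. v0 $ i * v0 $ j * G 0 i j x)" for x
  have "Q x0 = v0 \<bullet> (mat_of (g 0) c p *v v0)"
    by (simp add: Q_def G_def px0 inner_vec_def matrix_vector_mult_def mat_of_def sum_distrib_left mult_ac)
  also have "\<dots> = axis 0 1 \<bullet> (minkowski *v axis 0 1)"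
    unfolding v0_def E[symmetric]
    by (simp add: matrix_vector_mul_assoc[symmetric] dot_lmul_matrix[symmetric] flip: transpose_matrix_vector)
  also have "\<dots> = -1"
    by (simp add: inner_axis' matrix_vector_mult_basis column_def minkowski_def)
  finally have Q0: "Q x0 = -1" .
  have "continuous_on V Q" unfolding Q_def
    by (intro continuous_on_sum continuous_on_mult continuous_on_const smooth_on_imp_continuous_on sG order_refl)
  then have "isCont Q x0" using oV x0V continuous_on_eq_continuous_at by blast
  then obtain R1 where R1: "R1 > 0" "\<And>x. dist x x0 < R1 \<Longrightarrow> \<bar>Q x - Q x0\<bar> < 1/2"
    unfolding continuous_at_eps_delta dist_real_def by (meson half_gt_zero zero_less_one)
  obtain R2 where R2: "R2 > 0" "cball x0 R2 \<subseteq> V" using oV x0V open_contains_cball by blast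
  \<comment> \<open>Halving \<open>R1\<close> puts the closed ball of radius \<open>R\<close> inside
    the open ball on which \<open>Q\<close> stays below -1/2.\<close>
  define R where "R = min (R1 / 2) R2"
  have R: "R > 0" "R < R1" "R \<le> R2" using R1(1) R2(1) by (auto simp: R_def)
  \<comment> \<open>Four nested balls: constants are taken on the compact \<open>B\<close>, the
    analysis happens on the open \<open>U\<close>, the cutoff has its support in \<open>K'\<close>
    and is positive on the smaller \<open>K\<close>, where the test functions live.\<close>
  define B where "B = cball x0 R"
  define U where "U = ball x0 R"
  define K where "K = cball x0 (R / 4)"
  define K' where "K' = cball x0 (R / 2)"
  have B: "compact B" "B \<subseteq> V" using R R2(2) by (auto simp: B_def)
  have UB: "U \<subseteq> B" by (auto simp: U_def B_def)
  have UV: "U \<subseteq> V" using UB B(2) by (rule order_trans)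
  have oU: "open U" by (simp add: U_def)
  have KU: "K \<subseteq> U" "K \<subseteq> K'" "K' \<subseteq> U" using R(1) by (auto simp: K_def K'_def U_def)
  have cK: "compact K" "compact K'" by (simp_all add: K_def K'_def)
  have QB: "Q x \<le> -1/2" if "x \<in> B" for x
    using R1(2)[of x] that R(2) Q0 by (auto simp: B_def dist_commute abs_if split: if_splits)

  have b1: "tnorm e 2 (perturbation g l) c p \<le> l * C1 p" if "l > 0" "p \<in> cdom c" for l p
    using assms(9) c that by blast
  have b2: "tnorm e 3 (cov_deriv (g 0) (perturbation g l)) c p \<le> C2 p" if "l > 0" "p \<in> cdom c" for l p
    using assms(12) c that by blast
  obtain H where H: "H > 0" and Hb: "\<And>l x i j k. 0 < l \<Longrightarrow> x \<in> B \<Longrightarrow> \<bar>G l i j x - G 0 i j x\<bar> \<le> l * H \<and>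
      (l < 1 \<longrightarrow> \<bar>partial k (\<lambda>x. G l i j x - G 0 i j x) x\<bar> \<le> H)"
    using perturbation_bounds[OF sg gdet[OF order_refl c] assms(3,7,10) b1 b2 c B[unfolded V_def]]
    unfolding G_def by blast
  obtain Bg where Bg: "Bg > 0" "\<And>i j x. x \<in> B \<Longrightarrow> \<bar>G 0 i j x\<bar> \<le> Bg"
  proof -
    have "\<exists>C>0. \<forall>ij. \<forall>x\<in>B. \<bar>(\<lambda>(i, j). G 0 i j) ij x\<bar> \<le> C"
      by (rule ex_uniform_bound[OF B(1)])
        (auto intro!: continuous_on_subset[OF smooth_on_imp_continuous_on[OF sG] B(2)])
    then show ?thesis using that by (metis case_prod_conv)
  qed
  let ?W = "norm v0 + 1"
  have W: "?W > 0" by (simp add: add_nonneg_pos)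
  \<comment> \<open>The number 256 makes the contribution of the moving vector at most 1/128. The
    condition on \<open>l\<close> below makes that of the moving metric at most 1/128 as well, and
    16 (1/128 + 1/128) = 1/4 is what \<open>timelike_stable\<close> asks for.\<close>
  define \<epsilon> where "\<epsilon> = min 1 (1 / (256 * ?W * Bg))"
  have e: "\<epsilon> > 0" "\<epsilon> \<le> 1" "2 * \<epsilon> * ?W * Bg \<le> 1 / 128"
  proof -
    have pos: "256 * ?W * Bg > 0" using W Bg(1) by simp
    show "\<epsilon> > 0" "\<epsilon> \<le> 1" using pos by (simp_all add: \<epsilon>_def)
    have "\<epsilon> * (256 * ?W * Bg) \<le> 1 / (256 * ?W * Bg) * (256 * ?W * Bg)"
      using pos by (intro mult_right_mono) (simp_all add: \<epsilon>_def)
    also have "\<dots> = 1" by (rule nonzero_eq_divide_eq[THEN iffD1, OF less_imp_neq[OF pos, symmetric] refl])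
    finally show "2 * \<epsilon> * ?W * Bg \<le> 1 / 128" by (simp add: mult_ac)
  qed

  have small_ev: "\<forall>\<^sub>F l in at_right 0. l < a" if "a > 0" for a :: real
    using that by (auto simp: eventually_at_right_field)

  interpret M: metric_family U K G Gi
  proof unfold_locales
    show "open U" "compact K" "K \<subseteq> U" using oU cK KU by auto
    show "smooth_on U (G l i j)" if "l \<ge> 0" for l i j by (rule smooth_on_subset[OF sG[OF that] UV])
    show "smooth_on U (Gi l i j)" if "l \<ge> 0" for l i j by (rule smooth_on_subset[OF sGi[OF that] UV])
    fix l x i j assume l: "l \<ge> (0::real)" and "x \<in> U"
    then have pc: "cinv c x \<in> cdom c" using UV pd_V by blast
    show "G l i j x = G l j i x" unfolding G_def by (rule gsym[OF l c pc])
    show "Gi l i j x = Gi l j i x" unfolding Gi_def by (rule inv_metric_sym[OF gdet[OF l c pc] gsym[OF l c pc]])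
    show "(\<Sum>k\<in>UNIV. Gi l i k x * G l k j x) = (if i = j then 1 else 0)"
      unfolding Gi_def G_def by (rule inv_metric_mult[OF gdet[OF l c pc]])
  next
    have ws: "weak_setting U K" using oU cK KU by unfold_locales
    have fh: "weak_setting.family U (\<lambda>l x. G l i j x - G 0 i j x)" for i j
      unfolding weak_setting.family_def[OF ws]
      by (intro allI impI smooth_on_diff[OF oU] smooth_on_subset[OF sG UV]) auto
    show "weak_setting.unif_null U K (\<lambda>l x. G l i j x - G 0 i j x)" for i j
      unfolding weak_setting.unif_null_def[OF ws]
    proof (intro conjI fh allI impI)
      fix \<delta> :: real assume d: "\<delta> > 0"
      have "\<forall>\<^sub>F l in at_right 0. l < \<delta> / H" by (rule small_ev) (use d H in simp)
      then show "\<forall>\<^sub>F l in at_right 0. \<forall>x\<in>K. \<bar>G l i j x - G 0 i j x\<bar> \<le> \<delta>"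
        using eventually_at_right_less[of "0::real"]
      proof eventually_elim
        case (elim l)
        have "l * H \<le> \<delta>" using elim(1) H by (simp add: pos_less_divide_eq)
        then show ?case using Hb[OF elim(2)] KU(1) UB by (meson order_trans subsetD)
      qed
    qed
    show "weak_setting.unif_bounded U K (\<lambda>l. partial k (\<lambda>x. G l i j x - G 0 i j x))" for i j k
      unfolding weak_setting.unif_bounded_def[OF ws]
    proof (intro conjI weak_setting.family_partial[OF ws fh] exI[of _ H])
      have "\<forall>\<^sub>F l in at_right 0. l < (1::real)" by (rule small_ev) simp
      then show "\<forall>\<^sub>F l in at_right 0. \<forall>x\<in>K. \<bar>partial k (\<lambda>x. G l i j x - G 0 i j x) x\<bar> \<le> H"
        using eventually_at_right_less[of "0::real"]
      proof eventually_elim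
        case (elim l)
        then show ?case using Hb[OF elim(2)] KU(1) UB by (meson subsetD)
      qed
    qed
  qed

  have chr: "M.chr l i j k x = christoffel (g l) c i j k (cinv c x)" if "x \<in> V" for l i j k x
    using that unfolding V_def M.chr_def christoffel_def Gi_def G_def by (simp add: pd_cinv)
  \<comment> \<open>Agreement of the Christoffel symbols on the whole open set is needed, since the
    Ricci tensor differentiates them.\<close>
  have ric: "M.ric l a d x = ricci (g l) c (cinv c x) a d" if x: "x \<in> V" for l a d x
  proof -
    have "partial b (M.chr l i j k) x = pd c b (christoffel (g l) c i j k) (cinv c x)" for b i j k
      unfolding pd_cinv[OF x[unfolded V_def]] by (rule partial_cong[OF oV x]) (rule chr)
    then show ?thesis by (simp add: M.ric_def ricci_def riemann_def chr[OF x])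
  qed

  interpret N: matter_family U K G Gi "\<lambda>l i j x. T l c (cinv c x) [i, j]" "\<lambda>i j x. T0 c (cinv c x) [i, j]"
    \<Lambda> "bump x0 (R / 2)" K' v0 \<epsilon>
  proof unfold_locales
    show "smooth_on U (\<lambda>x. T l c (cinv c x) [i, j])" if "l > 0" for l i j
      by (rule smooth_on_subset[OF smooth_component[OF sT[OF that] c] UV[unfolded V_def]])
    show "smooth_on U (\<lambda>x. T0 c (cinv c x) [i, j])" for i j
      by (rule smooth_on_subset[OF smooth_component[OF T0(1) c] UV[unfolded V_def]])
    fix l :: real and x assume l: "l > 0" and "x \<in> U"
    then have xV: "x \<in> V" using UV by blast
    show "M.ric l a b x - 1 / 2 * (\<Sum>i\<in>UNIV. \<Sum>j\<in>UNIV. Gi l i j x * M.ric l i j x) * G l a b x + \<Lambda> * G l a b x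
        = 8 * pi * T l c (cinv c x) [a, b]" for a b
      using assms(5) l c pd_V[OF xV] unfolding ric[OF xV] G_def Gi_def
      by (simp add: einstein_def scalar_curv_def)
    fix v :: "real^4"
    have q: "v \<bullet> (mat_of S c (cinv c x) *v v) = (\<Sum>i\<in>UNIV. \<Sum>j\<in>UNIV. v $ i * v $ j * S c (cinv c x) [i, j])" for S
      by (simp add: inner_vec_def matrix_vector_mult_def mat_of_def sum_distrib_left mult_ac)
    assume "(\<Sum>i\<in>UNIV. \<Sum>j\<in>UNIV. v $ i * v $ j * G l i j x) < 0"
    then have "v \<bullet> (mat_of (g l) c (cinv c x) *v v) < 0" unfolding q G_def .
    then have "v \<bullet> (mat_of (T l) c (cinv c x) *v v) \<ge> 0"
      using assms(6) l c pd_V[OF xV] unfolding weak_energy_condition_def by blast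
    then show "(\<Sum>i\<in>UNIV. \<Sum>j\<in>UNIV. v $ i * v $ j * T l c (cinv c x) [i, j]) \<ge> 0" unfolding q .
  next
    fix \<psi> :: "real^4 \<Rightarrow> real" and i j assume \<psi>: "smooth_on UNIV \<psi>" "\<And>x. x \<notin> K' \<Longrightarrow> \<psi> x = 0"
    show "((\<lambda>l. \<integral>x. \<psi> x * T l c (cinv c x) [i, j] \<partial>lborel) \<longlongrightarrow> (\<integral>x. \<psi> x * T0 c (cinv c x) [i, j] \<partial>lborel)) (at_right 0)"
    proof (rule weak_limit_in_chart[OF T0(2) sT T0(1) c cK(2) _ \<psi>])
      show "K' \<subseteq> cran c" using KU(3) UV unfolding V_def by (rule order_trans)
    qed
  next
    show "compact K'" "K \<subseteq> K'" "K' \<subseteq> U" using cK KU by auto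
    show "smooth_on UNIV (bump x0 (R / 2))" by (rule smooth_on_bump)
    show "bump x0 (R / 2) x = 0" if "x \<notin> K'" for x
      by (rule bump_zero) (use that R(1) in \<open>auto simp: K'_def dist_norm norm_minus_commute\<close>)
    show "bump x0 (R / 2) x \<ge> 0" for x by (rule bump_nonneg)
    show "bump x0 (R / 2) x > 0" if "x \<in> K" for x
      by (rule bump_pos) (use that R(1) in \<open>auto simp: K_def dist_norm norm_minus_commute\<close>)
    show "\<epsilon> > 0" by (rule e(1))
    have "\<forall>\<^sub>F l in at_right 0. l < 1 / (128 * ?W\<^sup>2 * H)" by (rule small_ev) (use W H in simp)
    then show "\<forall>\<^sub>F l in at_right 0. \<forall>x\<in>U. \<forall>w. norm (w - v0) \<le> \<epsilon> \<longrightarrow> (\<Sum>i\<in>UNIV. \<Sum>j\<in>UNIV. w $ i * w $ j * G l i j x) < 0"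
      using eventually_at_right_less[of "0::real"]
    proof eventually_elim
      case (elim l)
      have pos: "128 * ?W\<^sup>2 * H > 0" using W H by simp
      have "l * (128 * ?W\<^sup>2 * H) \<le> 1" using elim(1) pos by (simp add: pos_less_divide_eq)
      then have d: "?W\<^sup>2 * (l * H) \<le> 1 / 128" by (simp add: mult_ac)
      show ?case
      proof (intro ballI allI impI)
        fix x and w :: "real^4" assume x: "x \<in> U" and w: "norm (w - v0) \<le> \<epsilon>"
        then have xB: "x \<in> B" using UB by blast
        show "(\<Sum>i\<in>UNIV. \<Sum>j\<in>UNIV. w $ i * w $ j * G l i j x) < 0"
        proof (rule timelike_stable[OF _ w e(2)])
          show "(\<Sum>i\<in>UNIV. \<Sum>j\<in>UNIV. v0 $ i * v0 $ j * G 0 i j x) \<le> - 1/2" using QB[OF xB] unfolding Q_def .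
          show "\<bar>G 0 i j x\<bar> \<le> Bg" for i j by (rule Bg(2)[OF xB])
          show "\<bar>G l i j x - G 0 i j x\<bar> \<le> l * H" for i j using Hb[OF elim(2) xB] by blast
          show "16 * (2 * \<epsilon> * ?W * Bg + ?W\<^sup>2 * (l * H)) \<le> 1/4" using e(3) d by simp
        qed
      qed
    qed
  qed

  have "ball x0 (R / 4) \<subseteq> K" by (auto simp: K_def)
  from N.background_trace[OF this] R(1)
  have tr: "scalar_curv (g 0) c p + 8 * pi * (\<Sum>i\<in>UNIV. \<Sum>j\<in>UNIV. inv_metric (g 0) c p i j * T0 c p [i, j]) - 4 * \<Lambda> = 0"
    unfolding ric[OF x0V] Gi_def px0 scalar_curv_def by simp
  have gg: "(\<Sum>a\<in>UNIV. \<Sum>b\<in>UNIV. inv_metric (g 0) c p a b * g 0 c p [a, b]) = 4"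
  proof -
    have "(\<Sum>b\<in>UNIV. inv_metric (g 0) c p a b * g 0 c p [a, b]) = 1" for a
    proof -
      have "(\<Sum>b\<in>UNIV. inv_metric (g 0) c p a b * g 0 c p [a, b]) = (\<Sum>b\<in>UNIV. inv_metric (g 0) c p a b * g 0 c p [b, a])"
        by (intro sum.cong refl arg_cong[where f = "\<lambda>t. _ * t"] gsym[OF order_refl c p])
      then show ?thesis using inv_metric_mult[OF gdet[OF order_refl c p], of a a] by simp
    qed
    then show ?thesis by simp
  qed
  let ?S = "scalar_curv (g 0) c p"
  let ?tT = "\<Sum>i\<in>UNIV. \<Sum>j\<in>UNIV. inv_metric (g 0) c p i j * T0 c p [i, j]"
  have t0': "8 * pi * t0 c p [a, b] = ricci (g 0) c p a b + (\<Lambda> - (1/2) * ?S) * g 0 c p [a, b] - 8 * pi * T0 c p [a, b]" for a b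
    using t0 c p by (simp add: einstein_def algebra_simps)
  have "8 * pi * metric_trace (g 0) t0 c p = (\<Sum>a\<in>UNIV. \<Sum>b\<in>UNIV. inv_metric (g 0) c p a b * (8 * pi * t0 c p [a, b]))"
    by (simp add: metric_trace_def sum_distrib_left mult_ac)
  also have "\<dots> = ?S + (\<Lambda> - (1/2) * ?S) * (\<Sum>a\<in>UNIV. \<Sum>b\<in>UNIV. inv_metric (g 0) c p a b * g 0 c p [a, b]) - 8 * pi * ?tT"
    unfolding t0' scalar_curv_def[of _ c p] sum_distrib_left sum.distrib[symmetric] sum_subtractf[symmetric]
    by (intro sum.cong refl) (simp add: algebra_simps)
  \<comment> \<open>With the metric trace 4 the expression is 4 \<Lambda> minus the scalar curvature
    minus 8 pi times the trace of \<open>T0\<close>, the negative of the left side of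
    \<open>tr\<close>.\<close>
  also have "\<dots> = 0" using tr unfolding gg by (simp add: algebra_simps)
  finally show "metric_trace (g 0) t0 c p = 0" by simp
qed

end
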